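(* Let $f \in L^2(D,F)$. The family $\{u_\varepsilon(f)\}_{\varepsilon>0}$ is bounded in $\mathcal{D}_T$ if and only if there exists $u \in \mathcal{D}_T$ satisfying $$(Au, Av)_{L^2(D,F)} = (f, Av)_{L^2(D,F)}\quad\text{for all } v \in \mathcal{D}_T .$$
   Context: Setting. $X$ is a $C^\infty$ manifold of dimension $n$ with smooth boundary, embedded in a smooth closed manifold of the same dimension; $X^\circ$ is its interior; $dx$ is a fixed volume form. $E, F$ are smooth complex vector bundles over $X$ with Hermitian metrics $(\cdot,\cdot)_x$. $A$ is a linear partial differential operator of order $m$ (with smooth coefficients) from sections of $E$ to sections of $F$ whose principal symbol is injective away from the zero section of $T^*X$. $D \subset X^\circ$ is a relatively compact domain with smooth boundary $\partial D$, and $\Gamma \subset \partial D$ is a closed subset ($\Gamma=\emptyset$ and $\Gamma=\partial D$ allowed). Fix a Dirichlet system $B_0,\dots,B_{m-1}$ of order $m-1$ on $\partial D$: each $B_j$ is a differential operator of type $E\to F_j$ and order $m_j\le m-1$ in a neighbourhood of $\partial D$, $m_i\ne m_j$ for $i\neq j$, and the principal symbols of $B_j$ restricted to the conormal bundle of $\partial D$ have rank equal to the dimension of $F_j$. Put $t(u)=\oplus_{j=0}^{m-1}B_ju$. For sections $u,v$ put $D(u,v)=(u,v)_{L^2(D,E)}+(Au,Av)_{L^2(D,F)}$, $D(u)=\sqrt{D(u,u)}$. $\mathcal{D}_T$ is the completion, with respect to the norm $D(\cdot)$, of the space of all $u\in C^\infty(\overline D,E)$ with $t(u)=0$ on $\Gamma$;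 it is a Hilbert space with scalar product $D(\cdot,\cdot)$. For $\varepsilon>0$ and $f\in L^2(D,F)$, $u_\varepsilon(f)$ denotes the unique element $u_\varepsilon\in\mathcal{D}_T$ such that $(Au_\varepsilon,Av)_{L^2(D,F)}+\varepsilon\,(u_\varepsilon,v)_{L^2(D,E)}=(f,Av)_{L^2(D,F)}$ for all $v\in\mathcal{D}_T$. *)

theory Defs
  imports "HOL-Analysis.Analysis"
begin

section \<open>Complex vector spaces\<close>

class scaleC =
  fixes scaleC :: "complex \<Rightarrow> 'a \<Rightarrow> 'a" (infixr \<open>*\<^sub>C\<close> 75)

class complex_vector = scaleC + ab_group_add +
  assumes scaleC_add_right: "a *\<^sub>C (x + y) = a *\<^sub>C x + a *\<^sub>C y"
    and scaleC_add_left: "(a + b) *\<^sub>C x = a *\<^sub>C x + b *\<^sub>C x"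
    and scaleC_scaleC: "a *\<^sub>C b *\<^sub>C x = (a * b) *\<^sub>C x"
    and scaleC_one: "1 *\<^sub>C x = x"

global_interpretation complex_vector:
  vector_space "scaleC :: complex \<Rightarrow> 'a \<Rightarrow> 'a::complex_vector"
  by unfold_locales (fact scaleC_add_right scaleC_add_left scaleC_scaleC scaleC_one)+

instantiation complex :: complex_vector
begin
definition scaleC_complex :: "complex \<Rightarrow> complex \<Rightarrow> complex"
  where "scaleC_complex a z = a * z"
instance by standard (auto simp: scaleC_complex_def algebra_simps)
end

instantiation vec :: (complex_vector, finite) complex_vector
begin
definition scaleC_vec :: "complex \<Rightarrow> 'a ^ 'b \<Rightarrow> 'a ^ 'b"
  where "scaleC_vec a v = (\<chi> i. a *\<^sub>C v $ i)"
instance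
  by standard (auto simp: scaleC_vec_def vec_eq_iff scaleC_add_right scaleC_add_left scaleC_scaleC
      scaleC_one)
end


section \<open>Smooth functions and smooth manifolds\<close>

text \<open>Only meaningful for open \<open>S\<close>: the partial derivatives are those of a function defined
  around each point of \<open>S\<close>.\<close>

primrec Ck_on :: "nat \<Rightarrow> 'v::euclidean_space set \<Rightarrow> ('v \<Rightarrow> 'w::real_normed_vector) \<Rightarrow> bool" where
  "Ck_on 0 S f \<longleftrightarrow> continuous_on S f"
| "Ck_on (Suc k) S f \<longleftrightarrow> (\<forall>x\<in>S. f differentiable (at x)) \<and>
     (\<forall>v. Ck_on k S (\<lambda>x. frechet_derivative f (at x) v))"

definition Cinf_on :: "'v::euclidean_space set \<Rightarrow> ('v \<Rightarrow> 'w::real_normed_vector) \<Rightarrow> bool" where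
  "Cinf_on S f \<longleftrightarrow> (\<forall>k. Ck_on k S f)"

text \<open>A chart is a pair (domain, coordinate map); the values of the coordinate map outside the
  domain are irrelevant.\<close>

type_synonym ('a, 'n) chart = "'a set \<times> ('a \<Rightarrow> real ^ 'n)"

abbreviation chart_dom :: "('a, 'n) chart \<Rightarrow> 'a set" where "chart_dom \<equiv> fst"
abbreviation chart_map :: "('a, 'n) chart \<Rightarrow> 'a \<Rightarrow> real ^ 'n" where "chart_map \<equiv> snd"

definition chart_inv :: "('a, 'n) chart \<Rightarrow> real ^ 'n \<Rightarrow> 'a" where
  "chart_inv c = inv_into (chart_dom c) (chart_map c)"

definition is_chart :: "('a::topological_space, 'n::finite) chart \<Rightarrow> bool" where
  "is_chart c \<longleftrightarrow> open (chart_dom c) \<and> open (chart_map c ` chart_dom c) \<and>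
     homeomorphism (chart_dom c) (chart_map c ` chart_dom c) (chart_map c) (chart_inv c)"

definition compatible :: "('a::topological_space, 'n::finite) chart \<Rightarrow> ('a, 'n) chart \<Rightarrow> bool" where
  "compatible c d \<longleftrightarrow>
     Cinf_on (chart_map d ` (chart_dom c \<inter> chart_dom d)) (chart_map c \<circ> chart_inv d) \<and>
     Cinf_on (chart_map c ` (chart_dom c \<inter> chart_dom d)) (chart_map d \<circ> chart_inv c)"

text \<open>A smooth structure on the whole space: a maximal smooth atlas.\<close>

definition smooth_structure :: "('a::topological_space, 'n::finite) chart set \<Rightarrow> bool" where
  "smooth_structure C \<longleftrightarrow>
     (\<forall>c\<in>C. is_chart c) \<and> \<Union> (chart_dom ` C) = UNIV \<and> (\<forall>c\<in>C. \<forall>d\<in>C. compatible c d) \<and>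
     (\<forall>c. is_chart c \<and> (\<forall>d\<in>C. compatible c d) \<longrightarrow> c \<in> C)"

definition closed_manifold :: "('a::{second_countable_topology,t2_space}, 'n::finite) chart set \<Rightarrow> bool"
  where "closed_manifold C \<longleftrightarrow> smooth_structure C \<and> compact (UNIV :: 'a set)"

text \<open>Smoothness on an arbitrary subset \<open>S\<close> (for instance a manifold with boundary) means that there
  are local smooth extensions.\<close>

definition smooth_on ::
    "('a::topological_space, 'n::finite) chart set \<Rightarrow> 'a set \<Rightarrow> ('a \<Rightarrow> 'w::real_normed_vector) \<Rightarrow> bool"
  where
  "smooth_on C S f \<longleftrightarrow> (\<forall>p\<in>S. \<exists>c\<in>C. p \<in> chart_dom c \<and>
     (\<exists>V g. open V \<and> chart_map c p \<in> V \<and> V \<subseteq> chart_map c ` chart_dom c \<and> Cinf_on V g \<and>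
        (\<forall>x \<in> S \<inter> chart_dom c. chart_map c x \<in> V \<longrightarrow> f x = g (chart_map c x))))"

text \<open>\<open>X\<close> is an embedded submanifold of codimension zero with smooth boundary. It need not be closed
  in the ambient manifold; its manifold interior is its topological interior.\<close>

definition manifold_with_boundary ::
    "('a::topological_space, 'n::finite) chart set \<Rightarrow> 'a set \<Rightarrow> bool" where
  "manifold_with_boundary C X \<longleftrightarrow> (\<forall>p\<in>X. p \<in> interior X \<or>
     (\<exists>c\<in>C. p \<in> chart_dom c \<and> (\<exists>l. \<forall>x\<in>chart_dom c. x \<in> X \<longleftrightarrow> chart_map c x $ l \<ge> 0)))"

definition smooth_domain ::
    "('a::topological_space, 'n::finite) chart set \<Rightarrow> 'a set \<Rightarrow> bool" where
  "smooth_domain C D \<longleftrightarrow> open D \<and> connected D \<and> (\<forall>p\<in>frontier D.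
     \<exists>c\<in>C. p \<in> chart_dom c \<and> (\<exists>l. \<forall>x\<in>chart_dom c. x \<in> D \<longleftrightarrow> chart_map c x $ l > 0))"

text \<open>A volume form is given by its coefficient \<open>\<omega> c\<close> with respect to
  \<open>dx\<^sub>1 \<and> \<dots> \<and> dx\<^sub>n\<close> in each chart \<open>c\<close>.\<close>

definition volume_form ::
    "('a::topological_space, 'n::finite) chart set \<Rightarrow> 'a set \<Rightarrow> (('a, 'n) chart \<Rightarrow> 'a \<Rightarrow> real) \<Rightarrow> bool"
  where
  "volume_form C X \<omega> \<longleftrightarrow>
     (\<forall>c\<in>C. smooth_on C (X \<inter> chart_dom c) (\<omega> c) \<and> (\<forall>x \<in> X \<inter> chart_dom c. \<omega> c x \<noteq> 0)) \<and>
     (\<forall>c\<in>C. \<forall>d\<in>C. \<forall>x \<in> X \<inter> chart_dom c \<inter> chart_dom d.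
        \<omega> d x = \<omega> c x *
          det (matrix (frechet_derivative (chart_map c \<circ> chart_inv d) (at (chart_map d x)))))"

definition volume_measure ::
    "('a::topological_space, 'n::finite) chart set \<Rightarrow> 'a set \<Rightarrow> (('a, 'n) chart \<Rightarrow> 'a \<Rightarrow> real)
      \<Rightarrow> 'a measure \<Rightarrow> bool"
  where
  "volume_measure C X \<omega> \<mu> \<longleftrightarrow> sets \<mu> = sets borel \<and>
     (\<forall>c\<in>C. \<forall>S\<in>sets borel. S \<subseteq> X \<inter> chart_dom c \<longrightarrow>
        emeasure \<mu> S =
          (\<integral>\<^sup>+y. ennreal \<bar>\<omega> c (chart_inv c y)\<bar> * indicator (chart_map c ` S) y \<partial>lborel))"

text \<open>Conormal covectors of \<open>Y\<close> at \<open>x\<close> in the coordinates of \<open>c\<close>: those annihilating all velocities of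
  curves in \<open>Y\<close> through \<open>x\<close>.\<close>

definition conormal ::
    "('a::topological_space, 'n::finite) chart \<Rightarrow> 'a set \<Rightarrow> 'a \<Rightarrow> (real ^ 'n) set" where
  "conormal c Y x = {\<xi>. \<forall>\<gamma> v. \<gamma> 0 = chart_map c x \<and>
     (\<forall>t. \<gamma> t \<in> chart_map c ` (Y \<inter> chart_dom c)) \<and> (\<gamma> has_vector_derivative v) (at (0::real))
       \<longrightarrow> \<xi> \<bullet> v = 0}"


section \<open>Vector bundles\<close>

text \<open>The fibres are subspaces of one complex vector space. This is no restriction, since the
  identification is fibrewise and need not be compatible with the smooth structure: each fibre may
  for instance be identified with a subspace of \<open>complex ^ 'k\<close>. The bundle structure is given by local frames \<open>(U, e)\<close>, that is, families
  \<open>e 0, \<dots>, e (rank - 1)\<close> of sections over \<open>U\<close> forming a basis of each fibre.\<close>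

record ('a, 'e) vbundle =
  rank :: nat
  fibre :: "'a \<Rightarrow> 'e set"
  frames :: "('a set \<times> (nat \<Rightarrow> 'a \<Rightarrow> 'e)) set"

record ('a, 'e) hermitian_bundle = "('a, 'e) vbundle" +
  metric :: "'a \<Rightarrow> 'e \<Rightarrow> 'e \<Rightarrow> complex"

definition coord ::
    "('a, 'e::complex_vector, 'z) vbundle_scheme \<Rightarrow> (nat \<Rightarrow> 'a \<Rightarrow> 'e) \<Rightarrow> 'a \<Rightarrow> 'e \<Rightarrow> nat \<Rightarrow> complex" where
  "coord E e x v i = complex_vector.representation ((\<lambda>j. e j x) ` {..<rank E}) v (e i x)"

definition vector_bundle ::
    "('a::topological_space, 'n::finite) chart set \<Rightarrow> 'a set
      \<Rightarrow> ('a, 'e::complex_vector, 'z) vbundle_scheme \<Rightarrow> bool" where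
  "vector_bundle C S E \<longleftrightarrow>
     (\<forall>x\<in>S. complex_vector.subspace (fibre E x)) \<and>
     (\<Union>(U, e)\<in>frames E. U) = S \<and>
     (\<forall>(U, e)\<in>frames E. openin (top_of_set S) U \<and>
        (\<forall>x\<in>U. inj_on (\<lambda>i. e i x) {..<rank E} \<and>
           complex_vector.independent ((\<lambda>i. e i x) ` {..<rank E}) \<and>
           complex_vector.span ((\<lambda>i. e i x) ` {..<rank E}) = fibre E x)) \<and>
     (\<forall>(U, e)\<in>frames E. \<forall>(U', e')\<in>frames E. \<forall>i<rank E. \<forall>j<rank E.
        smooth_on C (U \<inter> U') (\<lambda>x. coord E e x (e' j x) i))"

definition hermitian_vector_bundle ::
    "('a::topological_space, 'n::finite) chart set \<Rightarrow> 'a set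
      \<Rightarrow> ('a, 'e::complex_vector) hermitian_bundle \<Rightarrow> bool" where
  "hermitian_vector_bundle C S E \<longleftrightarrow> vector_bundle C S E \<and>
     (\<forall>x\<in>S. \<forall>u\<in>fibre E x. \<forall>v\<in>fibre E x.
        (\<forall>w\<in>fibre E x. metric E x (u + v) w = metric E x u w + metric E x v w) \<and>
        (\<forall>a. metric E x (a *\<^sub>C u) v = a * metric E x u v) \<and>
        metric E x u v = cnj (metric E x v u) \<and>
        (u \<noteq> 0 \<longrightarrow> Re (metric E x u u) > 0)) \<and>
     (\<forall>(U, e)\<in>frames E. \<forall>i<rank E. \<forall>j<rank E. smooth_on C U (\<lambda>x. metric E x (e i x) (e j x)))"

definition smooth_section ::
    "('a::topological_space, 'n::finite) chart set \<Rightarrow> ('a, 'e::complex_vector, 'z) vbundle_scheme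
      \<Rightarrow> 'a set \<Rightarrow> ('a \<Rightarrow> 'e) \<Rightarrow> bool" where
  "smooth_section C E S s \<longleftrightarrow> (\<forall>x\<in>S. s x \<in> fibre E x) \<and>
     (\<forall>(U, e)\<in>frames E. \<forall>i<rank E. smooth_on C (S \<inter> U) (\<lambda>x. coord E e x (s x) i))"


section \<open>Differential operators\<close>

definition partial :: "'n::finite \<Rightarrow> (real ^ 'n \<Rightarrow> complex) \<Rightarrow> real ^ 'n \<Rightarrow> complex" where
  "partial i g y = frechet_derivative g (at y) (axis i 1)"

text \<open>The order in which the partial derivatives are taken is irrelevant for smooth functions.\<close>

definition multi_partial :: "('n::finite \<Rightarrow> nat) \<Rightarrow> (real ^ 'n \<Rightarrow> complex) \<Rightarrow> real ^ 'n \<Rightarrow> complex" where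
  "multi_partial \<alpha> = foldr partial (SOME is. \<forall>i. count_list is i = \<alpha> i)"

definition local_coefficients ::
    "('a::topological_space, 'n::finite) chart set \<Rightarrow> 'a set
      \<Rightarrow> ('a, 'e::complex_vector, 'y) vbundle_scheme \<Rightarrow> ('a, 'f::complex_vector, 'z) vbundle_scheme
      \<Rightarrow> nat \<Rightarrow> (('a \<Rightarrow> 'e) \<Rightarrow> 'a \<Rightarrow> 'f)
      \<Rightarrow> ('a, 'n) chart \<Rightarrow> 'a set \<times> (nat \<Rightarrow> 'a \<Rightarrow> 'e) \<Rightarrow> 'a set \<times> (nat \<Rightarrow> 'a \<Rightarrow> 'f)
      \<Rightarrow> (('n \<Rightarrow> nat) \<Rightarrow> nat \<Rightarrow> nat \<Rightarrow> 'a \<Rightarrow> complex) \<Rightarrow> bool" where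
  "local_coefficients C S E F k P c e f a \<longleftrightarrow>
     (\<forall>\<alpha> i j. smooth_on C (S \<inter> chart_dom c \<inter> fst e \<inter> fst f) (a \<alpha> i j)) \<and>
     (\<forall>u W. open W \<and> W \<subseteq> S \<and> smooth_section C E W u \<longrightarrow>
        (\<forall>x \<in> W \<inter> chart_dom c \<inter> fst e \<inter> fst f. \<forall>i<rank F.
           coord F (snd f) x (P u x) i =
             (\<Sum>\<alpha> | sum \<alpha> UNIV \<le> k. \<Sum>j<rank E. a \<alpha> i j x *
                multi_partial \<alpha> (\<lambda>y. coord E (snd e) (chart_inv c y) (u (chart_inv c y)) j)
                  (chart_map c x))))"

text \<open>Operators of order at most \<open>k\<close> with coefficients smooth on \<open>S\<close>. An operator is a map on all
  functions, constrained only at points around which its argument is a smooth section. If \<open>S\<close> has a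
  boundary, the operator acts on sections over open sets (hence over the interior of \<open>S\<close>), but its
  coefficients are smooth up to the boundary, where they are determined by continuity.\<close>

definition diff_op ::
    "('a::topological_space, 'n::finite) chart set \<Rightarrow> 'a set
      \<Rightarrow> ('a, 'e::complex_vector, 'y) vbundle_scheme \<Rightarrow> ('a, 'f::complex_vector, 'z) vbundle_scheme
      \<Rightarrow> nat \<Rightarrow> (('a \<Rightarrow> 'e) \<Rightarrow> 'a \<Rightarrow> 'f) \<Rightarrow> bool" where
  "diff_op C S E F k P \<longleftrightarrow>
     (\<forall>u W. open W \<and> W \<subseteq> S \<and> smooth_section C E W u \<longrightarrow> (\<forall>x\<in>W. P u x \<in> fibre F x)) \<and>
     (\<forall>c\<in>C. \<forall>e\<in>frames E. \<forall>f\<in>frames F. \<exists>a. local_coefficients C S E F k P c e f a)"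

text \<open>The principal symbol of \<open>P\<close> as an operator of order \<open>k\<close>, at the covector with components \<open>\<xi>\<close> in
  the chart \<open>c\<close>, as a map from the fibre of \<open>E\<close> to the fibre of \<open>F\<close> over \<open>x\<close>. The coefficients chosen
  are unique for \<open>x\<close> in the closure of the interior of \<open>S\<close>, and the map does not depend on the
  frames.\<close>

definition principal_symbol ::
    "('a::topological_space, 'n::finite) chart set \<Rightarrow> 'a set
      \<Rightarrow> ('a, 'e::complex_vector, 'y) vbundle_scheme \<Rightarrow> ('a, 'f::complex_vector, 'z) vbundle_scheme
      \<Rightarrow> nat \<Rightarrow> (('a \<Rightarrow> 'e) \<Rightarrow> 'a \<Rightarrow> 'f)
      \<Rightarrow> ('a, 'n) chart \<Rightarrow> 'a set \<times> (nat \<Rightarrow> 'a \<Rightarrow> 'e) \<Rightarrow> 'a set \<times> (nat \<Rightarrow> 'a \<Rightarrow> 'f)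
      \<Rightarrow> 'a \<Rightarrow> real ^ 'n \<Rightarrow> 'e \<Rightarrow> 'f" where
  "principal_symbol C S E F k P c e f x \<xi> v =
     (let a = (SOME a. local_coefficients C S E F k P c e f a) in
      \<Sum>i<rank F. (\<Sum>\<alpha> | sum \<alpha> UNIV = k. \<Sum>j<rank E.
          a \<alpha> i j x * (\<Prod>l\<in>UNIV. (\<i> * complex_of_real (\<xi> $ l)) ^ \<alpha> l) * coord E (snd e) x v j)
        *\<^sub>C snd f i x)"

definition injective_symbol ::
    "('a::topological_space, 'n::finite) chart set \<Rightarrow> 'a set
      \<Rightarrow> ('a, 'e::complex_vector, 'y) vbundle_scheme \<Rightarrow> ('a, 'f::complex_vector, 'z) vbundle_scheme
      \<Rightarrow> nat \<Rightarrow> (('a \<Rightarrow> 'e) \<Rightarrow> 'a \<Rightarrow> 'f) \<Rightarrow> bool" where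
  "injective_symbol C S E F k P \<longleftrightarrow>
     (\<forall>c\<in>C. \<forall>e\<in>frames E. \<forall>f\<in>frames F. \<forall>x \<in> S \<inter> chart_dom c \<inter> fst e \<inter> fst f. \<forall>\<xi>. \<xi> \<noteq> 0 \<longrightarrow>
        inj_on (principal_symbol C S E F k P c e f x \<xi>) (fibre E x))"

text \<open>A Dirichlet system \<open>B 0, \<dots>, B (m - 1)\<close> of order \<open>m - 1\<close> on \<open>Y\<close>, where \<open>B j\<close> is of type
  \<open>E \<rightarrow> G j\<close> and of order \<open>k j\<close> in the neighbourhood \<open>N\<close> of \<open>Y\<close>.\<close>

definition dirichlet_system ::
    "('a::topological_space, 'n::finite) chart set \<Rightarrow> 'a set \<Rightarrow> 'a set \<Rightarrow> nat
      \<Rightarrow> ('a, 'e::complex_vector, 'y) vbundle_scheme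
      \<Rightarrow> (nat \<Rightarrow> ('a, 'g::complex_vector, 'z) vbundle_scheme) \<Rightarrow> (nat \<Rightarrow> nat)
      \<Rightarrow> (nat \<Rightarrow> ('a \<Rightarrow> 'e) \<Rightarrow> 'a \<Rightarrow> 'g) \<Rightarrow> bool" where
  "dirichlet_system C Y N m E G k B \<longleftrightarrow> open N \<and> Y \<subseteq> N \<and> inj_on k {..<m} \<and>
     (\<forall>j<m. vector_bundle C N (G j) \<and> k j \<le> m - 1 \<and> diff_op C N E (G j) (k j) (B j) \<and>
        (\<forall>c\<in>C. \<forall>e\<in>frames E. \<forall>g\<in>frames (G j). \<forall>x \<in> Y \<inter> chart_dom c \<inter> fst e \<inter> fst g.
           \<forall>\<xi> \<in> conormal c Y x. \<xi> \<noteq> 0 \<longrightarrow>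
             complex_vector.dim (principal_symbol C N E (G j) (k j) (B j) c e g x \<xi> ` fibre E x)
               = rank (G j)))"


section \<open>Square integrable sections\<close>

definition L2_section ::
    "'a measure \<Rightarrow> 'a set \<Rightarrow> ('a, 'e::complex_vector) hermitian_bundle \<Rightarrow> ('a \<Rightarrow> 'e) \<Rightarrow> bool" where
  "L2_section \<mu> D E f \<longleftrightarrow> (\<forall>x\<in>D. f x \<in> fibre E x) \<and>
     (\<forall>(U, e)\<in>frames E. \<forall>i<rank E. set_borel_measurable \<mu> (D \<inter> U) (\<lambda>x. coord E e x (f x) i)) \<and>
     set_integrable \<mu> D (\<lambda>x. metric E x (f x) (f x))"

definition L2_inner ::
    "'a measure \<Rightarrow> 'a set \<Rightarrow> ('a, 'e) hermitian_bundle \<Rightarrow> ('a \<Rightarrow> 'e) \<Rightarrow> ('a \<Rightarrow> 'e) \<Rightarrow> complex" where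
  "L2_inner \<mu> D E f g = (LINT x:D|\<mu>. metric E x (f x) (g x))"

definition L2_norm ::
    "'a measure \<Rightarrow> 'a set \<Rightarrow> ('a, 'e) hermitian_bundle \<Rightarrow> ('a \<Rightarrow> 'e) \<Rightarrow> real" where
  "L2_norm \<mu> D E f = sqrt (Re (L2_inner \<mu> D E f f))"

text \<open>A representative of the limit in \<open>L\<^sup>2(D, E)\<close>, which is unique up to equality almost
  everywhere.\<close>

definition L2_limit ::
    "'a measure \<Rightarrow> 'a set \<Rightarrow> ('a, 'e::complex_vector) hermitian_bundle \<Rightarrow> (nat \<Rightarrow> 'a \<Rightarrow> 'e) \<Rightarrow> 'a \<Rightarrow> 'e"
  where
  "L2_limit \<mu> D E s = (SOME g. L2_section \<mu> D E g \<and>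
     (\<lambda>n. L2_norm \<mu> D E (\<lambda>x. s n x - g x)) \<longlonglongrightarrow> 0)"


section \<open>The completion \<open>\<D>\<^sub>T\<close>\<close>

text \<open>Sections that are smooth up to the boundary of \<open>D\<close> are represented by smooth sections over some
  neighbourhood of the closure of \<open>D\<close>. Two extensions of the same section have distance zero in
  \<open>D_norm\<close> and are thus identified in the completion.\<close>

definition smooth_upto ::
    "('a::topological_space, 'n::finite) chart set \<Rightarrow> 'a set \<Rightarrow> 'a set
      \<Rightarrow> ('a, 'e::complex_vector, 'z) vbundle_scheme \<Rightarrow> ('a \<Rightarrow> 'e) set" where
  "smooth_upto C X D E =
     {u. \<exists>W. open W \<and> closure D \<subseteq> W \<and> W \<subseteq> X \<and> smooth_section C E W u}"

definition smooth_T ::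
    "('a::topological_space, 'n::finite) chart set \<Rightarrow> 'a set \<Rightarrow> 'a set \<Rightarrow> 'a set
      \<Rightarrow> ('a, 'e::complex_vector, 'z) vbundle_scheme
      \<Rightarrow> nat \<Rightarrow> (nat \<Rightarrow> ('a \<Rightarrow> 'e) \<Rightarrow> 'a \<Rightarrow> 'g::zero) \<Rightarrow> ('a \<Rightarrow> 'e) set" where
  "smooth_T C X D \<Gamma> E m B = {u \<in> smooth_upto C X D E. \<forall>j<m. \<forall>x\<in>\<Gamma>. B j u x = 0}"

definition D_inner ::
    "'a measure \<Rightarrow> 'a set \<Rightarrow> ('a, 'e) hermitian_bundle \<Rightarrow> ('a, 'f) hermitian_bundle
      \<Rightarrow> (('a \<Rightarrow> 'e) \<Rightarrow> 'a \<Rightarrow> 'f) \<Rightarrow> ('a \<Rightarrow> 'e) \<Rightarrow> ('a \<Rightarrow> 'e) \<Rightarrow> complex" where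
  "D_inner \<mu> D E F A u v = L2_inner \<mu> D E u v + L2_inner \<mu> D F (A u) (A v)"

definition D_norm ::
    "'a measure \<Rightarrow> 'a set \<Rightarrow> ('a, 'e) hermitian_bundle \<Rightarrow> ('a, 'f) hermitian_bundle
      \<Rightarrow> (('a \<Rightarrow> 'e) \<Rightarrow> 'a \<Rightarrow> 'f) \<Rightarrow> ('a \<Rightarrow> 'e) \<Rightarrow> real" where
  "D_norm \<mu> D E F A u = sqrt (Re (D_inner \<mu> D E F A u u))"

text \<open>The completion of a space \<open>S\<close> of sections with respect to a seminorm \<open>p\<close>: classes of Cauchy
  sequences modulo sequences converging to zero.\<close>

definition cauchy_seqs :: "(('a \<Rightarrow> 'e::minus) \<Rightarrow> real) \<Rightarrow> ('a \<Rightarrow> 'e) set \<Rightarrow> (nat \<Rightarrow> 'a \<Rightarrow> 'e) set" where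
  "cauchy_seqs p S = {s. range s \<subseteq> S \<and>
     (\<forall>\<epsilon>>0. \<exists>M. \<forall>i\<ge>M. \<forall>j\<ge>M. p (\<lambda>x. s i x - s j x) < \<epsilon>)}"

definition completion :: "(('a \<Rightarrow> 'e::minus) \<Rightarrow> real) \<Rightarrow> ('a \<Rightarrow> 'e) set \<Rightarrow> (nat \<Rightarrow> 'a \<Rightarrow> 'e) set set" where
  "completion p S = cauchy_seqs p S //
     {(s, t). s \<in> cauchy_seqs p S \<and> t \<in> cauchy_seqs p S \<and> (\<lambda>n. p (\<lambda>x. s n x - t n x)) \<longlonglongrightarrow> 0}"

definition D_T ::
    "('a::topological_space, 'n::finite) chart set \<Rightarrow> 'a set \<Rightarrow> 'a measure \<Rightarrow> 'a set \<Rightarrow> 'a set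
      \<Rightarrow> ('a, 'e::complex_vector) hermitian_bundle \<Rightarrow> ('a, 'f) hermitian_bundle
      \<Rightarrow> (('a \<Rightarrow> 'e) \<Rightarrow> 'a \<Rightarrow> 'f) \<Rightarrow> nat \<Rightarrow> (nat \<Rightarrow> ('a \<Rightarrow> 'e) \<Rightarrow> 'a \<Rightarrow> 'g::zero)
      \<Rightarrow> (nat \<Rightarrow> 'a \<Rightarrow> 'e) set set" where
  "D_T C X \<mu> D \<Gamma> E F A m B = completion (D_norm \<mu> D E F A) (smooth_T C X D \<Gamma> E m B)"

text \<open>The extensions by continuity to the completion of the inclusion into \<open>L\<^sup>2(D, E)\<close> and of \<open>A\<close> as a
  map into \<open>L\<^sup>2(D, F)\<close>.\<close>

definition ext_incl ::
    "'a measure \<Rightarrow> 'a set \<Rightarrow> ('a, 'e::complex_vector) hermitian_bundle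
      \<Rightarrow> (nat \<Rightarrow> 'a \<Rightarrow> 'e) set \<Rightarrow> 'a \<Rightarrow> 'e" where
  "ext_incl \<mu> D E u = L2_limit \<mu> D E (SOME s. s \<in> u)"

definition ext_op ::
    "'a measure \<Rightarrow> 'a set \<Rightarrow> ('a, 'f::complex_vector) hermitian_bundle
      \<Rightarrow> (('a \<Rightarrow> 'e) \<Rightarrow> 'a \<Rightarrow> 'f) \<Rightarrow> (nat \<Rightarrow> 'a \<Rightarrow> 'e) set \<Rightarrow> 'a \<Rightarrow> 'f" where
  "ext_op \<mu> D F A u = L2_limit \<mu> D F (\<lambda>n. A ((SOME s. s \<in> u) n))"

definition D_T_inner ::
    "'a measure \<Rightarrow> 'a set \<Rightarrow> ('a, 'e::complex_vector) hermitian_bundle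
      \<Rightarrow> ('a, 'f::complex_vector) hermitian_bundle \<Rightarrow> (('a \<Rightarrow> 'e) \<Rightarrow> 'a \<Rightarrow> 'f)
      \<Rightarrow> (nat \<Rightarrow> 'a \<Rightarrow> 'e) set \<Rightarrow> (nat \<Rightarrow> 'a \<Rightarrow> 'e) set \<Rightarrow> complex" where
  "D_T_inner \<mu> D E F A u v =
     L2_inner \<mu> D E (ext_incl \<mu> D E u) (ext_incl \<mu> D E v) +
     L2_inner \<mu> D F (ext_op \<mu> D F A u) (ext_op \<mu> D F A v)"

definition D_T_norm ::
    "'a measure \<Rightarrow> 'a set \<Rightarrow> ('a, 'e::complex_vector) hermitian_bundle
      \<Rightarrow> ('a, 'f::complex_vector) hermitian_bundle \<Rightarrow> (('a \<Rightarrow> 'e) \<Rightarrow> 'a \<Rightarrow> 'f)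
      \<Rightarrow> (nat \<Rightarrow> 'a \<Rightarrow> 'e) set \<Rightarrow> real" where
  "D_T_norm \<mu> D E F A u = sqrt (Re (D_T_inner \<mu> D E F A u u))"

definition u_eps ::
    "('a::topological_space, 'n::finite) chart set \<Rightarrow> 'a set \<Rightarrow> 'a measure \<Rightarrow> 'a set \<Rightarrow> 'a set
      \<Rightarrow> ('a, 'e::complex_vector) hermitian_bundle \<Rightarrow> ('a, 'f::complex_vector) hermitian_bundle
      \<Rightarrow> (('a \<Rightarrow> 'e) \<Rightarrow> 'a \<Rightarrow> 'f) \<Rightarrow> nat \<Rightarrow> (nat \<Rightarrow> ('a \<Rightarrow> 'e) \<Rightarrow> 'a \<Rightarrow> 'g::zero)
      \<Rightarrow> ('a \<Rightarrow> 'f) \<Rightarrow> real \<Rightarrow> (nat \<Rightarrow> 'a \<Rightarrow> 'e) set" where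
  "u_eps C X \<mu> D \<Gamma> E F A m B f \<epsilon> =
     (THE u. u \<in> D_T C X \<mu> D \<Gamma> E F A m B \<and>
        (\<forall>v \<in> D_T C X \<mu> D \<Gamma> E F A m B.
           L2_inner \<mu> D F (ext_op \<mu> D F A u) (ext_op \<mu> D F A v) +
           complex_of_real \<epsilon> * L2_inner \<mu> D E (ext_incl \<mu> D E u) (ext_incl \<mu> D E v) =
           L2_inner \<mu> D F f (ext_op \<mu> D F A v)))"

end

theory Submission
  imports Defs "HOL-Library.Function_Algebras"
begin

text \<open>
  The statement is Hilbert space theory for \<open>A\<close> as a bounded operator on \<open>\<D>\<^sub>T\<close>; the geometry only has to
  supply a Hilbert space. Write \<open>a(u, v) = (Au, Av)\<close>, \<open>b(u, v) = (u, v)\<close> and \<open>\<phi>(v) = (f, Av)\<close>, so that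
  \<open>u\<^sub>\<epsilon>\<close> is determined by \<open>a(u\<^sub>\<epsilon>, v) + \<epsilon> b(u\<^sub>\<epsilon>, v) = \<phi>(v)\<close> for all \<open>v\<close>.

  If \<open>u\<close> solves the equation with \<open>\<epsilon> = 0\<close>, then subtracting the two equations and testing with
  \<open>v = u\<^sub>\<epsilon> - u\<close> gives \<open>b(u\<^sub>\<epsilon>, u\<^sub>\<epsilon> - u) \<le> 0\<close>, whence the \<open>b\<close>-norm of \<open>u\<^sub>\<epsilon>\<close> is at most that of \<open>u\<close>.
  Testing the equation with \<open>u\<^sub>\<epsilon>\<close> itself bounds its \<open>a\<close>-norm by the norm of \<open>f\<close>, because
  \<open>\<bar>\<phi>(v)\<bar>\<close> is at most the norm of \<open>f\<close> times the \<open>a\<close>-norm of \<open>v\<close>.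

  Conversely, a bounded family would have a weakly convergent subsequence, but one can do without
  weak compactness. Subtracting the equations for \<open>\<epsilon>\<close> and \<open>\<delta>\<close> and testing with the difference gives,
  for \<open>\<delta> \<le> \<epsilon>\<close> and in the \<open>b\<close>-norm, \<open>\<parallel>u\<^sub>\<epsilon> - u\<^sub>\<delta>\<parallel>\<^sup>2 \<le> \<parallel>u\<^sub>\<delta>\<parallel>\<^sup>2 - \<parallel>u\<^sub>\<epsilon>\<parallel>\<^sup>2\<close>. The squared norms are thus monotone
  and, being bounded, convergent, so \<open>u\<^sub>\<epsilon>\<close> is Cauchy as \<open>\<epsilon> \<longlonglongrightarrow> 0\<close> (the same identity shows that the
  \<open>a\<close>-norm of the difference tends to zero). Its limit solves the equation. This argument is
  the lemma \<open>solvable_if_bounded\<close>; existence of \<open>u\<^sub>\<epsilon>\<close> is the Riesz representation theorem \<open>riesz\<close>.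

  To apply this, \<open>\<D>\<^sub>T\<close> has to be recognised as a Hilbert space in which \<open>a\<close> and \<open>b\<close> are given by the
  extensions \<open>ext_op\<close> and \<open>ext_incl\<close>. Up to null elements, \<open>\<D>\<^sub>T\<close> is the closure of the graph of \<open>A\<close>
  in \<open>L\<^sup>2(D, E) \<times> L\<^sup>2(D, F)\<close> (\<open>embed_in\<close>, \<open>embed_onto\<close>, \<open>embed_inj\<close>), so it is complete once the spaces of
  square integrable sections are (\<open>L2_complete\<close>). That the graph consists of pairs of square integrable sections
  rests on the smoothness of the coefficients of \<open>A\<close> near the closure of \<open>D\<close> and the finiteness of the volume of \<open>D\<close>
  (\<open>continuous_section_L2\<close>); that it is a linear space rests on \<open>A\<close> and the \<open>B\<^sub>j\<close> being given by partial
  derivatives in charts (\<open>op_linear\<close>).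
\<close>

section \<open>Function spaces and products as complex vector spaces\<close>

instantiation "fun" :: (type, complex_vector) complex_vector
begin
definition scaleC_fun :: "complex \<Rightarrow> ('a \<Rightarrow> 'b) \<Rightarrow> 'a \<Rightarrow> 'b"
  where "scaleC_fun a f = (\<lambda>x. a *\<^sub>C f x)"
instance
  by standard (auto simp: scaleC_fun_def fun_eq_iff scaleC_add_right scaleC_add_left scaleC_scaleC
      scaleC_one)
end

lemma scaleC_fun_apply [simp]: "(a *\<^sub>C f) x = a *\<^sub>C f x"
  by (simp add: scaleC_fun_def)

instantiation prod :: (complex_vector, complex_vector) complex_vector
begin
definition scaleC_prod :: "complex \<Rightarrow> 'a \<times> 'b \<Rightarrow> 'a \<times> 'b"
  where "scaleC_prod a p = (a *\<^sub>C fst p, a *\<^sub>C snd p)"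
instance
  by standard (auto simp: scaleC_prod_def prod_eq_iff scaleC_add_right scaleC_add_left scaleC_scaleC
      scaleC_one)
end

lemma fst_scaleC [simp]: "fst (a *\<^sub>C p) = a *\<^sub>C fst p"
  and snd_scaleC [simp]: "snd (a *\<^sub>C p) = a *\<^sub>C snd p"
  by (simp_all add: scaleC_prod_def)

section \<open>Positive semidefinite Hermitian forms\<close>

text \<open>Forms live on a subspace rather than on a type, because they are applied to spaces of
  sections and to the fibres of a bundle. They may have null vectors: sections that agree almost
  everywhere are different functions.\<close>

locale hermitian_form =
  fixes V :: "'v::complex_vector set" and ip :: "'v \<Rightarrow> 'v \<Rightarrow> complex"
  assumes subspace: "complex_vector.subspace V"
    and add_left: "u \<in> V \<Longrightarrow> v \<in> V \<Longrightarrow> w \<in> V \<Longrightarrow> ip (u + v) w = ip u w + ip v w"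
    and scale_left: "u \<in> V \<Longrightarrow> w \<in> V \<Longrightarrow> ip (a *\<^sub>C u) w = a * ip u w"
    and sym: "u \<in> V \<Longrightarrow> v \<in> V \<Longrightarrow> ip v u = cnj (ip u v)"
    and nonneg: "u \<in> V \<Longrightarrow> 0 \<le> Re (ip u u)"
begin

definition nrm :: "'v \<Rightarrow> real" where "nrm u = sqrt (Re (ip u u))"

definition cauchy :: "(nat \<Rightarrow> 'v) \<Rightarrow> bool" where
  "cauchy s \<longleftrightarrow> (\<forall>e>0. \<exists>M. \<forall>i\<ge>M. \<forall>j\<ge>M. nrm (s i - s j) < e)"

definition complete :: bool where
  "complete \<longleftrightarrow> (\<forall>s. range s \<subseteq> V \<longrightarrow> cauchy s \<longrightarrow> (\<exists>l\<in>V. (\<lambda>n. nrm (s n - l)) \<longlonglongrightarrow> 0))"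

lemma zero_in [simp]: "0 \<in> V"
  using subspace complex_vector.subspace_0 by blast

lemma add_in [simp]: "u \<in> V \<Longrightarrow> v \<in> V \<Longrightarrow> u + v \<in> V"
  using subspace complex_vector.subspace_add by blast

lemma scale_in [simp]: "u \<in> V \<Longrightarrow> a *\<^sub>C u \<in> V"
  using subspace complex_vector.subspace_scale by blast

lemma diff_in [simp]: "u \<in> V \<Longrightarrow> v \<in> V \<Longrightarrow> u - v \<in> V"
  using subspace complex_vector.subspace_diff by blast

lemma diff_left: "u \<in> V \<Longrightarrow> v \<in> V \<Longrightarrow> w \<in> V \<Longrightarrow> ip (u - v) w = ip u w - ip v w"
  using add_left[of "u - v" v w] by simp

lemma add_right: "u \<in> V \<Longrightarrow> v \<in> V \<Longrightarrow> w \<in> V \<Longrightarrow> ip w (u + v) = ip w u + ip w v"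
  using sym[of "u + v" w] sym[of u w] sym[of v w] add_left by simp

lemma diff_right: "u \<in> V \<Longrightarrow> v \<in> V \<Longrightarrow> w \<in> V \<Longrightarrow> ip w (u - v) = ip w u - ip w v"
  using sym[of "u - v" w] sym[of u w] sym[of v w] diff_left by simp

lemma scale_right: "u \<in> V \<Longrightarrow> w \<in> V \<Longrightarrow> ip w (a *\<^sub>C u) = cnj a * ip w u"
  using sym[of "a *\<^sub>C u" w] sym[of u w] scale_left by simp

lemma nrm_nonneg [simp]: "u \<in> V \<Longrightarrow> 0 \<le> nrm u"
  by (simp add: nrm_def nonneg)

lemma nrm_sq: "u \<in> V \<Longrightarrow> (nrm u)\<^sup>2 = Re (ip u u)"
  by (simp add: nrm_def nonneg)

lemma nrm_zero [simp]: "nrm 0 = 0"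
  using diff_left[of 0 0 0] by (simp add: nrm_def)

lemma ip_self: "u \<in> V \<Longrightarrow> ip u u = complex_of_real ((nrm u)\<^sup>2)"
  using sym[of u u] by (simp add: nrm_sq complex_eq_iff)

lemma nrm_add_sq:
  assumes "u \<in> V" "v \<in> V"
  shows "(nrm (u + v))\<^sup>2 = (nrm u)\<^sup>2 + (nrm v)\<^sup>2 + 2 * Re (ip u v)"
  using assms sym[of u v] by (simp add: nrm_sq add_left add_right)

lemma nrm_diff_sq:
  assumes "u \<in> V" "v \<in> V"
  shows "(nrm (u - v))\<^sup>2 = (nrm u)\<^sup>2 + (nrm v)\<^sup>2 - 2 * Re (ip u v)"
  using assms sym[of u v] by (simp add: nrm_sq diff_left diff_right)

lemma nrm_scale:
  assumes "u \<in> V"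
  shows "nrm (a *\<^sub>C u) = cmod a * nrm u"
proof -
  have "ip (a *\<^sub>C u) (a *\<^sub>C u) = (a * cnj a) * ip u u"
    using assms by (simp add: scale_left scale_right)
  also have "\<dots> = complex_of_real ((cmod a)\<^sup>2 * (nrm u)\<^sup>2)"
    using assms by (simp only: ip_self complex_norm_square[symmetric] of_real_mult)
  finally have "ip (a *\<^sub>C u) (a *\<^sub>C u) = complex_of_real ((cmod a)\<^sup>2 * (nrm u)\<^sup>2)" .
  then have "(nrm (a *\<^sub>C u))\<^sup>2 = (cmod a * nrm u)\<^sup>2"
    using assms by (simp add: nrm_sq power_mult_distrib)
  then show ?thesis using assms
    by (simp add: power2_eq_iff_nonneg)
qed

lemma nrm_minus_commute:
  assumes "u \<in> V" "v \<in> V"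
  shows "nrm (u - v) = nrm (v - u)"
proof -
  have "(nrm (u - v))\<^sup>2 = (nrm (v - u))\<^sup>2"
    using assms sym[of u v] by (simp add: nrm_diff_sq)
  then show ?thesis using assms by (simp add: power2_eq_iff_nonneg)
qed

text \<open>Since \<open>v\<close> may be a null vector, projecting onto \<open>v\<close> is not enough. The polynomial
  \<open>s \<mapsto> \<parallel>u - s \<langle>u, v\<rangle> v\<parallel>\<^sup>2\<close> is nonnegative; if \<open>v\<close> is null it is affine, so its slope vanishes.\<close>

lemma cauchy_schwarz:
  assumes u: "u \<in> V" and v: "v \<in> V"
  shows "cmod (ip u v) \<le> nrm u * nrm v"
proof -
  define c where "c = (cmod (ip u v))\<^sup>2"
  have key: "0 \<le> (nrm u)\<^sup>2 - 2 * s * c + s\<^sup>2 * c * (nrm v)\<^sup>2" for s :: real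
  proof -
    let ?t = "complex_of_real s * ip u v"
    have "ip u (?t *\<^sub>C v) = complex_of_real (s * c)"
      using u v by (simp add: scale_right c_def complex_norm_square mult.assoc mult.commute del: of_real_power)
    moreover have "(nrm (?t *\<^sub>C v))\<^sup>2 = s\<^sup>2 * c * (nrm v)\<^sup>2"
      using v by (simp add: nrm_scale c_def norm_mult power_mult_distrib)
    ultimately have "(nrm (u - ?t *\<^sub>C v))\<^sup>2 = (nrm u)\<^sup>2 - 2 * s * c + s\<^sup>2 * c * (nrm v)\<^sup>2"
      using u v by (simp add: nrm_diff_sq)
    then show ?thesis by (metis zero_le_power2)
  qed
  have "c \<le> (nrm u)\<^sup>2 * (nrm v)\<^sup>2"
  proof (cases "nrm v = 0")
    case True
    have "c = 0"
    proof (rule ccontr)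
      assume "c \<noteq> 0"
      then show False
        using key[of "((nrm u)\<^sup>2 + 1) / (2 * c)"] True by (simp add: field_simps)
    qed
    then show ?thesis by simp
  next
    case False
    then have "0 < (nrm v)\<^sup>2" by simp
    moreover have "0 \<le> (nrm u)\<^sup>2 - c / (nrm v)\<^sup>2"
      using key[of "1 / (nrm v)\<^sup>2"] False by (simp add: power2_eq_square field_simps)
    ultimately show ?thesis by (simp add: field_simps)
  qed
  then have "(cmod (ip u v))\<^sup>2 \<le> (nrm u * nrm v)\<^sup>2"
    by (simp add: c_def power_mult_distrib)
  then show ?thesis using u v by (simp add: power2_le_iff_abs_le)
qed

lemma nrm_triangle:
  assumes "u \<in> V" "v \<in> V"
  shows "nrm (u + v) \<le> nrm u + nrm v"
proof -
  have "Re (ip u v) \<le> nrm u * nrm v"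
    using cauchy_schwarz[OF assms] complex_Re_le_cmod[of "ip u v"] by linarith
  then have "(nrm (u + v))\<^sup>2 \<le> (nrm u + nrm v)\<^sup>2"
    using assms by (simp add: nrm_add_sq power2_sum)
  then show ?thesis using assms by (simp add: power2_le_iff_abs_le)
qed

lemma nrm_triangle_diff:
  assumes "u \<in> V" "v \<in> V" "w \<in> V"
  shows "nrm (u - w) \<le> nrm (u - v) + nrm (v - w)"
  using nrm_triangle[of "u - v" "v - w"] assms by simp

lemma nrm_sum_le:
  assumes "\<And>i. i \<in> I \<Longrightarrow> g i \<in> V"
  shows "nrm (\<Sum>i\<in>I. g i) \<le> (\<Sum>i\<in>I. nrm (g i))"
proof (cases "finite I")
  case True
  then show ?thesis using assms
  proof (induction I rule: finite_induct)
    case (insert x I)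
    have "(\<Sum>i\<in>I. g i) \<in> V"
      using insert.prems by (intro complex_vector.subspace_sum[OF subspace]) auto
    then show ?case using insert nrm_triangle[of "g x" "\<Sum>i\<in>I. g i"] by fastforce
  qed simp
qed simp

lemma ip_zero_if_nrm_zero:
  assumes "u \<in> V" "v \<in> V" "nrm u = 0"
  shows "ip u v = 0" "ip v u = 0"
  using cauchy_schwarz[OF assms(1,2)] cauchy_schwarz[OF assms(2,1)] assms(3) by auto

text \<open>The form only depends on classes modulo null vectors. This is what makes it harmless that limits
  in \<open>L\<^sup>2\<close> are represented by an arbitrary choice.\<close>

lemma ip_cong_nrm:
  assumes "u \<in> V" "u' \<in> V" "v \<in> V" "v' \<in> V" "nrm (u - u') = 0" "nrm (v - v') = 0"
  shows "ip u v = ip u' v'"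
  using ip_zero_if_nrm_zero(1)[of "u - u'" v] ip_zero_if_nrm_zero(2)[of "v - v'" u'] assms
  by (simp add: diff_left diff_right)

lemma tendsto_ip_left:
  assumes "\<And>n. s n \<in> V" "u \<in> V" "v \<in> V" "(\<lambda>n. nrm (s n - u)) \<longlonglongrightarrow> 0"
  shows "(\<lambda>n. ip (s n) v) \<longlonglongrightarrow> ip u v"
proof -
  have "(\<lambda>n. nrm (s n - u) * nrm v) \<longlonglongrightarrow> 0"
    using tendsto_mult_left_zero[OF assms(4)] .
  then have "(\<lambda>n. ip (s n) v - ip u v) \<longlonglongrightarrow> 0"
  proof (rule Lim_null_comparison[rotated])
    show "\<forall>\<^sub>F n in sequentially. cmod (ip (s n) v - ip u v) \<le> nrm (s n - u) * nrm v"
      using cauchy_schwarz[of "s _ - u" v] assms by (simp add: diff_left)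
  qed
  then show ?thesis by (simp add: LIM_zero_iff)
qed

lemma tendsto_nrm:
  assumes "\<And>n. s n \<in> V" "u \<in> V" "(\<lambda>n. nrm (s n - u)) \<longlonglongrightarrow> 0"
  shows "(\<lambda>n. nrm (s n)) \<longlonglongrightarrow> nrm u"
proof -
  have "(\<lambda>n. nrm (s n) - nrm u) \<longlonglongrightarrow> 0"
  proof (rule Lim_null_comparison[OF _ assms(3)])
    show "\<forall>\<^sub>F n in sequentially. norm (nrm (s n) - nrm u) \<le> nrm (s n - u)"
    proof (rule always_eventually, rule allI)
      fix n
      show "norm (nrm (s n) - nrm u) \<le> nrm (s n - u)"
        using nrm_triangle[of "s n - u" u] nrm_triangle[of "u - s n" "s n"]
          nrm_minus_commute[of "s n" u] assms by auto
    qed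
  qed
  then show ?thesis by (simp add: LIM_zero_iff)
qed

lemma cauchy_if_convergent:
  assumes "\<And>n. s n \<in> V" "u \<in> V" "(\<lambda>n. nrm (s n - u)) \<longlonglongrightarrow> 0"
  shows "cauchy s"
  unfolding cauchy_def
proof (intro allI impI)
  fix e :: real assume "0 < e"
  then obtain M where M: "\<And>n. n \<ge> M \<Longrightarrow> nrm (s n - u) < e / 2"
    using LIMSEQ_D[OF assms(3), of "e / 2"] assms(1,2) by auto
  have "nrm (s i - s j) < e" if "i \<ge> M" "j \<ge> M" for i j
    using nrm_triangle_diff[of "s i" u "s j"] nrm_minus_commute[of u "s j"] M[OF that(1)] M[OF that(2)]
      assms(1,2) by auto
  then show "\<exists>M. \<forall>i\<ge>M. \<forall>j\<ge>M. nrm (s i - s j) < e" by blast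
qed

lemma cauchyI_sq_bound:
  assumes s: "\<And>n. s n \<in> V"
    and r: "\<And>e. e > 0 \<Longrightarrow> \<exists>M. \<forall>i\<ge>M. \<forall>j\<ge>M. (nrm (s i - s j))\<^sup>2 < e"
  shows "cauchy s"
  unfolding cauchy_def
proof (intro allI impI)
  fix e :: real assume e: "0 < e"
  then obtain M where "\<forall>i\<ge>M. \<forall>j\<ge>M. (nrm (s i - s j))\<^sup>2 < e\<^sup>2"
    using r[of "e\<^sup>2"] by auto
  then show "\<exists>M. \<forall>i\<ge>M. \<forall>j\<ge>M. nrm (s i - s j) < e"
    using e by (meson less_imp_le power_less_imp_less_base)
qed

text \<open>The Riesz representation theorem, by minimizing \<open>J(u) = \<parallel>u\<parallel>\<^sup>2 - 2 Re \<phi>(u)\<close>: by the parallelogram law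
  a minimizing sequence is Cauchy, and the first variation of \<open>J\<close> at a minimum \<open>l\<close> is
  \<open>2 Re (\<langle>l, v\<rangle> - \<phi>(v))\<close>.\<close>

lemma riesz:
  assumes complete: complete
    and add: "\<And>u v. u \<in> V \<Longrightarrow> v \<in> V \<Longrightarrow> \<phi> (u + v) = \<phi> u + \<phi> v"
    and scale: "\<And>a u. u \<in> V \<Longrightarrow> \<phi> (a *\<^sub>C u) = cnj a * \<phi> u"
    and bound: "\<And>u. u \<in> V \<Longrightarrow> cmod (\<phi> u) \<le> M * nrm u"
  shows "\<exists>u\<in>V. \<forall>v\<in>V. ip u v = \<phi> v"
proof -
  define J where "J u = (nrm u)\<^sup>2 - 2 * Re (\<phi> u)" for u
  define I where "I = (INF u\<in>V. J u)"
  have J_lower: "- M\<^sup>2 \<le> J u" if "u \<in> V" for u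
  proof -
    have "Re (\<phi> u) \<le> M * nrm u" using bound[OF that] complex_Re_le_cmod[of "\<phi> u"] by linarith
    moreover have "0 \<le> (nrm u - M)\<^sup>2" by simp
    ultimately show ?thesis by (simp add: J_def power2_diff mult.commute)
  qed
  have bdd: "bdd_below (J ` V)" using J_lower by (intro bdd_belowI2[where m = "- M\<^sup>2"]) auto
  have I_le: "I \<le> J u" if "u \<in> V" for u
    unfolding I_def by (rule cINF_lower[OF bdd that])
  have "\<exists>u\<in>V. J u < I + e" if "e > 0" for e
    using cInf_lessD[of "J ` V" "I + e"] that zero_in unfolding I_def by fastforce
  then have "\<forall>n. \<exists>u\<in>V. J u < I + inverse (real (Suc n))" by simp
  then obtain s where s: "\<And>n. s n \<in> V" and Js: "\<And>n. J (s n) < I + inverse (real (Suc n))"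
    by metis
  have par: "(nrm (u - v))\<^sup>2 \<le> 2 * (J u - I) + 2 * (J v - I)" if "u \<in> V" "v \<in> V" for u v
  proof -
    let ?w = "(1/2) *\<^sub>C (u + v)"
    have w: "nrm ?w = nrm (u + v) / 2"
      using that nrm_scale[of "u + v" "1/2"] by simp
    have w2: "(nrm ?w)\<^sup>2 = (nrm (u + v))\<^sup>2 / 4" unfolding w by (simp add: power_divide)
    have \<phi>w: "\<phi> ?w = (\<phi> u + \<phi> v) / 2"
      using that by (simp only: scale add_in add) simp
    have "J ?w = (nrm (u + v))\<^sup>2 / 4 - Re (\<phi> u) - Re (\<phi> v)"
      unfolding J_def w2 \<phi>w by (simp add: add_divide_distrib)
    moreover have "I \<le> J ?w" using that by (intro I_le) simp
    moreover have "(nrm (u + v))\<^sup>2 + (nrm (u - v))\<^sup>2 = 2 * (nrm u)\<^sup>2 + 2 * (nrm v)\<^sup>2"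
      using that by (simp add: nrm_add_sq nrm_diff_sq)
    ultimately show ?thesis unfolding J_def by argo
  qed
  have "cauchy s"
  proof (rule cauchyI_sq_bound[OF s])
    fix e :: real assume "e > 0"
    then obtain M where M: "inverse (real (Suc M)) < e / 4"
      using reals_Archimedean[of "e / 4"] by auto
    have *: "J (s i) - I < e / 4" if "i \<ge> M" for i
    proof -
      have "inverse (real (Suc i)) \<le> inverse (real (Suc M))" using that by (simp add: field_simps)
      then show ?thesis using Js[of i] M by linarith
    qed
    have "(nrm (s i - s j))\<^sup>2 < e" if "i \<ge> M" "j \<ge> M" for i j
    proof -
      have p: "(nrm (s i - s j))\<^sup>2 \<le> 2 * (J (s i) - I) + 2 * (J (s j) - I)" using par[OF s s, of i j] .
      have q: "2 * (J (s i) - I) < e / 2" using *[OF that(1)] by simp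
      have r: "2 * (J (s j) - I) < e / 2" using *[OF that(2)] by simp
      have "2 * (J (s i) - I) + 2 * (J (s j) - I) < e / 2 + e / 2" using q r by (rule add_strict_mono)
      also have "\<dots> = e" by simp
      finally show ?thesis using p by (rule le_less_trans[rotated])
    qed
    then show "\<exists>M. \<forall>i\<ge>M. \<forall>j\<ge>M. (nrm (s i - s j))\<^sup>2 < e" by blast
  qed
  then obtain l where l: "l \<in> V" and lim: "(\<lambda>n. nrm (s n - l)) \<longlonglongrightarrow> 0"
    using complete s unfolding complete_def by blast
  have "(\<lambda>n. \<phi> (s n) - \<phi> l) \<longlonglongrightarrow> 0"
  proof (rule Lim_null_comparison)
    show "(\<lambda>n. M * nrm (s n - l)) \<longlonglongrightarrow> 0" using tendsto_mult_right_zero[OF lim] .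
    have "\<phi> (s n - l) = \<phi> (s n) - \<phi> l" for n using add[of "s n - l" l] s l by simp
    then show "\<forall>\<^sub>F n in sequentially. cmod (\<phi> (s n) - \<phi> l) \<le> M * nrm (s n - l)"
      using bound[of "s _ - l"] s l by (metis (no_types, lifting) always_eventually diff_in)
  qed
  then have "(\<lambda>n. \<phi> (s n)) \<longlonglongrightarrow> \<phi> l" by (simp add: LIM_zero_iff)
  then have "(\<lambda>n. J (s n)) \<longlonglongrightarrow> J l"
    unfolding J_def using tendsto_nrm[OF s l lim] by (intro tendsto_intros)
  moreover have "(\<lambda>n. I + inverse (real (Suc n))) \<longlonglongrightarrow> I"
    using tendsto_add[OF tendsto_const LIMSEQ_inverse_real_of_nat, of I] by simp
  ultimately have "J l \<le> I"
    by (rule LIMSEQ_le) (use Js in \<open>auto intro: less_imp_le\<close>)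
  have Re_eq: "Re (ip l v) = Re (\<phi> v)" if v: "v \<in> V" for v
  proof (rule ccontr)
    define d where "d = Re (ip l v) - Re (\<phi> v)"
    assume "Re (ip l v) \<noteq> Re (\<phi> v)"
    then have d: "d \<noteq> 0" by (simp add: d_def)
    have var: "0 \<le> 2 * t * d + t\<^sup>2 * (nrm v)\<^sup>2" for t :: real
    proof -
      let ?w = "complex_of_real t *\<^sub>C v"
      have "J (l + ?w) = J l + 2 * t * d + t\<^sup>2 * (nrm v)\<^sup>2"
        using l v by (simp add: J_def d_def nrm_add_sq nrm_scale scale_right add scale
            power_mult_distrib algebra_simps)
      moreover have "I \<le> J (l + ?w)" using l v by (intro I_le) simp
      ultimately show ?thesis using \<open>J l \<le> I\<close> by linarith
    qed
    \<comment> \<open>the choice \<open>t = - d / c\<close> makes the linear term win; adding 1 avoids dividing by zero if \<open>v\<close> is null\<close>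
    define c where "c = (nrm v)\<^sup>2 + 1"
    have c: "0 < c" "(nrm v)\<^sup>2 \<le> c" by (auto simp: c_def add_nonneg_pos)
    have "0 \<le> 2 * (- d / c) * d + (- d / c)\<^sup>2 * c"
      using var[of "- d / c"] mult_left_mono[OF c(2), of "(- d / c)\<^sup>2"] by simp
    also have "\<dots> = - (d\<^sup>2 / c)"
      using c(1) by (simp add: power2_eq_square field_simps)
    finally show False using d c(1) by (simp add: divide_le_0_iff)
  qed
  \<comment> \<open>the imaginary part is the real part at \<open>\<i> v\<close>\<close>
  have "ip l v = \<phi> v" if v: "v \<in> V" for v
    using Re_eq[OF v] Re_eq[of "\<i> *\<^sub>C v"] v l by (simp add: scale_right scale complex_eq_iff)
  then show ?thesis using l by blast
qed

end

context hermitian_form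
begin

lemma ip_zero_left [simp]: "w \<in> V \<Longrightarrow> ip 0 w = 0"
  using ip_zero_if_nrm_zero(1)[of 0 w] by simp

lemma sum_in: "(\<And>i. i \<in> I \<Longrightarrow> g i \<in> V) \<Longrightarrow> (\<Sum>i\<in>I. g i) \<in> V"
  by (rule complex_vector.subspace_sum[OF subspace])

lemma ip_sum_left:
  assumes "\<And>i. i \<in> I \<Longrightarrow> g i \<in> V" "w \<in> V"
  shows "ip (\<Sum>i\<in>I. g i) w = (\<Sum>i\<in>I. ip (g i) w)"
proof (cases "finite I")
  case True
  then show ?thesis using assms(1)
    by (induction I rule: finite_induct) (simp_all add: assms(2) add_left sum_in)
qed (simp add: assms(2))

lemma ip_sum_right:
  assumes "\<And>i. i \<in> I \<Longrightarrow> g i \<in> V" "w \<in> V"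
  shows "ip w (\<Sum>i\<in>I. g i) = (\<Sum>i\<in>I. ip w (g i))"
proof -
  have "ip w (\<Sum>i\<in>I. g i) = cnj (ip (\<Sum>i\<in>I. g i) w)"
    by (rule sym[OF sum_in[OF assms(1)] assms(2)])
  also have "\<dots> = (\<Sum>i\<in>I. cnj (ip (g i) w))"
    by (simp add: ip_sum_left[OF assms])
  also have "\<dots> = (\<Sum>i\<in>I. ip w (g i))"
    by (rule sum.cong[OF refl]) (rule sym[OF assms(1) assms(2), symmetric])
  finally show ?thesis .
qed

lemma nrm_add_sq_le:
  assumes "u \<in> V" "v \<in> V"
  shows "(nrm (u + v))\<^sup>2 \<le> 2 * (nrm u)\<^sup>2 + 2 * (nrm v)\<^sup>2"
  using nrm_add_sq[OF assms] nrm_diff_sq[OF assms] zero_le_power2[of "nrm (u - v)"] by linarith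

end

lemma (in hermitian_form) nrm_limit_unique:
  assumes s: "\<And>n. s n \<in> V" and uv: "u \<in> V" "v \<in> V"
    and "(\<lambda>n. nrm (s n - u)) \<longlonglongrightarrow> 0" "(\<lambda>n. nrm (s n - v)) \<longlonglongrightarrow> 0"
  shows "nrm (u - v) = 0"
proof -
  have "nrm (u - v) \<le> nrm (s n - u) + nrm (s n - v)" for n
    using nrm_triangle_diff[OF uv(1) s[of n] uv(2)] nrm_minus_commute[OF uv(1) s[of n]] by linarith
  moreover have "(\<lambda>n. nrm (s n - u) + nrm (s n - v)) \<longlonglongrightarrow> 0"
    using tendsto_add[OF assms(4,5)] by simp
  ultimately have "nrm (u - v) \<le> 0"
    by (intro LIMSEQ_le_const[where a = "nrm (u - v)" and x = 0]) auto
  then show ?thesis using nrm_nonneg[OF diff_in[OF uv]] by linarith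
qed

lemma (in hermitian_form) nrm_tendsto_trans:
  assumes s: "\<And>n. s n \<in> V" "\<And>n. t n \<in> V" "\<And>n. r n \<in> V"
    and "(\<lambda>n. nrm (s n - t n)) \<longlonglongrightarrow> 0" "(\<lambda>n. nrm (t n - r n)) \<longlonglongrightarrow> 0"
  shows "(\<lambda>n. nrm (s n - r n)) \<longlonglongrightarrow> 0"
proof (rule Lim_null_comparison)
  show "(\<lambda>n. nrm (s n - t n) + nrm (t n - r n)) \<longlonglongrightarrow> 0"
    using tendsto_add[OF assms(4,5)] by simp
  show "\<forall>\<^sub>F n in sequentially. norm (nrm (s n - r n)) \<le> nrm (s n - t n) + nrm (t n - r n)"
    using nrm_triangle_diff[OF s(1) s(2) s(3)] nrm_nonneg[OF diff_in[OF s(1) s(3)]] by simp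
qed

text \<open>On a finite-dimensional space the coefficients with respect to a basis are bounded by a
  definite norm. Induction on the basis: a new basis vector \<open>a\<close> has positive distance \<open>\<delta>\<close> from the span of
  the others, since that span is closed by the bound on its coefficients. So the coefficient of \<open>a\<close> is at
  most \<open>1 / \<delta>\<close> times the norm, and the remaining part of the vector is bounded accordingly.\<close>

lemma (in hermitian_form) coefficient_bound:
  assumes "finite S" "S \<subseteq> V" "complex_vector.independent S"
    and definite: "\<And>u. u \<in> V \<Longrightarrow> nrm u = 0 \<Longrightarrow> u = 0"
  shows "\<exists>K\<ge>0. \<forall>c. \<forall>x\<in>S. cmod (c x) \<le> K * nrm (\<Sum>y\<in>S. c y *\<^sub>C y)"
  using assms(1,2,3)
proof (induction S rule: finite_induct)
  case empty
  then show ?case by auto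
next
  case (insert a S)
  have SV: "S \<subseteq> V" and aV: "a \<in> V" using insert.prems by auto
  have ind: "complex_vector.independent S" and notin: "a \<notin> complex_vector.span S"
    using insert.prems insert.hyps by (auto simp: complex_vector.independent_insert)
  obtain K where K: "0 \<le> K" "\<And>c x. x \<in> S \<Longrightarrow> cmod (c x) \<le> K * nrm (\<Sum>y\<in>S. c y *\<^sub>C y)"
    using insert.IH[OF SV ind] by blast
  have sumV: "(\<Sum>y\<in>S. c y *\<^sub>C y) \<in> V" for c
    using SV by (intro complex_vector.subspace_sum[OF subspace]) auto
  have "\<exists>\<delta>>0. \<forall>c. \<delta> \<le> nrm (a - (\<Sum>y\<in>S. c y *\<^sub>C y))"
  proof (rule ccontr)
    assume "\<not> ?thesis"
    then have "\<forall>n. \<exists>c. nrm (a - (\<Sum>y\<in>S. c y *\<^sub>C y)) < inverse (real (Suc n))"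
      by (metis inverse_positive_iff_positive of_nat_0_less_iff zero_less_Suc not_less)
    then obtain c where c: "\<And>n. nrm (a - (\<Sum>y\<in>S. c n y *\<^sub>C y)) < inverse (real (Suc n))"
      by metis
    let ?w = "\<lambda>n. \<Sum>y\<in>S. c n y *\<^sub>C y"
    have lim0: "(\<lambda>n. nrm (?w n - a)) \<longlonglongrightarrow> 0"
    proof (rule Lim_null_comparison[OF _ LIMSEQ_inverse_real_of_nat])
      show "\<forall>\<^sub>F n in sequentially. norm (nrm (?w n - a)) \<le> inverse (real (Suc n))"
        using c nrm_minus_commute[OF sumV aV] sumV aV by (simp add: less_imp_le)
    qed
    have cau: "cauchy ?w" by (rule cauchy_if_convergent[OF sumV aV lim0])
    have "\<exists>l. (\<lambda>n. c n x) \<longlonglongrightarrow> l" if x: "x \<in> S" for x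
    proof -
      have "Cauchy (\<lambda>n. c n x)"
      proof (rule metric_CauchyI)
        fix e :: real assume "0 < e"
        then have "0 < e / (K + 1)" using K(1) by simp
        then obtain N where N: "\<And>i j. i \<ge> N \<Longrightarrow> j \<ge> N \<Longrightarrow> nrm (?w i - ?w j) < e / (K + 1)"
          using cau unfolding cauchy_def by blast
        have "dist (c i x) (c j x) < e" if "i \<ge> N" "j \<ge> N" for i j
        proof -
          have "?w i - ?w j = (\<Sum>y\<in>S. (c i y - c j y) *\<^sub>C y)"
            by (simp add: complex_vector.scale_left_diff_distrib sum_subtractf)
          then have "dist (c i x) (c j x) \<le> K * nrm (?w i - ?w j)"
            using K(2)[OF x, of "\<lambda>y. c i y - c j y"] by (simp add: dist_norm)
          also have "\<dots> \<le> (K + 1) * nrm (?w i - ?w j)"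
            using sumV by (intro mult_right_mono) auto
          also have "\<dots> < e" using N[OF that] K(1) by (simp add: field_simps)
          finally show ?thesis .
        qed
        then show "\<exists>N. \<forall>i\<ge>N. \<forall>j\<ge>N. dist (c i x) (c j x) < e" by blast
      qed
      then show ?thesis by (simp add: Cauchy_convergent_iff convergent_def)
    qed
    then obtain l where l: "\<And>x. x \<in> S \<Longrightarrow> (\<lambda>n. c n x) \<longlonglongrightarrow> l x" by metis
    let ?v = "\<Sum>y\<in>S. l y *\<^sub>C y"
    have lim1: "(\<lambda>n. \<Sum>y\<in>S. cmod (c n y - l y) * nrm y) \<longlonglongrightarrow> 0"
    proof (rule tendsto_null_sum)
      fix y assume "y \<in> S"
      from tendsto_norm_zero[OF LIM_zero[OF l[OF this]]]
      show "(\<lambda>n. cmod (c n y - l y) * nrm y) \<longlonglongrightarrow> 0" by (rule tendsto_mult_left_zero)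
    qed
    have close: "nrm (?w n - ?v) \<le> (\<Sum>y\<in>S. cmod (c n y - l y) * nrm y)" for n
    proof -
      have "?w n - ?v = (\<Sum>y\<in>S. (c n y - l y) *\<^sub>C y)"
        by (simp add: complex_vector.scale_left_diff_distrib sum_subtractf)
      also have "nrm \<dots> \<le> (\<Sum>y\<in>S. nrm ((c n y - l y) *\<^sub>C y))"
        using SV by (intro nrm_sum_le) auto
      also have "\<dots> = (\<Sum>y\<in>S. cmod (c n y - l y) * nrm y)"
        using SV by (intro sum.cong) (auto intro: nrm_scale)
      finally show ?thesis .
    qed
    have "nrm (a - ?v) \<le> nrm (?w n - a) + (\<Sum>y\<in>S. cmod (c n y - l y) * nrm y)" for n
      using nrm_triangle_diff[OF aV sumV[of "c n"] sumV[of l]] nrm_minus_commute[OF aV sumV[of "c n"]]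
        close[of n] by linarith
    moreover have "(\<lambda>n. nrm (?w n - a) + (\<Sum>y\<in>S. cmod (c n y - l y) * nrm y)) \<longlonglongrightarrow> 0"
      using tendsto_add[OF lim0 lim1] by simp
    ultimately have "nrm (a - ?v) \<le> 0"
      by (intro LIMSEQ_le_const[where a = "nrm (a - ?v)" and x = 0]) auto
    then have "nrm (a - ?v) = 0" using nrm_nonneg[OF diff_in[OF aV sumV]] by (simp add: order_antisym)
    from definite[OF diff_in[OF aV sumV] this] have "a = ?v" by simp
    moreover have "?v \<in> complex_vector.span S"
      by (intro complex_vector.span_sum complex_vector.span_scale complex_vector.span_base)
    ultimately show False using notin by simp
  qed
  then obtain \<delta> where \<delta>: "0 < \<delta>" "\<And>c. \<delta> \<le> nrm (a - (\<Sum>y\<in>S. c y *\<^sub>C y))" by blast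
  define K' where "K' = 1 / \<delta> + K * (1 + nrm a / \<delta>)"
  have na: "0 \<le> nrm a" using aV by simp
  have K': "0 \<le> K'" "1 / \<delta> \<le> K'" "K * (1 + nrm a / \<delta>) \<le> K'"
    using K(1) \<delta>(1) na by (auto simp: K'_def)
  have "cmod (c x) \<le> K' * nrm (\<Sum>y\<in>insert a S. c y *\<^sub>C y)" if x: "x \<in> insert a S" for c x
  proof -
    let ?w = "\<Sum>y\<in>S. c y *\<^sub>C y" and ?t = "\<Sum>y\<in>insert a S. c y *\<^sub>C y"
    have t: "?t = c a *\<^sub>C a + ?w" using insert.hyps by simp
    have tV: "?t \<in> V" unfolding t using sumV aV by simp
    have ca: "cmod (c a) * \<delta> \<le> nrm ?t"
    proof (cases "c a = 0")
      case True
      then show ?thesis using tV by simp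
    next
      case False
      have "?t = c a *\<^sub>C (a - (\<Sum>y\<in>S. (- c y / c a) *\<^sub>C y))"
        unfolding t complex_vector.scale_right_diff_distrib complex_vector.scale_sum_right
        using False by (simp add: sum_negf)
      then have "nrm ?t = cmod (c a) * nrm (a - (\<Sum>y\<in>S. (- c y / c a) *\<^sub>C y))"
        using nrm_scale[OF diff_in[OF aV sumV]] by (simp only:)
      then show ?thesis using \<delta>(2)[of "\<lambda>y. - c y / c a"] by (simp add: mult_left_mono)
    qed
    then have ca': "cmod (c a) \<le> nrm ?t / \<delta>" using \<delta>(1) by (simp add: field_simps)
    show ?thesis
    proof (cases "x = a")
      case True
      have "nrm ?t / \<delta> \<le> K' * nrm ?t" using mult_right_mono[OF K'(2) nrm_nonneg[OF tV]] by simp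
      then show ?thesis using True ca' by simp
    next
      case False
      then have "x \<in> S" using x by simp
      then have "cmod (c x) \<le> K * nrm ?w" by (rule K(2))
      also have "\<dots> \<le> K * (nrm ?t + cmod (c a) * nrm a)"
      proof (rule mult_left_mono[OF _ K(1)])
        have "?w = ?t + (- c a) *\<^sub>C a" unfolding t by simp
        then have "nrm ?w \<le> nrm ?t + nrm ((- c a) *\<^sub>C a)"
          using nrm_triangle[OF tV scale_in[OF aV]] by metis
        then show "nrm ?w \<le> nrm ?t + cmod (c a) * nrm a" using nrm_scale[OF aV, of "- c a"] by simp
      qed
      also have "\<dots> \<le> K * (nrm ?t + (nrm ?t / \<delta>) * nrm a)"
        using K(1) ca' na by (intro mult_left_mono add_left_mono mult_right_mono) auto
      also have "\<dots> = K * (1 + nrm a / \<delta>) * nrm ?t" by (simp add: algebra_simps)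
      also have "\<dots> \<le> K' * nrm ?t" using mult_right_mono[OF K'(3) nrm_nonneg[OF tV]] .
      finally show ?thesis .
    qed
  qed
  then show ?case using K'(1) by blast
qed

section \<open>The regularized equation\<close>

text \<open>The Hilbert space part of the proof. The functional \<open>\<phi>\<close> is bounded by the \<open>a\<close>-norm alone, as is
  \<open>v \<mapsto> (f, Av)\<close>; this makes the bound on the \<open>a\<close>-norm of the solutions uniform in \<open>\<epsilon>\<close>.\<close>

locale regularization =
  a: hermitian_form V a + b: hermitian_form V b + ab: hermitian_form V "\<lambda>u v. a u v + b u v"
  for V :: "'v::complex_vector set" and a b :: "'v \<Rightarrow> 'v \<Rightarrow> complex" +
  fixes \<phi> :: "'v \<Rightarrow> complex" and M :: real
  assumes complete: "ab.complete"
    and \<phi>_add: "\<And>u v. u \<in> V \<Longrightarrow> v \<in> V \<Longrightarrow> \<phi> (u + v) = \<phi> u + \<phi> v"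
    and \<phi>_scale: "\<And>c u. u \<in> V \<Longrightarrow> \<phi> (c *\<^sub>C u) = cnj c * \<phi> u"
    and \<phi>_bound: "\<And>u. u \<in> V \<Longrightarrow> cmod (\<phi> u) \<le> M * a.nrm u"
    and M_nonneg: "0 \<le> M"
begin

definition regularized :: "real \<Rightarrow> 'v \<Rightarrow> bool" where
  "regularized \<epsilon> u \<longleftrightarrow> u \<in> V \<and> (\<forall>v\<in>V. a u v + complex_of_real \<epsilon> * b u v = \<phi> v)"

lemma ab_nrm_sq: "u \<in> V \<Longrightarrow> (ab.nrm u)\<^sup>2 = (a.nrm u)\<^sup>2 + (b.nrm u)\<^sup>2"
  by (simp add: ab.nrm_sq a.nrm_sq b.nrm_sq)

lemma a_le_ab: "u \<in> V \<Longrightarrow> a.nrm u \<le> ab.nrm u"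
  by (rule power2_le_imp_le) (simp_all add: ab_nrm_sq)

lemma b_le_ab: "u \<in> V \<Longrightarrow> b.nrm u \<le> ab.nrm u"
  by (rule power2_le_imp_le) (simp_all add: ab_nrm_sq)

text \<open>The form \<open>a + \<epsilon> b\<close> has a norm equivalent to that of \<open>a + b\<close>, so the space is complete for it, too,
  and \<open>\<phi>\<close> is represented by a vector.\<close>

lemma regularized_exists:
  assumes \<epsilon>: "0 < \<epsilon>"
  shows "\<exists>u. regularized \<epsilon> u"
proof -
  interpret e: hermitian_form V "\<lambda>u v. a u v + complex_of_real \<epsilon> * b u v"
  proof
    show "complex_vector.subspace V" by (rule a.subspace)
  next
    fix u v assume uv: "u \<in> V" "v \<in> V"
    show "a v u + complex_of_real \<epsilon> * b v u = cnj (a u v + complex_of_real \<epsilon> * b u v)"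
      using a.sym[OF uv] b.sym[OF uv] by simp
  next
    fix u assume "u \<in> V"
    then show "0 \<le> Re (a u u + complex_of_real \<epsilon> * b u u)"
      using a.nonneg b.nonneg \<epsilon> by simp
  qed (simp_all add: a.add_left b.add_left a.scale_left b.scale_left algebra_simps)
  have e_sq: "(e.nrm u)\<^sup>2 = (a.nrm u)\<^sup>2 + \<epsilon> * (b.nrm u)\<^sup>2" if "u \<in> V" for u
    using that by (simp add: e.nrm_sq a.nrm_sq b.nrm_sq)
  have a_le: "a.nrm u \<le> e.nrm u" if "u \<in> V" for u
    by (rule power2_le_imp_le) (use that \<epsilon> in \<open>simp_all add: e_sq\<close>)
  \<comment> \<open>with \<open>c\<close> and \<open>d\<close> the two norms bound each other\<close>
  define c where "c = max 1 (1 / \<epsilon>)"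
  have c: "1 \<le> c" "1 \<le> c * \<epsilon>" using \<epsilon> by (auto simp: c_def max_def field_simps)
  have ab_le: "ab.nrm u \<le> c * e.nrm u" if "u \<in> V" for u
  proof (rule power2_le_imp_le)
    have cc: "c \<le> c\<^sup>2" using c by (simp add: power2_eq_square)
    have "(ab.nrm u)\<^sup>2 \<le> c * (a.nrm u)\<^sup>2 + (c * \<epsilon>) * (b.nrm u)\<^sup>2"
      using mult_right_mono[OF c(1), of "(a.nrm u)\<^sup>2"] mult_right_mono[OF c(2), of "(b.nrm u)\<^sup>2"]
      by (simp add: ab_nrm_sq[OF that])
    also have "\<dots> = c * (e.nrm u)\<^sup>2" by (simp add: e_sq[OF that] algebra_simps)
    also have "\<dots> \<le> c\<^sup>2 * (e.nrm u)\<^sup>2" using mult_right_mono[OF cc] by simp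
    finally show "(ab.nrm u)\<^sup>2 \<le> (c * e.nrm u)\<^sup>2" by (simp add: power_mult_distrib)
    show "0 \<le> c * e.nrm u" using c that by simp
  qed
  define d where "d = max 1 \<epsilon>"
  have d: "1 \<le> d" "\<epsilon> \<le> d" by (auto simp: d_def)
  have e_le: "e.nrm u \<le> d * ab.nrm u" if "u \<in> V" for u
  proof (rule power2_le_imp_le)
    have dd: "d \<le> d\<^sup>2" using d by (simp add: power2_eq_square)
    have "(e.nrm u)\<^sup>2 \<le> d * (a.nrm u)\<^sup>2 + d * (b.nrm u)\<^sup>2"
      using mult_right_mono[OF d(1), of "(a.nrm u)\<^sup>2"] mult_right_mono[OF d(2), of "(b.nrm u)\<^sup>2"]
      by (simp add: e_sq[OF that])
    also have "\<dots> = d * (ab.nrm u)\<^sup>2" by (simp add: ab_nrm_sq[OF that] algebra_simps)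
    also have "\<dots> \<le> d\<^sup>2 * (ab.nrm u)\<^sup>2" using mult_right_mono[OF dd] by simp
    finally show "(e.nrm u)\<^sup>2 \<le> (d * ab.nrm u)\<^sup>2" by (simp add: power_mult_distrib)
    show "0 \<le> d * ab.nrm u" using d that by simp
  qed
  have "e.complete"
    unfolding e.complete_def
  proof (intro allI impI)
    fix s :: "nat \<Rightarrow> 'v" assume s: "range s \<subseteq> V" and cs: "e.cauchy s"
    have "ab.cauchy s"
      unfolding ab.cauchy_def
    proof (intro allI impI)
      fix r :: real assume "0 < r"
      then have "0 < r / c" using c by simp
      then obtain N where N: "\<forall>i\<ge>N. \<forall>j\<ge>N. e.nrm (s i - s j) < r / c"
        using cs unfolding e.cauchy_def by blast
      have "ab.nrm (s i - s j) < r" if "i \<ge> N" "j \<ge> N" for i j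
      proof -
        have "e.nrm (s i - s j) < r / c" using N that by blast
        then have "c * e.nrm (s i - s j) < r" using c by (simp add: field_simps)
        then show ?thesis using ab_le[of "s i - s j"] s by (simp add: image_subset_iff)
      qed
      then show "\<exists>N. \<forall>i\<ge>N. \<forall>j\<ge>N. ab.nrm (s i - s j) < r" by blast
    qed
    then obtain l where l: "l \<in> V" "(\<lambda>n. ab.nrm (s n - l)) \<longlonglongrightarrow> 0"
      using complete s unfolding ab.complete_def by blast
    have "(\<lambda>n. e.nrm (s n - l)) \<longlonglongrightarrow> 0"
    proof (rule Lim_null_comparison)
      show "(\<lambda>n. d * ab.nrm (s n - l)) \<longlonglongrightarrow> 0" using tendsto_mult_right_zero[OF l(2)] .
      show "\<forall>\<^sub>F n in sequentially. norm (e.nrm (s n - l)) \<le> d * ab.nrm (s n - l)"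
        using e_le[of "s _ - l"] s l by (simp add: image_subset_iff)
    qed
    then show "\<exists>l\<in>V. (\<lambda>n. e.nrm (s n - l)) \<longlonglongrightarrow> 0" using l by blast
  qed
  moreover have "cmod (\<phi> u) \<le> M * e.nrm u" if "u \<in> V" for u
    using \<phi>_bound[OF that] a_le[OF that] M_nonneg by (meson mult_left_mono order_trans)
  ultimately have "\<exists>u\<in>V. \<forall>v\<in>V. a u v + complex_of_real \<epsilon> * b u v = \<phi> v"
    by (intro e.riesz[where M = M]) (simp_all add: \<phi>_add \<phi>_scale)
  then show ?thesis unfolding regularized_def by blast
qed

lemma regularized_unique:
  assumes \<epsilon>: "0 < \<epsilon>" and u: "regularized \<epsilon> u" "regularized \<epsilon> u'"
  shows "a.nrm (u - u') = 0" "b.nrm (u - u') = 0"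
proof -
  have V: "u \<in> V" "u' \<in> V" using u by (auto simp: regularized_def)
  have "a (u - u') v + complex_of_real \<epsilon> * b (u - u') v = 0" if "v \<in> V" for v
    using u that V by (simp add: regularized_def a.diff_left b.diff_left algebra_simps)
  from this[of "u - u'"] have "(a.nrm (u - u'))\<^sup>2 + \<epsilon> * (b.nrm (u - u'))\<^sup>2 = 0"
    using V by (simp add: a.nrm_sq b.nrm_sq complex_eq_iff)
  then show "a.nrm (u - u') = 0" "b.nrm (u - u') = 0"
    using \<epsilon> by (auto simp: add_nonneg_eq_0_iff)
qed

text \<open>For the solutions \<open>x\<^sub>i\<close> and \<open>x\<^sub>j\<close> with parameters \<open>\<epsilon>\<^sub>i \<ge> \<epsilon>\<^sub>j\<close> and \<open>w = x\<^sub>i - x\<^sub>j\<close>, testing the difference of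
  their equations with \<open>w\<close> yields \<open>a(w, w) = - Re b(\<epsilon>\<^sub>i x\<^sub>i - \<epsilon>\<^sub>j x\<^sub>j, w)\<close>. Expanding the right-hand side and
  dropping \<open>a(w, w) \<ge> 0\<close>, one obtains
  \<open>(\<epsilon>\<^sub>i + \<epsilon>\<^sub>j) b(w, w) \<le> (\<epsilon>\<^sub>i - \<epsilon>\<^sub>j) (b(x\<^sub>j, x\<^sub>j) - b(x\<^sub>i, x\<^sub>i))\<close>. Hence \<open>b(x\<^sub>i, x\<^sub>i)\<close> increases with \<open>i\<close> and controls
  \<open>b(w, w)\<close>; the identity itself then makes \<open>a(w, w)\<close> small, its right-hand side being at most
  \<open>(\<epsilon>\<^sub>i + \<epsilon>\<^sub>j) K\<^sup>2\<close>.\<close>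

lemma solvable_if_bounded:
  assumes U: "\<And>\<epsilon>. 0 < \<epsilon> \<Longrightarrow> regularized \<epsilon> (U \<epsilon>)"
    and K: "\<And>\<epsilon>. 0 < \<epsilon> \<Longrightarrow> ab.nrm (U \<epsilon>) \<le> K"
  shows "\<exists>u\<in>V. \<forall>v\<in>V. a u v = \<phi> v"
proof -
  define \<epsilon> where "\<epsilon> n = inverse (real (Suc n))" for n
  define x where "x n = U (\<epsilon> n)" for n
  have \<epsilon>_pos: "0 < \<epsilon> n" for n by (simp add: \<epsilon>_def)
  have \<epsilon>_le: "\<epsilon> j \<le> \<epsilon> i" if "i \<le> j" for i j using that by (simp add: \<epsilon>_def field_simps)
  have x: "x n \<in> V" and eq: "\<And>v. v \<in> V \<Longrightarrow> a (x n) v + complex_of_real (\<epsilon> n) * b (x n) v = \<phi> v"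
    and xK: "ab.nrm (x n) \<le> K" for n
    using U[OF \<epsilon>_pos] K[OF \<epsilon>_pos] by (auto simp: x_def regularized_def)
  have K0: "0 \<le> K" using xK[of 0] ab.nrm_nonneg[OF x[of 0]] by linarith
  have identity: "(a.nrm (x i - x j))\<^sup>2 =
      - (\<epsilon> i * (b.nrm (x i))\<^sup>2 + \<epsilon> j * (b.nrm (x j))\<^sup>2 - (\<epsilon> i + \<epsilon> j) * Re (b (x i) (x j)))" for i j
  proof -
    have "a (x i - x j) (x i - x j)
        = - (complex_of_real (\<epsilon> i) * b (x i) (x i - x j) - complex_of_real (\<epsilon> j) * b (x j) (x i - x j))"
      using eq[of "x i - x j" i] eq[of "x i - x j" j] x
      by (simp add: a.diff_left algebra_simps)
    from arg_cong[OF this, of Re] show ?thesis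
      using x b.sym[OF x[of i] x[of j]]
      by (simp add: a.nrm_sq b.nrm_sq b.diff_right algebra_simps)
  qed
  have mono: "(b.nrm (x i))\<^sup>2 \<le> (b.nrm (x j))\<^sup>2"
    and close: "(b.nrm (x i - x j))\<^sup>2 \<le> (b.nrm (x j))\<^sup>2 - (b.nrm (x i))\<^sup>2"
    if ij: "i \<le> j" for i j
  proof -
    let ?A = "(b.nrm (x i))\<^sup>2" and ?B = "(b.nrm (x j))\<^sup>2" and ?W = "(b.nrm (x i - x j))\<^sup>2"
    have W: "2 * Re (b (x i) (x j)) = ?A + ?B - ?W"
      using x by (simp add: b.nrm_diff_sq)
    have "\<epsilon> i * ?A + \<epsilon> j * ?B \<le> (\<epsilon> i + \<epsilon> j) * Re (b (x i) (x j))"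
      using identity[of i j] zero_le_power2[of "a.nrm (x i - x j)"] by linarith
    then have "2 * (\<epsilon> i * ?A + \<epsilon> j * ?B) \<le> (\<epsilon> i + \<epsilon> j) * (?A + ?B - ?W)"
      unfolding W[symmetric] by (simp add: mult.left_commute)
    then have main: "(\<epsilon> i + \<epsilon> j) * ?W \<le> (\<epsilon> i - \<epsilon> j) * (?B - ?A)"
      by (simp add: algebra_simps)
    have "0 < \<epsilon> i + \<epsilon> j" using \<epsilon>_pos[of i] \<epsilon>_pos[of j] by linarith
    then have W0: "0 \<le> (\<epsilon> i + \<epsilon> j) * ?W" by simp
    show AB: "?A \<le> ?B"
    proof (cases "\<epsilon> i = \<epsilon> j")
      case True
      then have "x i = x j" by (simp add: x_def)
      then show ?thesis by simp
    next
      case False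
      then have "0 < \<epsilon> i - \<epsilon> j" using \<epsilon>_le[OF ij] by simp
      moreover have "0 \<le> (\<epsilon> i - \<epsilon> j) * (?B - ?A)" using main W0 by linarith
      ultimately have "0 \<le> ?B - ?A" by (simp add: zero_le_mult_iff)
      then show ?thesis by simp
    qed
    have "(\<epsilon> i - \<epsilon> j) * (?B - ?A) \<le> (\<epsilon> i + \<epsilon> j) * (?B - ?A)"
      using AB \<epsilon>_pos[of j] by (intro mult_right_mono) auto
    then show "?W \<le> ?B - ?A"
      using main \<open>0 < \<epsilon> i + \<epsilon> j\<close> by (meson mult_le_cancel_left_pos order_trans)
  qed
  have bK: "b.nrm (x n) \<le> K" for n using b_le_ab[OF x] xK order_trans by blast
  have "convergent (\<lambda>n. (b.nrm (x n))\<^sup>2)"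
  proof (rule Bseq_mono_convergent)
    show "Bseq (\<lambda>n. (b.nrm (x n))\<^sup>2)"
      using bK x by (intro BseqI'[where K = "K\<^sup>2"]) (simp add: power_mono)
  qed (use mono in auto)
  then have conv: "Cauchy (\<lambda>n. (b.nrm (x n))\<^sup>2)" by (rule convergent_Cauchy)
  have \<epsilon>_lim: "\<epsilon> \<longlonglongrightarrow> 0" unfolding \<epsilon>_def by (rule LIMSEQ_inverse_real_of_nat)
  have "ab.cauchy x"
  proof (rule ab.cauchyI_sq_bound[OF x])
    fix e :: real assume e: "0 < e"
    obtain N1 where N1: "\<And>i j. i \<ge> N1 \<Longrightarrow> j \<ge> N1 \<Longrightarrow> \<bar>(b.nrm (x i))\<^sup>2 - (b.nrm (x j))\<^sup>2\<bar> < e / 2"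
      using conv e unfolding Cauchy_def dist_real_def by (meson half_gt_zero)
    have "0 < e / (4 * (K\<^sup>2 + 1))" using e by (simp add: add_nonneg_pos)
    then obtain N2 where N2: "\<And>i. i \<ge> N2 \<Longrightarrow> \<epsilon> i < e / (4 * (K\<^sup>2 + 1))"
      using LIMSEQ_D[OF \<epsilon>_lim] \<epsilon>_pos by (metis abs_of_pos diff_zero real_norm_def)
    have "(ab.nrm (x i - x j))\<^sup>2 < e" if "i \<ge> max N1 N2" "j \<ge> max N1 N2" for i j
    proof -
      have "(b.nrm (x i - x j))\<^sup>2 \<le> \<bar>(b.nrm (x i))\<^sup>2 - (b.nrm (x j))\<^sup>2\<bar>"
      proof (cases "i \<le> j")
        case True
        then show ?thesis using close[of i j] by linarith
      next
        case False
        then show ?thesis using close[of j i] b.nrm_minus_commute[OF x[of i] x[of j]] by auto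
      qed
      then have 1: "(b.nrm (x i - x j))\<^sup>2 < e / 2" using N1[of i j] that by auto
      have "Re (b (x i) (x j)) \<le> b.nrm (x i) * b.nrm (x j)"
        using b.cauchy_schwarz[OF x[of i] x[of j]] complex_Re_le_cmod[of "b (x i) (x j)"] by linarith
      also have "\<dots> \<le> K * K" using bK x K0 by (intro mult_mono) auto
      finally have re: "Re (b (x i) (x j)) \<le> K\<^sup>2" by (simp add: power2_eq_square)
      have "(a.nrm (x i - x j))\<^sup>2 \<le> (\<epsilon> i + \<epsilon> j) * Re (b (x i) (x j))"
        using identity[of i j]
          mult_nonneg_nonneg[OF less_imp_le[OF \<epsilon>_pos] zero_le_power2, of i "b.nrm (x i)"]
          mult_nonneg_nonneg[OF less_imp_le[OF \<epsilon>_pos] zero_le_power2, of j "b.nrm (x j)"]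
        by linarith
      also have "\<dots> \<le> (\<epsilon> i + \<epsilon> j) * (K\<^sup>2 + 1)"
        using re \<epsilon>_pos[of i] \<epsilon>_pos[of j] by (intro mult_left_mono) auto
      also have "\<dots> < (2 * (e / (4 * (K\<^sup>2 + 1)))) * (K\<^sup>2 + 1)"
        using N2[of i] N2[of j] that by (intro mult_strict_right_mono) (auto simp: add_nonneg_pos)
      also have "\<dots> = e / 2"
        using add_nonneg_pos[of "K\<^sup>2" 1] by (simp add: field_simps)
      finally show ?thesis using 1 x by (simp add: ab_nrm_sq)
    qed
    then show "\<exists>N. \<forall>i\<ge>N. \<forall>j\<ge>N. (ab.nrm (x i - x j))\<^sup>2 < e" by blast
  qed
  then obtain u where u: "u \<in> V" and lim: "(\<lambda>n. ab.nrm (x n - u)) \<longlonglongrightarrow> 0"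
    using complete x unfolding ab.complete_def by blast
  have alim: "(\<lambda>n. a.nrm (x n - u)) \<longlonglongrightarrow> 0"
    using a_le_ab[of "x _ - u"] x u by (intro Lim_null_comparison[OF _ lim]) auto
  have "a u v = \<phi> v" if v: "v \<in> V" for v
  proof (rule LIMSEQ_unique)
    show "(\<lambda>n. a (x n) v) \<longlonglongrightarrow> a u v" by (rule a.tendsto_ip_left[OF x u v alim])
    have "(\<lambda>n. complex_of_real (\<epsilon> n) * b (x n) v) \<longlonglongrightarrow> 0"
    proof (rule Lim_null_comparison)
      show "(\<lambda>n. \<epsilon> n * (K * b.nrm v)) \<longlonglongrightarrow> 0" using tendsto_mult_left_zero[OF \<epsilon>_lim] .
      have "cmod (complex_of_real (\<epsilon> n) * b (x n) v) \<le> \<epsilon> n * (K * b.nrm v)" for n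
      proof -
        have "cmod (b (x n) v) \<le> K * b.nrm v"
          using b.cauchy_schwarz[OF x v, of n] mult_right_mono[OF bK b.nrm_nonneg[OF v], of n] by linarith
        then show ?thesis using \<epsilon>_pos[of n] by (simp add: norm_mult)
      qed
      then show "\<forall>\<^sub>F n in sequentially. cmod (complex_of_real (\<epsilon> n) * b (x n) v) \<le> \<epsilon> n * (K * b.nrm v)"
        by simp
    qed
    then have "(\<lambda>n. \<phi> v - complex_of_real (\<epsilon> n) * b (x n) v) \<longlonglongrightarrow> \<phi> v"
      using tendsto_diff[OF tendsto_const, of _ 0] by fastforce
    moreover have "\<phi> v - complex_of_real (\<epsilon> n) * b (x n) v = a (x n) v" for n
      using eq[OF v, of n] by (simp add: algebra_simps)
    ultimately show "(\<lambda>n. a (x n) v) \<longlonglongrightarrow> \<phi> v" by simp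
  qed
  then show ?thesis using u by blast
qed

text \<open>Testing the difference of the two equations with \<open>U - u\<close> bounds the \<open>b\<close>-norm of \<open>U\<close> by that of \<open>u\<close>;
  testing the regularized equation with \<open>U\<close> bounds its \<open>a\<close>-norm by \<open>M\<close>.\<close>

lemma bounded_if_solvable:
  assumes u: "u \<in> V" "\<And>v. v \<in> V \<Longrightarrow> a u v = \<phi> v"
    and \<epsilon>: "0 < \<epsilon>" and U: "regularized \<epsilon> U"
  shows "ab.nrm U \<le> M + b.nrm u"
proof -
  have UV: "U \<in> V" and eq: "\<And>v. v \<in> V \<Longrightarrow> a U v + complex_of_real \<epsilon> * b U v = \<phi> v"
    using U by (auto simp: regularized_def)
  have "a (U - u) (U - u) = - complex_of_real \<epsilon> * (b U U - b U u)"
    using eq[of "U - u"] u(2)[of "U - u"] u(1) UV by (simp add: a.diff_left b.diff_right algebra_simps)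
  then have "(a.nrm (U - u))\<^sup>2 = - \<epsilon> * ((b.nrm U)\<^sup>2 - Re (b U u))"
    using u(1) UV by (simp add: a.nrm_sq b.nrm_sq)
  then have "\<epsilon> * ((b.nrm U)\<^sup>2 - Re (b U u)) \<le> 0"
    using zero_le_power2[of "a.nrm (U - u)"] by linarith
  then have "(b.nrm U)\<^sup>2 \<le> Re (b U u)" using \<epsilon> by (simp add: mult_le_0_iff)
  also have "\<dots> \<le> b.nrm U * b.nrm u"
    using b.cauchy_schwarz[OF UV u(1)] complex_Re_le_cmod[of "b U u"] by linarith
  finally have 1: "b.nrm U \<le> b.nrm u"
    using b.nrm_nonneg[OF UV] b.nrm_nonneg[OF u(1)]
    by (metis dual_order.order_iff_strict mult_le_cancel_left_pos power2_eq_square)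
  have "(a.nrm U)\<^sup>2 \<le> Re (\<phi> U)"
    using eq[OF UV] \<epsilon> UV by (simp add: a.nrm_sq b.ip_self complex_eq_iff)
      (metis Re_complex_of_real add.commute le_add_same_cancel2 less_eq_real_def mult_nonneg_nonneg zero_le_power2)
  also have "\<dots> \<le> M * a.nrm U"
    using \<phi>_bound[OF UV] complex_Re_le_cmod[of "\<phi> U"] by linarith
  finally have 2: "a.nrm U \<le> M"
    using a.nrm_nonneg[OF UV] M_nonneg
    by (metis dual_order.order_iff_strict mult.commute mult_le_cancel_left_pos power2_eq_square)
  have "(ab.nrm U)\<^sup>2 \<le> (M + b.nrm u)\<^sup>2"
  proof -
    have "(a.nrm U)\<^sup>2 \<le> M\<^sup>2" "(b.nrm U)\<^sup>2 \<le> (b.nrm u)\<^sup>2"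
      using 1 2 UV by (auto intro: power_mono)
    moreover have "0 \<le> M * b.nrm u" using M_nonneg u(1) by simp
    ultimately show ?thesis by (simp add: ab_nrm_sq[OF UV] power2_sum)
  qed
  then show ?thesis by (rule power2_le_imp_le) (use M_nonneg u(1) in simp_all)
qed

theorem bounded_iff_solvable:
  assumes "\<And>\<epsilon>. 0 < \<epsilon> \<Longrightarrow> regularized \<epsilon> (U \<epsilon>)"
  shows "(\<exists>K. \<forall>\<epsilon>>0. ab.nrm (U \<epsilon>) \<le> K) \<longleftrightarrow> (\<exists>u\<in>V. \<forall>v\<in>V. a u v = \<phi> v)"
  using solvable_if_bounded[OF assms] bounded_if_solvable assms by meson

end

section \<open>Charts, frames and coordinates\<close>

lemma continuous_on_if_locally:
  fixes f :: "'a::t2_space \<Rightarrow> 'b::topological_space"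
  assumes "\<And>p. p \<in> S \<Longrightarrow> \<exists>W. open W \<and> p \<in> W \<and> continuous_on (S \<inter> W) f"
  shows "continuous_on S f"
  unfolding continuous_on_eq_continuous_within
proof
  fix p assume p: "p \<in> S"
  then obtain W where W: "open W" "p \<in> W" "continuous_on (S \<inter> W) f" using assms by blast
  then have "continuous (at p within S \<inter> W) f" using p by (simp add: continuous_on_eq_continuous_within)
  moreover have "at p within S = at p within S \<inter> W"
    by (rule at_within_nhd[OF W(2,1)]) auto
  ultimately show "continuous (at p within S) f" by simp
qed

lemma chart_continuous:
  assumes "smooth_structure C" "c \<in> C"
  shows "open (chart_dom c)" "continuous_on (chart_dom c) (chart_map c)"
    "open (chart_map c ` chart_dom c)" "continuous_on (chart_map c ` chart_dom c) (chart_inv c)"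
    "\<And>x. x \<in> chart_dom c \<Longrightarrow> chart_inv c (chart_map c x) = x"
    "\<And>y. y \<in> chart_map c ` chart_dom c \<Longrightarrow> chart_map c (chart_inv c y) = y"
    "\<And>y. y \<in> chart_map c ` chart_dom c \<Longrightarrow> chart_inv c y \<in> chart_dom c"
  using assms by (auto simp: smooth_structure_def is_chart_def homeomorphism_def)

lemma smooth_on_imp_continuous_on:
  fixes f :: "'a::t2_space \<Rightarrow> 'w::real_normed_vector"
  assumes C: "smooth_structure C" and f: "smooth_on C S f"
  shows "continuous_on S f"
proof (rule continuous_on_if_locally)
  fix p assume "p \<in> S"
  then obtain c V g where c: "c \<in> C" "p \<in> chart_dom c" and V: "open V" "chart_map c p \<in> V"
      and g: "Cinf_on V g" and eq: "\<And>x. x \<in> S \<inter> chart_dom c \<Longrightarrow> chart_map c x \<in> V \<Longrightarrow> f x = g (chart_map c x)"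
    using f unfolding smooth_on_def by metis
  let ?W = "chart_dom c \<inter> chart_map c -` V"
  have W: "open ?W"
    using chart_continuous(1,2)[OF C c(1)] V(1)
    by (metis Int_commute continuous_on_open_vimage)
  have "continuous_on V g" using g unfolding Cinf_on_def by (metis Ck_on.simps(1))
  then have "continuous_on ?W (\<lambda>x. g (chart_map c x))"
    by (rule continuous_on_compose2[OF _ continuous_on_subset[OF chart_continuous(2)[OF C c(1)]]]) auto
  then have "continuous_on (S \<inter> ?W) (\<lambda>x. g (chart_map c x))" by (rule continuous_on_subset) auto
  then have "continuous_on (S \<inter> ?W) f"
    by (rule continuous_on_eq) (use eq in auto)
  then show "\<exists>W. open W \<and> p \<in> W \<and> continuous_on (S \<inter> W) f"
    using W c V by (intro exI[of _ ?W]) auto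
qed

lemma hermitian_metricD:
  assumes "hermitian_vector_bundle C X E" "x \<in> X" "u \<in> fibre E x" "v \<in> fibre E x"
  shows "w \<in> fibre E x \<Longrightarrow> metric E x (u + v) w = metric E x u w + metric E x v w"
    "metric E x (a *\<^sub>C u) v = a * metric E x u v"
    "metric E x v u = cnj (metric E x u v)"
    "u \<noteq> 0 \<Longrightarrow> 0 < Re (metric E x u u)"
  using assms unfolding hermitian_vector_bundle_def by blast+

lemma hermitian_metric_form:
  assumes E: "hermitian_vector_bundle C X E" and x: "x \<in> X"
  shows "hermitian_form (fibre E x) (metric E x)"
proof
  have "vector_bundle C X E" using E unfolding hermitian_vector_bundle_def by (rule conjunct1)
  then show "complex_vector.subspace (fibre E x)"
    unfolding vector_bundle_def using x by (elim conjE) (rule bspec)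
  then have 0: "0 \<in> fibre E x" by (rule complex_vector.subspace_0)
  fix u assume u: "u \<in> fibre E x"
  show "0 \<le> Re (metric E x u u)"
  proof (cases "u = 0")
    case True
    then show ?thesis using hermitian_metricD(1)[OF E x 0 0 0] by simp
  next
    case False
    then show ?thesis using hermitian_metricD(4)[OF E x u u] by (simp add: less_imp_le)
  qed
qed (use hermitian_metricD[OF E x] in blast)+

text \<open>The base \<open>X\<close> is left arbitrary, since the bundles in a Dirichlet system live over a
  neighbourhood of \<open>\<partial>D\<close> only.\<close>

locale bundle_over_manifold =
  fixes C :: "('a::{second_countable_topology,t2_space}, 'n::finite) chart set"
    and X :: "'a set" and E :: "('a, 'e::complex_vector, 'z) vbundle_scheme"
  assumes smooth: "smooth_structure C" and vector_bundle: "vector_bundle C X E"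
begin

lemma fibre_subspace: "x \<in> X \<Longrightarrow> complex_vector.subspace (fibre E x)"
  using vector_bundle by (auto simp: vector_bundle_def)

lemma frame_cover:
  assumes "x \<in> X"
  obtains U e where "(U, e) \<in> frames E" "x \<in> U"
  using vector_bundle assms unfolding vector_bundle_def by blast

lemma frame_subset: "(U, e) \<in> frames E \<Longrightarrow> U \<subseteq> X"
  using vector_bundle unfolding vector_bundle_def by blast

lemma frame_basis:
  assumes "(U, e) \<in> frames E" "x \<in> U"
  shows "inj_on (\<lambda>i. e i x) {..<rank E}"
    and "complex_vector.independent ((\<lambda>i. e i x) ` {..<rank E})"
    and "complex_vector.span ((\<lambda>i. e i x) ` {..<rank E}) = fibre E x"
  using vector_bundle assms unfolding vector_bundle_def by blast+

lemma open_Int_frame: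
  assumes "(U, e) \<in> frames E" "open W" "W \<subseteq> X"
  shows "open (W \<inter> U)"
proof -
  have "openin (top_of_set X) U" using vector_bundle assms(1) unfolding vector_bundle_def by blast
  then obtain T where "open T" "U = X \<inter> T" by (auto simp: openin_open)
  then have "W \<inter> U = W \<inter> T" using assms(3) by blast
  then show ?thesis using assms(2) \<open>open T\<close> by (simp add: open_Int)
qed

lemma frame_in_fibre: "(U, e) \<in> frames E \<Longrightarrow> x \<in> U \<Longrightarrow> i < rank E \<Longrightarrow> e i x \<in> fibre E x"
  unfolding frame_basis(3)[symmetric] by (rule complex_vector.span_base) simp

lemma coord_expansion:
  assumes "(U, e) \<in> frames E" "x \<in> U" "v \<in> fibre E x"
  shows "(\<Sum>i<rank E. coord E e x v i *\<^sub>C e i x) = v"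
proof -
  note b = frame_basis[OF assms(1,2)]
  have "(\<Sum>i<rank E. coord E e x v i *\<^sub>C e i x) =
      (\<Sum>b\<in>(\<lambda>i. e i x) ` {..<rank E}.
        complex_vector.representation ((\<lambda>j. e j x) ` {..<rank E}) v b *\<^sub>C b)"
    unfolding coord_def sum.reindex[OF b(1)] by (simp only: o_def)
  also have "\<dots> = v"
    by (rule complex_vector.sum_representation_eq[OF b(2)]) (use b(3) assms(3) in auto)
  finally show ?thesis .
qed

lemma coord_add:
  assumes "(U, e) \<in> frames E" "x \<in> U" "v \<in> fibre E x" "w \<in> fibre E x"
  shows "coord E e x (v + w) i = coord E e x v i + coord E e x w i"
proof -
  let ?B = "(\<lambda>i. e i x) ` {..<rank E}"
  have "v \<in> complex_vector.span ?B" "w \<in> complex_vector.span ?B"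
    unfolding frame_basis(3)[OF assms(1,2)] by (fact assms)+
  from complex_vector.representation_add[OF frame_basis(2)[OF assms(1,2)] this(2,1)]
  show ?thesis unfolding coord_def by (rule fun_cong)
qed

lemma coord_scale:
  assumes "(U, e) \<in> frames E" "x \<in> U" "v \<in> fibre E x"
  shows "coord E e x (a *\<^sub>C v) i = a * coord E e x v i"
proof -
  let ?B = "(\<lambda>i. e i x) ` {..<rank E}"
  have "v \<in> complex_vector.span ?B"
    unfolding frame_basis(3)[OF assms(1,2)] by (fact assms)
  from complex_vector.representation_scale[OF frame_basis(2)[OF assms(1,2)] this]
  show ?thesis unfolding coord_def by (rule fun_cong)
qed

lemma coord_diff:
  assumes "(U, e) \<in> frames E" "x \<in> U" "v \<in> fibre E x" "w \<in> fibre E x"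
  shows "coord E e x (v - w) i = coord E e x v i - coord E e x w i"
proof -
  have "x \<in> X" using assms(1,2) frame_subset by blast
  then have "v - w \<in> fibre E x"
    using assms(3,4) by (rule complex_vector.subspace_diff[OF fibre_subspace])
  from coord_add[OF assms(1,2) this assms(4), of i] show ?thesis by (simp add: algebra_simps)
qed

lemma coord_zero [simp]: "coord E e x 0 i = 0"
  by (simp add: coord_def complex_vector.representation_zero)

lemma coord_eqI:
  assumes "(U, e) \<in> frames E" "x \<in> U" "v \<in> fibre E x" "w \<in> fibre E x"
    and "\<And>i. i < rank E \<Longrightarrow> coord E e x v i = coord E e x w i"
  shows "v = w"
proof -
  have "(\<Sum>i<rank E. coord E e x v i *\<^sub>C e i x) = (\<Sum>i<rank E. coord E e x w i *\<^sub>C e i x)"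
    by (rule sum.cong) (use assms(5) in auto)
  then show ?thesis
    unfolding coord_expansion[OF assms(1,2,3)] coord_expansion[OF assms(1,2,4)] .
qed

end

section \<open>Square integrable sections\<close>

locale hermitian_bundle_on = bundle_over_manifold C X E
  for C :: "('a::{second_countable_topology,t2_space}, 'n::finite) chart set"
    and X :: "'a set" and E :: "('a, 'e::complex_vector) hermitian_bundle" +
  fixes D :: "'a set" and \<mu> :: "'a measure"
  assumes hermitian: "hermitian_vector_bundle C X E"
    and open_D: "open D" and D_subset: "D \<subseteq> X"
    and sets_\<mu>: "sets \<mu> = sets borel"
begin

abbreviation \<nu> :: "'a measure" where "\<nu> \<equiv> restrict_space \<mu> D"

text \<open>The measurability that \<open>L2_section\<close> asks for, expressed on restricted measure spaces so that the
  rules for functions on a whole measure space apply.\<close>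

definition measurable_section :: "('a \<Rightarrow> 'e) \<Rightarrow> bool" where
  "measurable_section s \<longleftrightarrow> (\<forall>x\<in>D. s x \<in> fibre E x) \<and>
     (\<forall>(U, e)\<in>frames E. \<forall>i<rank E.
        (\<lambda>x. coord E e x (s x) i) \<in> borel_measurable (restrict_space \<mu> (D \<inter> U)))"

definition fnorm :: "'a \<Rightarrow> 'e \<Rightarrow> real" where
  "fnorm x = hermitian_form.nrm (metric E x)"

lemma form: "x \<in> X \<Longrightarrow> hermitian_form (fibre E x) (metric E x)"
  using hermitian_metric_form[OF hermitian] .

lemma definite: "x \<in> X \<Longrightarrow> v \<in> fibre E x \<Longrightarrow> fnorm x v = 0 \<Longrightarrow> v = 0"
  using hermitian_metricD(4)[OF hermitian] hermitian_form.nrm_sq[OF form, of x v]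
  unfolding fnorm_def by fastforce

lemma sets_D: "D \<in> sets \<mu>" "D \<inter> space \<mu> \<in> sets \<mu>" "space \<mu> = UNIV" "space \<nu> = D"
proof -
  show "D \<in> sets \<mu>" using open_D by (simp add: sets_\<mu>)
  show "space \<mu> = UNIV" using sets_eq_imp_space_eq[OF sets_\<mu>] by simp
  then show "D \<inter> space \<mu> \<in> sets \<mu>" "space \<nu> = D"
    using \<open>D \<in> sets \<mu>\<close> by (auto simp: space_restrict_space)
qed

lemma sets_D_Int_frame: "(U, e) \<in> frames E \<Longrightarrow> D \<inter> U \<in> sets \<mu>"
  using open_Int_frame[OF _ open_D D_subset] by (simp add: sets_\<mu>)

lemma set_borel_measurable_iff:
  fixes f :: "'a \<Rightarrow> 'b::real_normed_vector"
  assumes "S \<in> sets \<mu>"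
  shows "set_borel_measurable \<mu> S f \<longleftrightarrow> f \<in> borel_measurable (restrict_space \<mu> S)"
  unfolding set_borel_measurable_def
  by (rule borel_measurable_restrict_space_iff[symmetric]) (simp add: assms sets_D)

lemma set_integrable_iff:
  fixes f :: "'a \<Rightarrow> 'b::{banach, second_countable_topology}"
  shows "set_integrable \<mu> D f \<longleftrightarrow> integrable \<nu> f"
  unfolding set_integrable_def by (rule integrable_restrict_space[symmetric]) (rule sets_D)

lemma L2_section_iff:
  "L2_section \<mu> D E s \<longleftrightarrow> measurable_section s \<and> integrable \<nu> (\<lambda>x. metric E x (s x) (s x))"
proof -
  have "set_borel_measurable \<mu> (D \<inter> U) h \<longleftrightarrow> h \<in> borel_measurable (restrict_space \<mu> (D \<inter> U))"
    if "(U, e) \<in> frames E" for U e and h :: "'a \<Rightarrow> complex"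
    by (rule set_borel_measurable_iff[OF sets_D_Int_frame[OF that]])
  then show ?thesis
    unfolding L2_section_def measurable_section_def set_integrable_iff
    by (auto split: prod.splits)
qed

lemma L2_inner_eq: "L2_inner \<mu> D E s t = (\<integral>x. metric E x (s x) (t x) \<partial>\<nu>)"
  unfolding L2_inner_def set_lebesgue_integral_def
  by (rule integral_restrict_space[symmetric]) (rule sets_D)

lemma L2_inner_cong:
  assumes "\<And>x. x \<in> D \<Longrightarrow> s x = s' x" "\<And>x. x \<in> D \<Longrightarrow> t x = t' x"
  shows "L2_inner \<mu> D E s t = L2_inner \<mu> D E s' t'"
  unfolding L2_inner_eq by (rule Bochner_Integration.integral_cong) (auto simp: sets_D assms)

text \<open>Countably many frame domains cover \<open>D\<close>, because the topology is second countable.\<close>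

lemma measurable_if_frames:
  fixes h :: "'a \<Rightarrow> 'b::topological_space"
  assumes "\<And>U e. (U, e) \<in> frames E \<Longrightarrow> h \<in> borel_measurable (restrict_space \<mu> (D \<inter> U))"
  shows "h \<in> borel_measurable \<nu>"
proof -
  let ?F = "(\<lambda>(U, e). D \<inter> U) ` frames E"
  have "open S" if "S \<in> ?F" for S
    using that open_Int_frame[OF _ open_D D_subset] by auto
  then obtain F where F: "F \<subseteq> ?F" "countable F" "\<Union>F = \<Union>?F" using Lindelof by metis
  have "D \<subseteq> \<Union>?F"
  proof
    fix x assume x: "x \<in> D"
    then obtain U e where "(U, e) \<in> frames E" "x \<in> U" using frame_cover D_subset by blast
    then show "x \<in> \<Union>?F" using x by blast
  qed
  show ?thesis
  proof (rule measurable_piecewise_restrict[OF F(2)])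
    show "space \<nu> \<subseteq> \<Union>F" using \<open>D \<subseteq> \<Union>?F\<close> F(3) sets_D(4) by simp
    fix S assume "S \<in> F"
    then obtain U e where U: "(U, e) \<in> frames E" "S = D \<inter> U" using F(1) by auto
    show "S \<inter> space \<nu> \<in> sets \<nu>"
      using sets_D_Int_frame[OF U(1)] U(2) sets_D
      by (auto simp: sets_restrict_space_iff Int_absorb2 Int_ac)
    have "restrict_space \<nu> S = restrict_space \<mu> (D \<inter> U)"
      using U(2) sets_D by (subst restrict_restrict_space) (auto simp: sets_D_Int_frame[OF U(1)])
    then show "h \<in> borel_measurable (restrict_space \<nu> S)" using assms[OF U(1)] by simp
  qed
qed

lemma metric_expansion:
  assumes e: "(U, e) \<in> frames E" "x \<in> U" and v: "v \<in> fibre E x" "w \<in> fibre E x"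
  shows "metric E x v w = (\<Sum>i<rank E. \<Sum>j<rank E.
    coord E e x v i * (cnj (coord E e x w j) * metric E x (e i x) (e j x)))"
proof -
  have x: "x \<in> X" using e frame_subset by blast
  interpret h: hermitian_form "fibre E x" "metric E x" by (rule form[OF x])
  have ef: "e i x \<in> fibre E x" if "i < rank E" for i using frame_in_fibre[OF e that] .
  have "metric E x v w =
      metric E x (\<Sum>i<rank E. coord E e x v i *\<^sub>C e i x) (\<Sum>j<rank E. coord E e x w j *\<^sub>C e j x)"
    by (simp only: coord_expansion[OF e v(1)] coord_expansion[OF e v(2)])
  also have "\<dots> = (\<Sum>i<rank E. metric E x (coord E e x v i *\<^sub>C e i x)
      (\<Sum>j<rank E. coord E e x w j *\<^sub>C e j x))"
    by (rule h.ip_sum_left) (auto intro!: h.scale_in ef h.sum_in)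
  also have "\<dots> = (\<Sum>i<rank E. \<Sum>j<rank E. metric E x (coord E e x v i *\<^sub>C e i x)
      (coord E e x w j *\<^sub>C e j x))"
    by (intro sum.cong refl h.ip_sum_right) (auto intro!: h.scale_in ef)
  also have "\<dots> = (\<Sum>i<rank E. \<Sum>j<rank E.
    coord E e x v i * (cnj (coord E e x w j) * metric E x (e i x) (e j x)))"
    by (intro sum.cong refl) (simp add: h.scale_left h.scale_right ef)
  finally show ?thesis .
qed

lemma frame_metric_continuous:
  assumes "(U, e) \<in> frames E" "i < rank E" "j < rank E"
  shows "continuous_on U (\<lambda>x. metric E x (e i x) (e j x))"
proof (rule smooth_on_imp_continuous_on[OF smooth])
  have "\<forall>(U, e)\<in>frames E. \<forall>i<rank E. \<forall>j<rank E. smooth_on C U (\<lambda>x. metric E x (e i x) (e j x))"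
    using hermitian unfolding hermitian_vector_bundle_def by (elim conjE)
  then show "smooth_on C U (\<lambda>x. metric E x (e i x) (e j x))" using assms by blast
qed

lemma continuous_imp_measurable_frame:
  assumes "(U, e) \<in> frames E" "continuous_on (D \<inter> U) h"
  shows "(h :: 'a \<Rightarrow> complex) \<in> borel_measurable (restrict_space \<mu> (D \<inter> U))"
proof -
  have "h \<in> borel_measurable (restrict_space borel (D \<inter> U))"
    by (rule borel_measurable_continuous_on_restrict[OF assms(2)])
  moreover have "sets (restrict_space \<mu> (D \<inter> U)) = sets (restrict_space borel (D \<inter> U))"
    by (rule sets_restrict_space_cong[OF sets_\<mu>])
  ultimately show ?thesis using measurable_cong_sets by blast
qed

lemma metric_measurable:
  assumes s: "measurable_section s" and t: "measurable_section t"
  shows "(\<lambda>x. metric E x (s x) (t x)) \<in> borel_measurable \<nu>"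
proof (rule measurable_if_frames)
  fix U e assume e: "(U, e) \<in> frames E"
  let ?N = "restrict_space \<mu> (D \<inter> U)"
  have sp: "space ?N = D \<inter> U" by (simp add: space_restrict_space sets_D)
  have [measurable]: "(\<lambda>x. coord E e x (s x) i) \<in> borel_measurable ?N"
    "(\<lambda>x. coord E e x (t x) i) \<in> borel_measurable ?N" if "i < rank E" for i
    using s t e that unfolding measurable_section_def by blast+
  have [measurable]: "(\<lambda>x. metric E x (e i x) (e j x)) \<in> borel_measurable ?N"
    if "i < rank E" "j < rank E" for i j
    by (intro continuous_imp_measurable_frame[OF e] continuous_on_subset[OF frame_metric_continuous[OF e that]]) simp
  have "cnj \<in> borel_measurable borel"
    by (intro borel_measurable_continuous_onI continuous_intros)
  then have cnj_meas: "(\<lambda>x. cnj (coord E e x (t x) i)) \<in> borel_measurable ?N" if "i < rank E" for i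
    using that by simp
  have "(\<lambda>x. \<Sum>i<rank E. \<Sum>j<rank E. coord E e x (s x) i *
      (cnj (coord E e x (t x) j) * metric E x (e i x) (e j x))) \<in> borel_measurable ?N"
    using cnj_meas by (intro borel_measurable_sum borel_measurable_times) simp_all
  moreover have "metric E x (s x) (t x) = (\<Sum>i<rank E. \<Sum>j<rank E. coord E e x (s x) i *
      (cnj (coord E e x (t x) j) * metric E x (e i x) (e j x)))" if "x \<in> space ?N" for x
  proof -
    have "x \<in> D" "x \<in> U" using that sp by auto
    moreover have "s x \<in> fibre E x" "t x \<in> fibre E x"
      using s t \<open>x \<in> D\<close> unfolding measurable_section_def by blast+
    ultimately show ?thesis using metric_expansion[OF e] by blast
  qed
  ultimately show "(\<lambda>x. metric E x (s x) (t x)) \<in> borel_measurable ?N"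
    using measurable_cong[of ?N] by (simp cong: measurable_cong)
qed

lemma measurable_section_zero: "measurable_section (\<lambda>x. 0)"
  using complex_vector.subspace_0[OF fibre_subspace] D_subset
  unfolding measurable_section_def by auto

lemma measurable_section_linear:
  assumes s: "measurable_section s" and t: "measurable_section t"
  shows "measurable_section (\<lambda>x. s x + a *\<^sub>C t x)"
  unfolding measurable_section_def
proof (intro conjI ballI)
  fix x assume "x \<in> D"
  then show "s x + a *\<^sub>C t x \<in> fibre E x"
    using s t D_subset complex_vector.subspace_add[OF fibre_subspace]
      complex_vector.subspace_scale[OF fibre_subspace]
    unfolding measurable_section_def by blast
next
  fix p assume "p \<in> frames E"
  moreover obtain U e where p: "p = (U, e)" by fastforce
  ultimately have e: "(U, e) \<in> frames E" by simp
  show "case p of (U, e) \<Rightarrow> \<forall>i<rank E.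
      (\<lambda>x. coord E e x (s x + a *\<^sub>C t x) i) \<in> borel_measurable (restrict_space \<mu> (D \<inter> U))"
    unfolding p prod.case
  proof (intro allI impI)
    fix i assume i: "i < rank E"
    have "(\<lambda>x. coord E e x (s x) i + a * coord E e x (t x) i) \<in> borel_measurable (restrict_space \<mu> (D \<inter> U))"
      using s t e i unfolding measurable_section_def
      by (intro borel_measurable_add borel_measurable_times) auto
    then show "(\<lambda>x. coord E e x (s x + a *\<^sub>C t x) i) \<in> borel_measurable (restrict_space \<mu> (D \<inter> U))"
    proof (rule measurable_cong[THEN iffD1, rotated])
      fix x assume "x \<in> space (restrict_space \<mu> (D \<inter> U))"
      then have x: "x \<in> D" "x \<in> U" by (auto simp: space_restrict_space)
      have f: "s x \<in> fibre E x" "t x \<in> fibre E x" using s t x by (auto simp: measurable_section_def)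
      have "a *\<^sub>C t x \<in> fibre E x"
        using f(2) x(1) D_subset by (intro complex_vector.subspace_scale[OF fibre_subspace]) auto
      then show "coord E e x (s x) i + a * coord E e x (t x) i = coord E e x (s x + a *\<^sub>C t x) i"
        using coord_add[OF e x(2) f(1)] coord_scale[OF e x(2) f(2)] by simp
    qed
  qed
qed

lemma measurable_section_add:
  assumes "measurable_section s" "measurable_section t"
  shows "measurable_section (\<lambda>x. s x + t x)"
  using measurable_section_linear[OF assms, of 1] by (simp add: scaleC_one)

lemma measurable_section_scale:
  assumes "measurable_section s"
  shows "measurable_section (\<lambda>x. a *\<^sub>C s x)"
  using measurable_section_linear[OF measurable_section_zero assms, of a] by simp

lemma measurable_section_diff:
  assumes s: "measurable_section s" and t: "measurable_section t"
  shows "measurable_section (\<lambda>x. s x - t x)"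
  using measurable_section_add[OF s measurable_section_scale[OF t, of "-1"]] by simp

lemma section_fibre: "measurable_section s \<Longrightarrow> x \<in> D \<Longrightarrow> s x \<in> fibre E x"
  by (simp add: measurable_section_def)

lemma fnorm_sq: "measurable_section s \<Longrightarrow> x \<in> D \<Longrightarrow> (fnorm x (s x))\<^sup>2 = Re (metric E x (s x) (s x))"
  unfolding fnorm_def using hermitian_form.nrm_sq[OF form] section_fibre D_subset by blast

lemma metric_self:
  "measurable_section s \<Longrightarrow> x \<in> D \<Longrightarrow> metric E x (s x) (s x) = complex_of_real ((fnorm x (s x))\<^sup>2)"
  unfolding fnorm_def using hermitian_form.ip_self[OF form] section_fibre D_subset by blast

lemma fnorm_sq_measurable:
  assumes "measurable_section s"
  shows "(\<lambda>x. (fnorm x (s x))\<^sup>2) \<in> borel_measurable \<nu>"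
proof -
  have "(\<lambda>x. Re (metric E x (s x) (s x))) \<in> borel_measurable \<nu>"
    using metric_measurable[OF assms assms] by simp
  then show ?thesis
    by (rule measurable_cong[THEN iffD1, rotated]) (simp add: fnorm_sq[OF assms] sets_D)
qed

text \<open>The squared \<open>L\<^sup>2\<close> norm, with value \<open>\<infinity>\<close> for sections that are not square integrable.\<close>

definition energy :: "('a \<Rightarrow> 'e) \<Rightarrow> ennreal" where
  "energy s = (\<integral>\<^sup>+x. ennreal ((fnorm x (s x))\<^sup>2) \<partial>\<nu>)"

lemma L2_section_energy: "L2_section \<mu> D E s \<longleftrightarrow> measurable_section s \<and> energy s < \<infinity>"
proof -
  have "integrable \<nu> (\<lambda>x. metric E x (s x) (s x)) \<longleftrightarrow> energy s < \<infinity>" if s: "measurable_section s"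
  proof -
    have "(\<integral>\<^sup>+x. ennreal (norm (metric E x (s x) (s x))) \<partial>\<nu>) = energy s"
      unfolding energy_def
      by (rule nn_integral_cong) (simp add: metric_self[OF s] sets_D norm_power)
    then show ?thesis
      unfolding integrable_iff_bounded using metric_measurable[OF s s] by simp
  qed
  then show ?thesis unfolding L2_section_iff by blast
qed

lemma L2_inner_integrable:
  assumes "L2_section \<mu> D E s" "L2_section \<mu> D E t"
  shows "integrable \<nu> (\<lambda>x. metric E x (s x) (t x))"
proof (rule Bochner_Integration.integrable_bound)
  have m: "measurable_section s" "measurable_section t" using assms L2_section_iff by blast+
  show "(\<lambda>x. metric E x (s x) (t x)) \<in> borel_measurable \<nu>" by (rule metric_measurable[OF m])
  show "integrable \<nu> (\<lambda>x. metric E x (s x) (s x) + metric E x (t x) (t x))"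
    using assms L2_section_iff by (intro Bochner_Integration.integrable_add) blast+
  show "AE x in \<nu>. norm (metric E x (s x) (t x)) \<le> norm (metric E x (s x) (s x) + metric E x (t x) (t x))"
  proof (rule AE_I2)
    fix x assume "x \<in> space \<nu>"
    then have x: "x \<in> D" by (simp add: sets_D)
    interpret h: hermitian_form "fibre E x" "metric E x" by (rule form) (use x D_subset in blast)
    have f: "s x \<in> fibre E x" "t x \<in> fibre E x" using section_fibre m x by blast+
    have "norm (metric E x (s x) (t x)) \<le> fnorm x (s x) * fnorm x (t x)"
      unfolding fnorm_def by (rule h.cauchy_schwarz[OF f])
    also have "\<dots> \<le> (fnorm x (s x))\<^sup>2 + (fnorm x (t x))\<^sup>2"
    proof -
      have "2 * (fnorm x (s x) * fnorm x (t x)) \<le> (fnorm x (s x))\<^sup>2 + (fnorm x (t x))\<^sup>2"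
        using sum_squares_bound[of "fnorm x (s x)" "fnorm x (t x)"] by (simp add: mult.assoc)
      moreover have "0 \<le> fnorm x (s x) * fnorm x (t x)"
        unfolding fnorm_def using f by simp
      ultimately show ?thesis by linarith
    qed
    also have "\<dots> = norm (complex_of_real ((fnorm x (s x))\<^sup>2 + (fnorm x (t x))\<^sup>2))"
      by (simp only: norm_of_real) simp
    also have "\<dots> = norm (metric E x (s x) (s x) + metric E x (t x) (t x))"
      using metric_self[OF m(1) x] metric_self[OF m(2) x] by simp
    finally show "norm (metric E x (s x) (t x)) \<le> norm (metric E x (s x) (s x) + metric E x (t x) (t x))" .
  qed
qed

lemma energy_add:
  assumes m: "measurable_section s" "measurable_section t"
  shows "energy (\<lambda>x. s x + t x) \<le> 2 * energy s + 2 * energy t"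
proof -
  have "energy (\<lambda>x. s x + t x) \<le>
      (\<integral>\<^sup>+x. 2 * ennreal ((fnorm x (s x))\<^sup>2) + 2 * ennreal ((fnorm x (t x))\<^sup>2) \<partial>\<nu>)"
    unfolding energy_def
  proof (rule nn_integral_mono)
    fix x assume "x \<in> space \<nu>"
    then have x: "x \<in> D" by (simp add: sets_D)
    interpret h: hermitian_form "fibre E x" "metric E x" by (rule form) (use x D_subset in blast)
    have "(fnorm x (s x + t x))\<^sup>2 \<le> 2 * (fnorm x (s x))\<^sup>2 + 2 * (fnorm x (t x))\<^sup>2"
      unfolding fnorm_def using section_fibre m x by (intro h.nrm_add_sq_le) blast+
    then have "ennreal ((fnorm x (s x + t x))\<^sup>2) \<le> ennreal (2 * (fnorm x (s x))\<^sup>2 + 2 * (fnorm x (t x))\<^sup>2)"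
      by (rule ennreal_leI)
    then show "ennreal ((fnorm x (s x + t x))\<^sup>2) \<le> 2 * ennreal ((fnorm x (s x))\<^sup>2) + 2 * ennreal ((fnorm x (t x))\<^sup>2)"
      by (simp add: ennreal_plus ennreal_mult)
  qed
  also have "\<dots> = 2 * energy s + 2 * energy t"
    unfolding energy_def using fnorm_sq_measurable[OF m(1)] fnorm_sq_measurable[OF m(2)]
    by (simp add: nn_integral_add nn_integral_cmult)
  finally show ?thesis .
qed

lemma L2_section_add:
  assumes "L2_section \<mu> D E s" "L2_section \<mu> D E t"
  shows "L2_section \<mu> D E (\<lambda>x. s x + t x)"
proof -
  have m: "measurable_section s" "measurable_section t" "energy s < \<infinity>" "energy t < \<infinity>"
    using assms L2_section_energy by blast+
  then have "2 * energy s + 2 * energy t < \<infinity>" by (simp add: ennreal_mult_less_top)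
  then show ?thesis
    unfolding L2_section_energy using m measurable_section_add energy_add by (metis order_le_less_trans)
qed

lemma L2_section_scale:
  assumes "L2_section \<mu> D E s"
  shows "L2_section \<mu> D E (\<lambda>x. a *\<^sub>C s x)"
proof -
  have m: "measurable_section s" "integrable \<nu> (\<lambda>x. metric E x (s x) (s x))"
    using assms L2_section_iff by blast+
  have "integrable \<nu> (\<lambda>x. (a * cnj a) * metric E x (s x) (s x))" using m(2) by simp
  moreover have "integrable \<nu> (\<lambda>x. (a * cnj a) * metric E x (s x) (s x)) \<longleftrightarrow>
      integrable \<nu> (\<lambda>x. metric E x (a *\<^sub>C s x) (a *\<^sub>C s x))"
  proof (rule Bochner_Integration.integrable_cong[OF refl])
    fix x assume "x \<in> space \<nu>"
    then have x: "x \<in> D" by (simp add: sets_D)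
    interpret h: hermitian_form "fibre E x" "metric E x" by (rule form) (use x D_subset in blast)
    show "a * cnj a * metric E x (s x) (s x) = metric E x (a *\<^sub>C s x) (a *\<^sub>C s x)"
      using section_fibre[OF m(1) x] by (simp add: h.scale_left h.scale_right)
  qed
  ultimately show ?thesis unfolding L2_section_iff using measurable_section_scale[OF m(1)] by blast
qed

lemma L2_section_zero: "L2_section \<mu> D E (\<lambda>x. 0)"
proof -
  have "fnorm x 0 = 0" if "x \<in> D" for x
    unfolding fnorm_def by (rule hermitian_form.nrm_zero[OF form]) (use that D_subset in blast)
  then have "energy (\<lambda>x. 0) = (\<integral>\<^sup>+x. 0 \<partial>\<nu>)"
    unfolding energy_def by (intro nn_integral_cong) (simp add: sets_D)
  then show ?thesis unfolding L2_section_energy using measurable_section_zero by simp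
qed

lemma L2_hermitian: "hermitian_form (Collect (L2_section \<mu> D E)) (L2_inner \<mu> D E)"
proof
  show "complex_vector.subspace (Collect (L2_section \<mu> D E))"
    unfolding complex_vector.subspace_def
    using L2_section_zero L2_section_add L2_section_scale
    by (auto simp: zero_fun_def plus_fun_def scaleC_fun_def)
next
  fix u v w assume uvw: "u \<in> Collect (L2_section \<mu> D E)" "v \<in> Collect (L2_section \<mu> D E)"
    "w \<in> Collect (L2_section \<mu> D E)"
  then have m: "measurable_section u" "measurable_section v" "measurable_section w"
    using L2_section_iff by auto
  have "L2_inner \<mu> D E (u + v) w = (\<integral>x. metric E x (u x) (w x) + metric E x (v x) (w x) \<partial>\<nu>)"
    unfolding L2_inner_eq
  proof (rule Bochner_Integration.integral_cong[OF refl])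
    fix x assume "x \<in> space \<nu>"
    then have x: "x \<in> D" by (simp add: sets_D)
    interpret h: hermitian_form "fibre E x" "metric E x" by (rule form) (use x D_subset in blast)
    show "metric E x ((u + v) x) (w x) = metric E x (u x) (w x) + metric E x (v x) (w x)"
      using section_fibre m x by (simp add: h.add_left)
  qed
  also have "\<dots> = L2_inner \<mu> D E u w + L2_inner \<mu> D E v w"
    unfolding L2_inner_eq using uvw by (intro Bochner_Integration.integral_add L2_inner_integrable) auto
  finally show "L2_inner \<mu> D E (u + v) w = L2_inner \<mu> D E u w + L2_inner \<mu> D E v w" .
next
  fix u w a assume uw: "u \<in> Collect (L2_section \<mu> D E)" "w \<in> Collect (L2_section \<mu> D E)"
  then have m: "measurable_section u" "measurable_section w" using L2_section_iff by auto
  have "L2_inner \<mu> D E (a *\<^sub>C u) w = (\<integral>x. a * metric E x (u x) (w x) \<partial>\<nu>)"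
    unfolding L2_inner_eq
  proof (rule Bochner_Integration.integral_cong[OF refl])
    fix x assume "x \<in> space \<nu>"
    then have x: "x \<in> D" by (simp add: sets_D)
    interpret h: hermitian_form "fibre E x" "metric E x" by (rule form) (use x D_subset in blast)
    show "metric E x ((a *\<^sub>C u) x) (w x) = a * metric E x (u x) (w x)"
      using section_fibre m x by (simp add: h.scale_left)
  qed
  also have "\<dots> = a * L2_inner \<mu> D E u w" unfolding L2_inner_eq by simp
  finally show "L2_inner \<mu> D E (a *\<^sub>C u) w = a * L2_inner \<mu> D E u w" .
next
  fix u v assume uv: "u \<in> Collect (L2_section \<mu> D E)" "v \<in> Collect (L2_section \<mu> D E)"
  then have m: "measurable_section u" "measurable_section v" using L2_section_iff by auto
  have "L2_inner \<mu> D E v u = (\<integral>x. cnj (metric E x (u x) (v x)) \<partial>\<nu>)"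
    unfolding L2_inner_eq
  proof (rule Bochner_Integration.integral_cong[OF refl])
    fix x assume "x \<in> space \<nu>"
    then have x: "x \<in> D" by (simp add: sets_D)
    interpret h: hermitian_form "fibre E x" "metric E x" by (rule form) (use x D_subset in blast)
    show "metric E x (v x) (u x) = cnj (metric E x (u x) (v x))"
      using section_fibre m x by (intro h.sym) blast+
  qed
  then show "L2_inner \<mu> D E v u = cnj (L2_inner \<mu> D E u v)" unfolding L2_inner_eq by simp
next
  fix u assume "u \<in> Collect (L2_section \<mu> D E)"
  then have u: "L2_section \<mu> D E u" "measurable_section u" using L2_section_iff by auto
  have "Re (L2_inner \<mu> D E u u) = (\<integral>x. Re (metric E x (u x) (u x)) \<partial>\<nu>)"
    unfolding L2_inner_eq using L2_inner_integrable[OF u(1) u(1)] by simp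
  also have "0 \<le> \<dots>"
    by (rule Bochner_Integration.integral_nonneg) (simp add: sets_D fnorm_sq[OF u(2), symmetric])
  finally show "0 \<le> Re (L2_inner \<mu> D E u u)" .
qed

lemma energy_L2_norm:
  assumes "L2_section \<mu> D E s"
  shows "energy s = ennreal ((L2_norm \<mu> D E s)\<^sup>2)"
proof -
  have m: "measurable_section s" using assms L2_section_iff by blast
  have i: "integrable \<nu> (\<lambda>x. Re (metric E x (s x) (s x)))"
    using L2_inner_integrable[OF assms assms] by simp
  have "energy s = (\<integral>\<^sup>+x. ennreal (Re (metric E x (s x) (s x))) \<partial>\<nu>)"
    unfolding energy_def by (rule nn_integral_cong) (simp add: fnorm_sq[OF m] sets_D)
  also have "\<dots> = ennreal (\<integral>x. Re (metric E x (s x) (s x)) \<partial>\<nu>)"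
    by (rule nn_integral_eq_integral[OF i]) (auto intro!: AE_I2 simp: sets_D fnorm_sq[OF m, symmetric])
  also have "(\<integral>x. Re (metric E x (s x) (s x)) \<partial>\<nu>) = Re (L2_inner \<mu> D E s s)"
    unfolding L2_inner_eq using L2_inner_integrable[OF assms assms] by simp
  also have "\<dots> = (L2_norm \<mu> D E s)\<^sup>2"
    unfolding L2_norm_def using hermitian_form.nonneg[OF L2_hermitian, of s] assms by simp
  finally show ?thesis .
qed

lemma L2_norm_nrm: "L2_norm \<mu> D E = hermitian_form.nrm (L2_inner \<mu> D E)"
  by (rule ext) (simp add: L2_norm_def hermitian_form.nrm_def[OF L2_hermitian])

end

section \<open>Completeness of the space of square integrable sections\<close>

lemma convergent_if_summable_increments:
  fixes f :: "nat \<Rightarrow> 'a::banach"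
  assumes "summable (\<lambda>n. f (Suc n) - f n)"
  shows "convergent f"
proof -
  have "(\<lambda>n. f 0 + (\<Sum>k<n. f (Suc k) - f k)) \<longlonglongrightarrow> f 0 + (\<Sum>k. f (Suc k) - f k)"
    using summable_LIMSEQ[OF assms] by (intro tendsto_add tendsto_const)
  then have "f \<longlonglongrightarrow> f 0 + (\<Sum>k. f (Suc k) - f k)"
    by (simp add: sum_lessThan_telescope)
  then show ?thesis by (rule convergentI)
qed

context hermitian_bundle_on
begin

lemma coord_bound:
  assumes e: "(U, e) \<in> frames E" "x \<in> U"
  shows "\<exists>K\<ge>0. \<forall>v\<in>fibre E x. \<forall>i<rank E. cmod (coord E e x v i) \<le> K * fnorm x v"
proof -
  have x: "x \<in> X" using e frame_subset by blast
  interpret h: hermitian_form "fibre E x" "metric E x" by (rule form[OF x])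
  let ?B = "(\<lambda>i. e i x) ` {..<rank E}"
  note b = frame_basis[OF e]
  have B: "finite ?B" "?B \<subseteq> fibre E x" using frame_in_fibre[OF e] by auto
  have "\<exists>K\<ge>0. \<forall>c. \<forall>y\<in>?B. cmod (c y) \<le> K * h.nrm (\<Sum>y\<in>?B. c y *\<^sub>C y)"
    by (rule h.coefficient_bound[OF B b(2)]) (rule definite[OF x, unfolded fnorm_def])
  then obtain K where K: "0 \<le> K" "\<forall>c. \<forall>y\<in>?B. cmod (c y) \<le> K * h.nrm (\<Sum>y\<in>?B. c y *\<^sub>C y)"
    by (elim exE conjE)
  have "cmod (coord E e x v i) \<le> K * fnorm x v" if v: "v \<in> fibre E x" and i: "i < rank E" for v i
  proof -
    have "(\<Sum>y\<in>?B. complex_vector.representation ?B v y *\<^sub>C y) = v"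
      by (rule complex_vector.sum_representation_eq[OF b(2)]) (use b(3) v B in auto)
    then show ?thesis
      using bspec[OF spec[OF K(2), of "complex_vector.representation ?B v"], of "e i x"] i
      unfolding coord_def fnorm_def by simp
  qed
  then show ?thesis using K(1) by blast
qed

text \<open>Fibres are finite-dimensional, so it suffices that the coordinates in one frame converge.\<close>

lemma fibre_limit:
  assumes x: "x \<in> X" and v: "\<And>n. v n \<in> fibre E x"
    and sm: "summable (\<lambda>n. fnorm x (v (Suc n) - v n))"
  shows "\<exists>w\<in>fibre E x. (\<lambda>n. fnorm x (v n - w)) \<longlonglongrightarrow> 0"
proof -
  interpret h: hermitian_form "fibre E x" "metric E x" by (rule form[OF x])
  obtain U e where e: "(U, e) \<in> frames E" "x \<in> U" using frame_cover[OF x] .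
  obtain K where K: "0 \<le> K" "\<And>v i. v \<in> fibre E x \<Longrightarrow> i < rank E \<Longrightarrow> cmod (coord E e x v i) \<le> K * fnorm x v"
    using coord_bound[OF e] by blast
  have "\<exists>l. (\<lambda>n. coord E e x (v n) i) \<longlonglongrightarrow> l" if i: "i < rank E" for i
  proof -
    have "summable (\<lambda>n. coord E e x (v (Suc n)) i - coord E e x (v n) i)"
    proof (rule summable_comparison_test)
      show "summable (\<lambda>n. K * fnorm x (v (Suc n) - v n))" using sm by (rule summable_mult)
      have "norm (coord E e x (v (Suc n)) i - coord E e x (v n) i) \<le> K * fnorm x (v (Suc n) - v n)" for n
        using K(2)[OF h.diff_in[OF v[of "Suc n"] v[of n]] i]
        unfolding coord_diff[OF e v[of "Suc n"] v[of n]] .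
      then show "\<exists>N. \<forall>n\<ge>N. norm (coord E e x (v (Suc n)) i - coord E e x (v n) i) \<le> K * fnorm x (v (Suc n) - v n)"
        by blast
    qed
    from convergent_if_summable_increments[of "\<lambda>n. coord E e x (v n) i", OF this]
    show ?thesis unfolding convergent_def .
  qed
  then obtain l where l: "\<And>i. i < rank E \<Longrightarrow> (\<lambda>n. coord E e x (v n) i) \<longlonglongrightarrow> l i" by metis
  have ef: "e i x \<in> fibre E x" if "i < rank E" for i using frame_in_fibre[OF e that] .
  let ?w = "\<Sum>i<rank E. l i *\<^sub>C e i x"
  have w: "?w \<in> fibre E x" using ef by (intro h.sum_in h.scale_in) auto
  have bound0: "(\<lambda>n. \<Sum>i<rank E. cmod (coord E e x (v n) i - l i) * fnorm x (e i x)) \<longlonglongrightarrow> 0"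
  proof (rule tendsto_null_sum)
    fix i assume "i \<in> {..<rank E}"
    then have "(\<lambda>n. cmod (coord E e x (v n) i - l i)) \<longlonglongrightarrow> 0"
      using l by (intro tendsto_norm_zero LIM_zero) auto
    then show "(\<lambda>n. cmod (coord E e x (v n) i - l i) * fnorm x (e i x)) \<longlonglongrightarrow> 0"
      by (rule tendsto_mult_left_zero)
  qed
  have bound: "norm (fnorm x (v n - ?w)) \<le> (\<Sum>i<rank E. cmod (coord E e x (v n) i - l i) * fnorm x (e i x))" for n
  proof -
    have "v n - ?w = (\<Sum>i<rank E. coord E e x (v n) i *\<^sub>C e i x) - ?w"
      by (simp only: coord_expansion[OF e v])
    also have "\<dots> = (\<Sum>i<rank E. (coord E e x (v n) i - l i) *\<^sub>C e i x)"
      by (simp add: complex_vector.scale_left_diff_distrib sum_subtractf)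
    finally have eq: "v n - ?w = (\<Sum>i<rank E. (coord E e x (v n) i - l i) *\<^sub>C e i x)" .
    have "fnorm x (v n - ?w) \<le> (\<Sum>i<rank E. fnorm x ((coord E e x (v n) i - l i) *\<^sub>C e i x))"
      unfolding eq fnorm_def using ef by (intro h.nrm_sum_le h.scale_in) auto
    also have "\<dots> = (\<Sum>i<rank E. cmod (coord E e x (v n) i - l i) * fnorm x (e i x))"
      unfolding fnorm_def using ef by (intro sum.cong refl h.nrm_scale) auto
    finally show ?thesis using h.nrm_nonneg[OF h.diff_in[OF v w]] unfolding fnorm_def by simp
  qed
  have "(\<lambda>n. fnorm x (v n - ?w)) \<longlonglongrightarrow> 0"
    by (rule Lim_null_comparison[OF always_eventually[OF allI[OF bound]] bound0])
  then show ?thesis using w by blast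
qed

text \<open>The limit in \<open>fibre_limit\<close> is found with one frame, but measurability of the limit section has to be
  checked in every frame.\<close>

lemma coord_tendsto:
  assumes e: "(U, e) \<in> frames E" "x \<in> U" and v: "\<And>n. v n \<in> fibre E x" "w \<in> fibre E x"
    and lim: "(\<lambda>n. fnorm x (v n - w)) \<longlonglongrightarrow> 0" and i: "i < rank E"
  shows "(\<lambda>n. coord E e x (v n) i) \<longlonglongrightarrow> coord E e x w i"
proof -
  have x: "x \<in> X" using e frame_subset by blast
  interpret h: hermitian_form "fibre E x" "metric E x" by (rule form[OF x])
  obtain K where K: "0 \<le> K" "\<And>v i. v \<in> fibre E x \<Longrightarrow> i < rank E \<Longrightarrow> cmod (coord E e x v i) \<le> K * fnorm x v"
    using coord_bound[OF e] by blast
  have "norm (coord E e x (v n) i - coord E e x w i) \<le> K * fnorm x (v n - w)" for n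
    using K(2)[OF h.diff_in[OF v(1)[of n] v(2)] i] unfolding coord_diff[OF e v(1)[of n] v(2)] .
  then have "(\<lambda>n. coord E e x (v n) i - coord E e x w i) \<longlonglongrightarrow> 0"
    by (rule Lim_null_comparison[OF always_eventually[OF allI] tendsto_mult_right_zero[OF lim]])
  then show ?thesis by (simp add: LIM_zero_iff)
qed

text \<open>On the complement of the set \<open>G\<close> of convergence the limit is set to zero, the only element that
  all fibres are known to contain.\<close>

lemma pointwise_limit_measurable:
  assumes s: "\<And>n. measurable_section (s n)" and G: "G \<in> sets \<nu>"
    and g: "\<And>x. x \<in> G \<Longrightarrow> g x \<in> fibre E x \<and> (\<lambda>n. fnorm x (s n x - g x)) \<longlonglongrightarrow> 0"
    and g0: "\<And>x. x \<in> D - G \<Longrightarrow> g x = 0"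
  shows "measurable_section g"
  unfolding measurable_section_def
proof (intro conjI ballI, goal_cases)
  case (1 x)
  then show ?case using g g0 D_subset complex_vector.subspace_0[OF fibre_subspace] by (cases "x \<in> G") auto
next
  case (2 p)
  obtain U e where p: "p = (U, e)" by fastforce
  have e: "(U, e) \<in> frames E" using 2 p by simp
  let ?N = "restrict_space \<mu> (D \<inter> U)"
  have GD: "G \<subseteq> D" using sets.sets_into_space[OF G] sets_D by simp
  have G\<mu>: "G \<in> sets \<mu>" using G sets_D by (simp add: sets_restrict_space_iff)
  have [measurable]: "G \<inter> U \<in> sets ?N"
  proof -
    have "G \<inter> U = G \<inter> (D \<inter> U)" using GD by blast
    then have "G \<inter> U \<in> sets \<mu>" using G\<mu> sets_D_Int_frame[OF e] by simp
    then show ?thesis using sets_D_Int_frame[OF e] GD sets_D by (simp add: sets_restrict_space_iff) blast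
  qed
  show ?case unfolding p prod.case
  proof (intro allI impI)
    fix i assume i: "i < rank E"
    show "(\<lambda>x. coord E e x (g x) i) \<in> borel_measurable ?N"
    proof (rule borel_measurable_LIMSEQ_metric)
      fix n
      have [measurable]: "(\<lambda>x. coord E e x (s n x) i) \<in> borel_measurable ?N"
        using s[of n] e i unfolding measurable_section_def by blast
      show "(\<lambda>x. indicator (G \<inter> U) x *\<^sub>R coord E e x (s n x) i) \<in> borel_measurable ?N" by measurable
    next
      fix x assume "x \<in> space ?N"
      then have x: "x \<in> D" "x \<in> U" by (auto simp: space_restrict_space)
      show "(\<lambda>n. indicator (G \<inter> U) x *\<^sub>R coord E e x (s n x) i) \<longlonglongrightarrow> coord E e x (g x) i"
      proof (cases "x \<in> G")
        case True
        have "(\<lambda>n. coord E e x (s n x) i) \<longlonglongrightarrow> coord E e x (g x) i"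
          using g[OF True] section_fibre[OF s x(1)] by (intro coord_tendsto[OF e x(2) _ _ _ i]) auto
        then show ?thesis using True x by simp
      next
        case False
        then show ?thesis using g0[of x] x by simp
      qed
    qed
  qed
qed

text \<open>Let \<open>h\<^sub>n(x)\<close> be the squared length of the \<open>n\<close>-th increment at \<open>x\<close>, with integral at most \<open>4\<^sup>-\<^sup>n\<close>. The series
  \<open>\<Sum>n. 2\<^sup>n h\<^sub>n(x)\<close> has a finite integral, so at almost every \<open>x\<close> it has a finite sum \<open>K\<close>. There the
  length of the \<open>n\<close>-th increment is at most \<open>\<surd>K (1 / \<surd>2)\<^sup>n\<close>, which is summable.\<close>

lemma rapidly_cauchy_limit:
  assumes s: "\<And>n. L2_section \<mu> D E (s n)"
    and r: "\<And>n. L2_norm \<mu> D E (\<lambda>x. s (Suc n) x - s n x) \<le> (1/2) ^ n"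
  shows "\<exists>g. measurable_section g \<and> (AE x in \<nu>. (\<lambda>n. fnorm x (s n x - g x)) \<longlonglongrightarrow> 0)"
proof -
  have m: "measurable_section (s n)" for n using s L2_section_iff by blast
  have md: "measurable_section (\<lambda>x. s (Suc n) x - s n x)" for n
    by (rule measurable_section_diff[OF m m])
  define h where "h n x = (fnorm x (s (Suc n) x - s n x))\<^sup>2" for n x
  have h_meas [measurable]: "h n \<in> borel_measurable \<nu>" for n
    unfolding h_def by (rule fnorm_sq_measurable[OF md])
  have Ld: "L2_section \<mu> D E (\<lambda>x. s (Suc n) x - s n x)" for n
    using L2_section_add[OF s[of "Suc n"] L2_section_scale[OF s[of n], of "-1"]] by simp
  have h_int: "(\<integral>\<^sup>+x. ennreal (h n x) \<partial>\<nu>) \<le> ennreal ((1/4) ^ n)" for n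
  proof -
    have "(\<integral>\<^sup>+x. ennreal (h n x) \<partial>\<nu>) = ennreal ((L2_norm \<mu> D E (\<lambda>x. s (Suc n) x - s n x))\<^sup>2)"
      using energy_L2_norm[OF Ld] unfolding energy_def h_def .
    also have "\<dots> \<le> ennreal (((1/2) ^ n)\<^sup>2)"
      using r[of n] hermitian_form.nrm_nonneg[OF L2_hermitian] Ld
      by (intro ennreal_leI power_mono) (auto simp: L2_norm_nrm)
    also have "((1/2) ^ n)\<^sup>2 = (1/4 :: real) ^ n"
      by (simp add: power2_eq_square power_mult_distrib[symmetric])
    finally show ?thesis .
  qed
  define S where "S x = (\<Sum>n. ennreal (2 ^ n * h n x))" for x
  have S_meas [measurable]: "S \<in> borel_measurable \<nu>" unfolding S_def by measurable
  have "(\<integral>\<^sup>+x. S x \<partial>\<nu>) = (\<Sum>n. \<integral>\<^sup>+x. ennreal (2 ^ n * h n x) \<partial>\<nu>)"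
    unfolding S_def by (rule nn_integral_suminf) measurable
  also have "\<dots> \<le> (\<Sum>n. ennreal ((1/2) ^ n))"
  proof (rule suminf_le)
    fix n
    have "(\<integral>\<^sup>+x. ennreal (2 ^ n * h n x) \<partial>\<nu>) = (\<integral>\<^sup>+x. ennreal (2 ^ n) * ennreal (h n x) \<partial>\<nu>)"
      by (intro nn_integral_cong) (simp add: ennreal_mult h_def)
    also have "\<dots> = ennreal (2 ^ n) * (\<integral>\<^sup>+x. ennreal (h n x) \<partial>\<nu>)" by (rule nn_integral_cmult) measurable
    also have "\<dots> \<le> ennreal (2 ^ n) * ennreal ((1/4) ^ n)" using h_int by (rule mult_left_mono) simp
    also have "\<dots> = ennreal ((1/2) ^ n)"
      by (simp add: ennreal_mult[symmetric] power_mult_distrib[symmetric])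
    finally show "(\<integral>\<^sup>+x. ennreal (2 ^ n * h n x) \<partial>\<nu>) \<le> ennreal ((1/2) ^ n)" .
  qed auto
  also have "\<dots> = ennreal (\<Sum>n. (1/2) ^ n)"
    by (rule suminf_ennreal2) (auto intro: summable_geometric)
  finally have "(\<integral>\<^sup>+x. S x \<partial>\<nu>) \<noteq> \<infinity>" by (auto simp: top_unique)
  from nn_integral_PInf_AE[OF S_meas this] have AE_S: "AE x in \<nu>. S x \<noteq> \<infinity>" .
  define G where "G = {x\<in>space \<nu>. S x \<noteq> \<infinity>}"
  have G: "G \<in> sets \<nu>" unfolding G_def by measurable
  have "\<exists>w\<in>fibre E x. (\<lambda>n. fnorm x (s n x - w)) \<longlonglongrightarrow> 0" if "x \<in> G" for x
  proof -
    have x: "x \<in> D" "S x \<noteq> \<infinity>" using that by (auto simp: G_def sets_D)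
    then have xX: "x \<in> X" using D_subset by blast
    interpret f: hermitian_form "fibre E x" "metric E x" by (rule form[OF xX])
    define K where "K = enn2real (S x)"
    have SK: "S x = ennreal K" using x(2) by (simp add: K_def ennreal_enn2real less_top)
    have hK: "2 ^ n * h n x \<le> K" for n
    proof -
      have "ennreal (2 ^ n * h n x) = (\<Sum>k\<in>{n}. ennreal (2 ^ k * h k x))" by simp
      also have "\<dots> \<le> S x" unfolding S_def by (rule sum_le_suminf) auto
      finally show ?thesis unfolding SK by (simp add: K_def)
    qed
    have "summable (\<lambda>n. fnorm x (s (Suc n) x - s n x))"
    proof (rule summable_comparison_test)
      have "norm (sqrt (1/2)) < 1" by (simp add: real_sqrt_divide)
      then show "summable (\<lambda>n. sqrt K * sqrt (1/2) ^ n)" by (intro summable_mult summable_geometric)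
      have "norm (fnorm x (s (Suc n) x - s n x)) \<le> sqrt K * sqrt (1/2) ^ n" for n
      proof -
        have "fnorm x (s (Suc n) x - s n x) = sqrt (h n x)"
          unfolding h_def fnorm_def using section_fibre[OF m x(1)] by simp
        moreover have "h n x \<le> K * (1/2) ^ n" using hK[of n] by (simp add: field_simps power_divide)
        then have "sqrt (h n x) \<le> sqrt (K * (1/2) ^ n)" by (rule real_sqrt_le_mono)
        moreover have "0 \<le> sqrt (h n x)" by (simp add: h_def)
        ultimately show ?thesis by (simp add: real_sqrt_mult real_sqrt_power)
      qed
      then show "\<exists>N. \<forall>n\<ge>N. norm (fnorm x (s (Suc n) x - s n x)) \<le> sqrt K * sqrt (1/2) ^ n" by blast
    qed
    then show ?thesis by (rule fibre_limit[OF xX section_fibre[OF m x(1)]])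
  qed
  then obtain w where w: "\<And>x. x \<in> G \<Longrightarrow> w x \<in> fibre E x \<and> (\<lambda>n. fnorm x (s n x - w x)) \<longlonglongrightarrow> 0" by metis
  define g where "g x = (if x \<in> G then w x else 0)" for x
  have "measurable_section g"
    by (rule pointwise_limit_measurable[where s = s, OF m G]) (use w in \<open>auto simp: g_def\<close>)
  moreover have "AE x in \<nu>. (\<lambda>n. fnorm x (s n x - g x)) \<longlonglongrightarrow> 0"
    using AE_S by (rule AE_mp) (use w in \<open>auto intro!: AE_I2 simp: G_def g_def\<close>)
  ultimately show ?thesis by blast
qed

text \<open>Fatou's lemma for sections.\<close>

lemma energy_liminf:
  assumes s: "\<And>n. measurable_section (s n)" and t: "measurable_section t" and g: "measurable_section g"
    and lim: "AE x in \<nu>. (\<lambda>n. fnorm x (s n x - g x)) \<longlonglongrightarrow> 0"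
    and bound: "eventually (\<lambda>n. energy (\<lambda>x. t x - s n x) \<le> c) sequentially"
  shows "energy (\<lambda>x. t x - g x) \<le> c"
proof -
  have "energy (\<lambda>x. t x - g x) = (\<integral>\<^sup>+x. liminf (\<lambda>n. ennreal ((fnorm x (t x - s n x))\<^sup>2)) \<partial>\<nu>)"
    unfolding energy_def
  proof (rule nn_integral_cong_AE, rule AE_mp[OF lim], rule AE_I2, rule impI)
    fix x assume "x \<in> space \<nu>" and l: "(\<lambda>n. fnorm x (s n x - g x)) \<longlonglongrightarrow> 0"
    then have x: "x \<in> D" by (simp add: sets_D)
    interpret h: hermitian_form "fibre E x" "metric E x" by (rule form) (use x D_subset in blast)
    note f = section_fibre[OF s x] section_fibre[OF t x] section_fibre[OF g x]
    have "(\<lambda>n. fnorm x (t x - s n x)) \<longlonglongrightarrow> fnorm x (t x - g x)"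
      unfolding fnorm_def
    proof (rule h.tendsto_nrm)
      have "(t x - s n x) - (t x - g x) = g x - s n x" for n by simp
      then show "(\<lambda>n. h.nrm ((t x - s n x) - (t x - g x))) \<longlonglongrightarrow> 0"
        using l h.nrm_minus_commute[OF f(3) f(1)] unfolding fnorm_def by simp
    qed (use f in auto)
    then have "(\<lambda>n. ennreal ((fnorm x (t x - s n x))\<^sup>2)) \<longlonglongrightarrow> ennreal ((fnorm x (t x - g x))\<^sup>2)"
      by (intro tendsto_ennrealI tendsto_power)
    from lim_imp_Liminf[OF _ this]
    show "ennreal ((fnorm x (t x - g x))\<^sup>2) = liminf (\<lambda>n. ennreal ((fnorm x (t x - s n x))\<^sup>2))" by simp
  qed
  also have "\<dots> \<le> liminf (\<lambda>n. energy (\<lambda>x. t x - s n x))"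
    unfolding energy_def
    by (rule nn_integral_liminf)
       (intro measurable_compose[OF fnorm_sq_measurable measurable_ennreal] measurable_section_diff t s)
  also have "\<dots> \<le> limsup (\<lambda>n. energy (\<lambda>x. t x - s n x))" by (rule Liminf_le_Limsup) simp
  also have "\<dots> \<le> c" using bound by (rule Limsup_bounded)
  finally show ?thesis .
qed

text \<open>The theorem of Riesz and Fischer for sections. A subsequence with rapidly decreasing increments
  converges almost everywhere, and Fatou's lemma turns the Cauchy condition for the original
  sequence into convergence in norm to the same limit.\<close>

theorem L2_complete: "hermitian_form.complete (Collect (L2_section \<mu> D E)) (L2_inner \<mu> D E)"
proof -
  let ?L = "Collect (L2_section \<mu> D E)"
  interpret L: hermitian_form ?L "L2_inner \<mu> D E" by (rule L2_hermitian)
  show ?thesis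
    unfolding L.complete_def
  proof (intro allI impI)
    fix s :: "nat \<Rightarrow> 'a \<Rightarrow> 'e" assume "range s \<subseteq> ?L" and cau: "L.cauchy s"
    then have s: "L2_section \<mu> D E (s n)" for n by auto
    then have m: "measurable_section (s n)" for n using L2_section_iff by blast
    have Ld: "L2_section \<mu> D E (\<lambda>x. s i x - s j x)" for i j
      using L2_section_add[OF s[of i] L2_section_scale[OF s[of j], of "-1"]] by simp
    have "\<forall>n. \<exists>M. \<forall>i\<ge>M. \<forall>j\<ge>M. L.nrm (s i - s j) < (1/2) ^ n"
      using cau unfolding L.cauchy_def by (metis half_gt_zero_iff zero_less_one zero_less_power)
    then obtain M where M: "\<And>n i j. i \<ge> M n \<Longrightarrow> j \<ge> M n \<Longrightarrow> L.nrm (s i - s j) < (1/2) ^ n" by metis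
    \<comment> \<open>summing makes \<open>r\<close> increasing and at least \<open>M\<close>; the summand \<open>n\<close> makes it unbounded\<close>
    define r where "r n = (\<Sum>k\<le>n. M k) + n" for n
    have r: "M n \<le> r n" "r n \<le> r (Suc n)" "n \<le> r n" for n
      using member_le_sum[of n "{..n}" M] by (auto simp: r_def)
    obtain g where g: "measurable_section g"
      and lim: "AE x in \<nu>. (\<lambda>n. fnorm x (s (r n) x - g x)) \<longlonglongrightarrow> 0"
    proof -
      have "L2_norm \<mu> D E (\<lambda>x. s (r (Suc n)) x - s (r n) x) \<le> (1/2) ^ n" for n
        using M[of n "r (Suc n)" "r n"] r(1,2)[of n] by (simp add: L2_norm_nrm fun_diff_def less_imp_le)
      from rapidly_cauchy_limit[of "\<lambda>n. s (r n)", OF s this] that show thesis by blast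
    qed
    have en: "energy (\<lambda>x. s j x - g x) \<le> ennreal (e\<^sup>2)" if N: "\<And>i j. i \<ge> N \<Longrightarrow> j \<ge> N \<Longrightarrow> L.nrm (s i - s j) < e" and j: "j \<ge> N" for N j e
    proof (rule energy_liminf[OF m m g lim])
      show "\<forall>\<^sub>F n in sequentially. energy (\<lambda>x. s j x - s (r n) x) \<le> ennreal (e\<^sup>2)"
        unfolding eventually_sequentially
      proof (intro exI allI impI)
        fix n assume "N \<le> n"
        then have "L.nrm (s j - s (r n)) < e" using N[OF j] r(3)[of n] by (meson order_trans)
        moreover have "0 \<le> L.nrm (s j - s (r n))" by (intro L.nrm_nonneg L.diff_in) (use s in auto)
        ultimately have "(L2_norm \<mu> D E (\<lambda>x. s j x - s (r n) x))\<^sup>2 \<le> e\<^sup>2"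
          by (simp add: L2_norm_nrm fun_diff_def power_mono)
        then show "energy (\<lambda>x. s j x - s (r n) x) \<le> ennreal (e\<^sup>2)"
          unfolding energy_L2_norm[OF Ld] by (rule ennreal_leI)
      qed
    qed
    have gd: "measurable_section (\<lambda>x. s j x - g x)" for j by (rule measurable_section_diff[OF m g])
    have Lg: "L2_section \<mu> D E g"
    proof -
      let ?j = "M 0"
      have "energy (\<lambda>x. s ?j x - g x) \<le> ennreal (1\<^sup>2)"
        by (rule en[of "M 0"]) (use M[of 0] in auto)
      then have "L2_section \<mu> D E (\<lambda>x. s ?j x - g x)"
        unfolding L2_section_energy using gd by (auto simp: less_top[symmetric] top_unique)
      from L2_section_add[OF s[of ?j] L2_section_scale[OF this, of "-1"]] show ?thesis by simp
    qed
    have Lgd: "L2_section \<mu> D E (\<lambda>x. s j x - g x)" for j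
      using L2_section_add[OF s[of j] L2_section_scale[OF Lg, of "-1"]] by simp
    have "(\<lambda>n. L.nrm (s n - g)) \<longlonglongrightarrow> 0"
    proof (rule LIMSEQ_I)
      fix e :: real assume e: "0 < e"
      then obtain N where N: "\<And>i j. i \<ge> N \<Longrightarrow> j \<ge> N \<Longrightarrow> L.nrm (s i - s j) < e / 2"
        using cau unfolding L.cauchy_def by (metis half_gt_zero)
      have "norm (L.nrm (s j - g) - 0) < e" if "j \<ge> N" for j
      proof -
        have "ennreal ((L2_norm \<mu> D E (\<lambda>x. s j x - g x))\<^sup>2) \<le> ennreal ((e / 2)\<^sup>2)"
          using en[OF N that] unfolding energy_L2_norm[OF Lgd] .
        then have "(L.nrm (s j - g))\<^sup>2 \<le> (e / 2)\<^sup>2" by (simp add: L2_norm_nrm fun_diff_def)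
        then have "L.nrm (s j - g) \<le> e / 2" by (rule power2_le_imp_le) (use e in simp)
        moreover have "0 \<le> L.nrm (s j - g)" by (intro L.nrm_nonneg L.diff_in) (use s Lg in auto)
        ultimately show ?thesis using e by simp
      qed
      then show "\<exists>N. \<forall>n\<ge>N. norm (L.nrm (s n - g) - 0) < e" by blast
    qed
    then show "\<exists>l\<in>?L. (\<lambda>n. L.nrm (s n - l)) \<longlonglongrightarrow> 0" using Lg by blast
  qed
qed

end

section \<open>Smooth functions in several variables\<close>

text \<open>Whether a linear map is a derivative of a function at a point is decided near the point, and
  this determines the choice made by \<open>frechet_derivative\<close>, also for functions that are not
  differentiable. So iterated partial derivatives are local (\<open>foldr_partial_cong\<close>).\<close>

lemma frechet_derivative_cong_open:
  assumes "open S" "x \<in> S" "\<And>y. y \<in> S \<Longrightarrow> f y = g y"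
  shows "frechet_derivative f (at x) = frechet_derivative g (at x)"
proof -
  have "(f has_derivative f') (at x) \<longleftrightarrow> (g has_derivative f') (at x)" for f'
    using has_derivative_transform_within_open[OF _ assms(1,2)] assms(3) by metis
  then show ?thesis unfolding frechet_derivative_def by simp
qed

lemma Ck_on_cong:
  fixes f g :: "'v::euclidean_space \<Rightarrow> 'w::real_normed_vector"
  assumes "open S" "\<And>x. x \<in> S \<Longrightarrow> f x = g x" "Ck_on k S f"
  shows "Ck_on k S g"
  using assms
proof (induction k arbitrary: f g)
  case 0
  then show ?case using continuous_on_cong[of S S f g] by simp
next
  case (Suc k)
  have "g differentiable (at x)" if x: "x \<in> S" for x
  proof -
    obtain f' where "(f has_derivative f') (at x)"
      using Suc.prems(3) x by (auto simp: differentiable_def)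
    then have "(g has_derivative f') (at x)"
      by (rule has_derivative_transform_within_open[OF _ Suc.prems(1) x]) (rule Suc.prems(2))
    then show ?thesis by (auto simp: differentiable_def)
  qed
  moreover have "Ck_on k S (\<lambda>x. frechet_derivative g (at x) v)" for v
  proof (rule Suc.IH[OF Suc.prems(1)])
    show "Ck_on k S (\<lambda>x. frechet_derivative f (at x) v)" using Suc.prems(3) by simp
    fix x assume "x \<in> S"
    from frechet_derivative_cong_open[OF Suc.prems(1) this Suc.prems(2)]
    show "frechet_derivative f (at x) v = frechet_derivative g (at x) v" by simp
  qed
  ultimately show ?case by simp
qed

lemma Ck_on_subset: "Ck_on k S f \<Longrightarrow> T \<subseteq> S \<Longrightarrow> Ck_on k T f"
  by (induction k arbitrary: f) (auto intro: continuous_on_subset)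

lemma Ck_on_locally:
  assumes "\<And>x. x \<in> S \<Longrightarrow> \<exists>V. open V \<and> x \<in> V \<and> Ck_on k V f"
  shows "Ck_on k S f"
  using assms
proof (induction k arbitrary: f)
  case 0
  show ?case unfolding Ck_on.simps
  proof (rule continuous_on_if_locally)
    fix p assume "p \<in> S"
    then obtain V where "open V" "p \<in> V" "continuous_on V f" using 0 by auto
    then show "\<exists>W. open W \<and> p \<in> W \<and> continuous_on (S \<inter> W) f"
      by (intro exI[of _ V]) (auto intro: continuous_on_subset)
  qed
next
  case (Suc k)
  have "Ck_on k S (\<lambda>x. frechet_derivative f (at x) v)" for v
    by (rule Suc.IH) (use Suc.prems in fastforce)
  then show ?case using Suc.prems by fastforce
qed

lemma Ck_on_Suc_D: "Ck_on (Suc k) S f \<Longrightarrow> Ck_on k S f"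
proof (induction k arbitrary: f)
  case 0
  then show ?case
    by (auto intro!: continuous_at_imp_continuous_on differentiable_imp_continuous_within)
next
  case (Suc k)
  then show ?case by (metis Ck_on.simps(2))
qed

lemma Ck_on_const: "Ck_on k S (\<lambda>x. c)"
proof (induction k arbitrary: c)
  case (Suc k)
  have "frechet_derivative (\<lambda>x. c) (at x) = (\<lambda>v. 0)" for x
    by (rule frechet_derivative_at[symmetric]) (rule has_derivative_const)
  then show ?case using Suc.IH by simp
qed simp

lemma Ck_on_add:
  fixes f g :: "'v::euclidean_space \<Rightarrow> 'w::real_normed_vector"
  assumes "open S" "Ck_on k S f" "Ck_on k S g"
  shows "Ck_on k S (\<lambda>x. f x + g x)"
  using assms
proof (induction k arbitrary: f g)
  case 0
  then show ?case by (auto intro: continuous_on_add)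
next
  case (Suc k)
  have D: "((\<lambda>x. f x + g x) has_derivative
      (\<lambda>v. frechet_derivative f (at x) v + frechet_derivative g (at x) v)) (at x)" if "x \<in> S" for x
    using Suc.prems that by (intro has_derivative_add) (auto simp: frechet_derivative_works)
  have "Ck_on k S (\<lambda>x. frechet_derivative (\<lambda>x. f x + g x) (at x) v)" for v
  proof (rule Ck_on_cong[OF Suc.prems(1)])
    show "Ck_on k S (\<lambda>x. frechet_derivative f (at x) v + frechet_derivative g (at x) v)"
      by (rule Suc.IH[OF Suc.prems(1)]) (use Suc.prems in auto)
    fix x assume "x \<in> S"
    from frechet_derivative_at[OF D[OF this]]
    show "frechet_derivative f (at x) v + frechet_derivative g (at x) v
        = frechet_derivative (\<lambda>x. f x + g x) (at x) v" by metis
  qed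
  then show ?case using D by (auto simp: differentiable_def)
qed

lemma Ck_on_sum:
  fixes f :: "'i \<Rightarrow> 'v::euclidean_space \<Rightarrow> 'w::real_normed_vector"
  assumes "open S" "\<And>i. i \<in> I \<Longrightarrow> Ck_on k S (f i)"
  shows "Ck_on k S (\<lambda>x. \<Sum>i\<in>I. f i x)"
proof (cases "finite I")
  case True
  then show ?thesis using assms(2)
    by (induction I rule: finite_induct) (simp_all add: Ck_on_const Ck_on_add[OF assms(1)])
qed (simp add: Ck_on_const)

lemma Ck_on_bounded_linear:
  fixes f :: "'v::euclidean_space \<Rightarrow> 'w::real_normed_vector"
  assumes T: "bounded_linear T" and "open S" "Ck_on k S f"
  shows "Ck_on k S (\<lambda>x. T (f x))"
  using assms(2,3)
proof (induction k arbitrary: f)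
  case 0
  then show ?case using bounded_linear.continuous_on[OF T] by simp
next
  case (Suc k)
  have D: "((\<lambda>x. T (f x)) has_derivative (\<lambda>v. T (frechet_derivative f (at x) v))) (at x)"
    if "x \<in> S" for x
    using Suc.prems that by (intro bounded_linear.has_derivative[OF T]) (auto simp: frechet_derivative_works)
  have "Ck_on k S (\<lambda>x. frechet_derivative (\<lambda>x. T (f x)) (at x) v)" for v
  proof (rule Ck_on_cong[OF Suc.prems(1)])
    show "Ck_on k S (\<lambda>x. T (frechet_derivative f (at x) v))"
      by (rule Suc.IH[OF Suc.prems(1)]) (use Suc.prems in auto)
    fix x assume "x \<in> S"
    from frechet_derivative_at[OF D[OF this]]
    show "T (frechet_derivative f (at x) v) = frechet_derivative (\<lambda>x. T (f x)) (at x) v" by metis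
  qed
  then show ?case using D by (auto simp: differentiable_def)
qed

lemma Ck_on_scaleR:
  fixes r :: "'v::euclidean_space \<Rightarrow> real" and f :: "'v \<Rightarrow> 'w::real_normed_vector"
  assumes "open S" "Ck_on k S r" "Ck_on k S f"
  shows "Ck_on k S (\<lambda>x. r x *\<^sub>R f x)"
  using assms
proof (induction k arbitrary: r f)
  case 0
  then show ?case by (auto intro: continuous_on_scaleR)
next
  case (Suc k)
  let ?d = "\<lambda>x v. r x *\<^sub>R frechet_derivative f (at x) v + frechet_derivative r (at x) v *\<^sub>R f x"
  have D: "((\<lambda>x. r x *\<^sub>R f x) has_derivative ?d x) (at x)" if "x \<in> S" for x
    using Suc.prems that by (intro has_derivative_scaleR) (auto simp: frechet_derivative_works)
  have "Ck_on k S (\<lambda>x. frechet_derivative (\<lambda>x. r x *\<^sub>R f x) (at x) v)" for v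
  proof (rule Ck_on_cong[OF Suc.prems(1)])
    show "Ck_on k S (\<lambda>x. ?d x v)"
      by (intro Ck_on_add[OF Suc.prems(1)] Suc.IH[OF Suc.prems(1)] Ck_on_Suc_D[OF Suc.prems(2)]
          Ck_on_Suc_D[OF Suc.prems(3)]) (use Suc.prems in auto)
    fix x assume "x \<in> S"
    from frechet_derivative_at[OF D[OF this]]
    show "?d x v = frechet_derivative (\<lambda>x. r x *\<^sub>R f x) (at x) v" by metis
  qed
  then show ?case using D by (auto simp: differentiable_def)
qed

text \<open>The chain rule writes a derivative of \<open>g \<circ> h\<close> as a sum, over a basis, of derivatives of components of
  \<open>h\<close> times derivatives of \<open>g\<close> composed with \<open>h\<close>, to which the induction hypothesis applies.\<close>

lemma Ck_on_compose:
  fixes g :: "'b::euclidean_space \<Rightarrow> 'w::real_normed_vector" and h :: "'v::euclidean_space \<Rightarrow> 'b"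
  assumes "open S" "open T" "Ck_on k T g" "Ck_on k S h" "h ` S \<subseteq> T"
  shows "Ck_on k S (\<lambda>x. g (h x))"
  using assms
proof (induction k arbitrary: g)
  case 0
  then show ?case using continuous_on_compose2[of T g S h] by simp
next
  case (Suc k)
  have hd: "(h has_derivative frechet_derivative h (at x)) (at x)" if "x \<in> S" for x
    using Suc.prems(4) that by (auto simp: frechet_derivative_works)
  have gd: "(g has_derivative frechet_derivative g (at (h x))) (at (h x))" if "x \<in> S" for x
    using Suc.prems(3,5) that by (auto simp: frechet_derivative_works)
  have D: "((\<lambda>x. g (h x)) has_derivative (\<lambda>v. frechet_derivative g (at (h x)) (frechet_derivative h (at x) v))) (at x)"
    if "x \<in> S" for x
    using has_derivative_compose[OF hd[OF that] gd[OF that]] .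
  let ?d = "\<lambda>x v. \<Sum>b\<in>Basis. (frechet_derivative h (at x) v \<bullet> b) *\<^sub>R frechet_derivative g (at (h x)) b"
  have eq: "frechet_derivative (\<lambda>x. g (h x)) (at x) v = ?d x v" if "x \<in> S" for x v
  proof -
    have lin: "linear (frechet_derivative g (at (h x)))"
      using gd[OF that] has_derivative_linear by blast
    have "frechet_derivative (\<lambda>x. g (h x)) (at x) v
        = frechet_derivative g (at (h x)) (frechet_derivative h (at x) v)"
      using frechet_derivative_at[OF D[OF that]] by metis
    also have "\<dots> = frechet_derivative g (at (h x))
        (\<Sum>b\<in>Basis. (frechet_derivative h (at x) v \<bullet> b) *\<^sub>R b)"
      by (simp only: euclidean_representation)
    also have "\<dots> = ?d x v" by (simp only: linear_sum[OF lin] linear_scale[OF lin])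
    finally show ?thesis .
  qed
  have "Ck_on k S (\<lambda>x. frechet_derivative (\<lambda>x. g (h x)) (at x) v)" for v
  proof (rule Ck_on_cong[OF Suc.prems(1)])
    show "Ck_on k S (\<lambda>x. ?d x v)"
    proof (intro Ck_on_sum[OF Suc.prems(1)] Ck_on_scaleR[OF Suc.prems(1)])
      fix b :: 'b
      show "Ck_on k S (\<lambda>x. frechet_derivative h (at x) v \<bullet> b)"
        by (rule Ck_on_bounded_linear[OF bounded_linear_inner_left Suc.prems(1)])
           (use Suc.prems(4) in simp)
      show "Ck_on k S (\<lambda>x. frechet_derivative g (at (h x)) b)"
        by (rule Suc.IH[OF Suc.prems(1,2) _ Ck_on_Suc_D[OF Suc.prems(4)] Suc.prems(5)])
           (use Suc.prems(3) in simp)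
    qed
  qed (simp add: eq)
  then show ?case using D by (auto simp: differentiable_def)
qed

lemma Cinf_on_derivative: "Cinf_on S f \<Longrightarrow> Cinf_on S (\<lambda>x. frechet_derivative f (at x) v)"
  unfolding Cinf_on_def by (metis Ck_on.simps(2))

lemma Cinf_on_continuous: "Cinf_on S f \<Longrightarrow> continuous_on S f"
  unfolding Cinf_on_def by (metis Ck_on.simps(1))

lemma Cinf_on_differentiable: "Cinf_on S f \<Longrightarrow> x \<in> S \<Longrightarrow> f differentiable (at x)"
  unfolding Cinf_on_def by (metis Ck_on.simps(2))

lemma foldr_partial_cong:
  assumes "open V" "\<And>y. y \<in> V \<Longrightarrow> f y = g y" "y \<in> V"
  shows "foldr partial L f y = foldr partial L g y"
  using assms(3)
proof (induction L arbitrary: y)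
  case Nil
  then show ?case using assms(2) by simp
next
  case (Cons i L)
  from frechet_derivative_cong_open[OF assms(1) Cons.prems Cons.IH]
  show ?case by (simp add: partial_def)
qed

lemma Cinf_on_foldr_partial: "Cinf_on V f \<Longrightarrow> Cinf_on V (foldr partial L f)"
proof (induction L)
  case (Cons i L)
  then have "Cinf_on V (\<lambda>y. frechet_derivative (foldr partial L f) (at y) (axis i 1))"
    by (intro Cinf_on_derivative) simp
  then show ?case by (simp add: partial_def[abs_def])
qed simp

lemma foldr_partial_add:
  assumes V: "open V" and f: "Cinf_on V f" and g: "Cinf_on V g" and y: "y \<in> V"
  shows "foldr partial L (\<lambda>y. f y + g y) y = foldr partial L f y + foldr partial L g y"
  using y
proof (induction L arbitrary: y)
  case (Cons i L)
  have "frechet_derivative (foldr partial L (\<lambda>y. f y + g y)) (at y) =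
      frechet_derivative (\<lambda>y. foldr partial L f y + foldr partial L g y) (at y)"
    by (rule frechet_derivative_cong_open[OF V Cons.prems Cons.IH])
  also have "\<dots> = (\<lambda>v. frechet_derivative (foldr partial L f) (at y) v +
      frechet_derivative (foldr partial L g) (at y) v)"
    by (rule frechet_derivative_at[symmetric], intro has_derivative_add)
      (use Cinf_on_differentiable[OF Cinf_on_foldr_partial[OF f] Cons.prems]
         Cinf_on_differentiable[OF Cinf_on_foldr_partial[OF g] Cons.prems]
       in \<open>simp_all add: frechet_derivative_works\<close>)
  finally show ?case by (simp add: partial_def[of i])
qed simp

lemma foldr_partial_mult:
  assumes V: "open V" and f: "Cinf_on V f" and y: "y \<in> V"
  shows "foldr partial L (\<lambda>y. a * f y) y = a * foldr partial L f y"
  using y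
proof (induction L arbitrary: y)
  case (Cons i L)
  have "frechet_derivative (foldr partial L (\<lambda>y. a * f y)) (at y) =
      frechet_derivative (\<lambda>y. a * foldr partial L f y) (at y)"
    by (rule frechet_derivative_cong_open[OF V Cons.prems Cons.IH])
  also have "\<dots> = (\<lambda>v. a * frechet_derivative (foldr partial L f) (at y) v)"
    by (rule frechet_derivative_at[symmetric], intro has_derivative_mult_right)
      (use Cinf_on_differentiable[OF Cinf_on_foldr_partial[OF f] Cons.prems]
       in \<open>simp_all add: frechet_derivative_works\<close>)
  finally show ?case by (simp add: partial_def[of i])
qed simp

lemma chart_image_open:
  assumes C: "smooth_structure C" "c \<in> C" and T: "open T"
  shows "open (chart_map c ` (T \<inter> chart_dom c))"
proof -
  have "chart_map c ` (T \<inter> chart_dom c) = chart_inv c -` T \<inter> chart_map c ` chart_dom c"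
    using chart_continuous(5,6,7)[OF C] by force
  also have "open \<dots>"
    using chart_continuous(3,4)[OF C] T continuous_on_open_vimage by blast
  finally show ?thesis .
qed

text \<open>The definition of \<open>smooth_on\<close> allows a different chart for every function and point, whereas sums
  and local expressions of operators need one chart for all functions involved. On open sets every chart
  will do, as transition maps are smooth.\<close>

lemma smooth_on_open_iff:
  fixes f :: "'a::t2_space \<Rightarrow> 'w::real_normed_vector"
  assumes C: "smooth_structure (C :: ('a, 'n::finite) chart set)" and S: "open S"
  shows "smooth_on C S f \<longleftrightarrow> (\<forall>c\<in>C. Cinf_on (chart_map c ` (S \<inter> chart_dom c)) (\<lambda>y. f (chart_inv c y)))"
proof
  assume f: "smooth_on C S f"
  show "\<forall>c\<in>C. Cinf_on (chart_map c ` (S \<inter> chart_dom c)) (\<lambda>y. f (chart_inv c y))"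
    unfolding Cinf_on_def
  proof (intro ballI allI Ck_on_locally)
    fix c k y assume c: "c \<in> C" and "y \<in> chart_map c ` (S \<inter> chart_dom c)"
    then obtain p where p: "p \<in> S" "p \<in> chart_dom c" "y = chart_map c p" by blast
    obtain d V g where d: "d \<in> C" "p \<in> chart_dom d" and V: "open V" "chart_map d p \<in> V"
      and g: "Cinf_on V g" and eq: "\<And>x. x \<in> S \<inter> chart_dom d \<Longrightarrow> chart_map d x \<in> V \<Longrightarrow> f x = g (chart_map d x)"
      using f p(1) unfolding smooth_on_def by metis
    \<comment> \<open>around \<open>p\<close>, the function is \<open>g\<close> after the transition map from \<open>c\<close> to \<open>d\<close>\<close>
    let ?T = "S \<inter> chart_dom d \<inter> chart_map d -` V"
    have "open (chart_dom d \<inter> chart_map d -` V)"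
      using chart_continuous(1,2)[OF C d(1)] V(1) by (metis Int_commute continuous_on_open_vimage)
    then have T: "open ?T" using S by (simp add: open_Int Int_assoc)
    let ?W = "chart_map c ` (?T \<inter> chart_dom c)"
    have W: "open ?W" by (rule chart_image_open[OF C c T])
    have comp: "Cinf_on (chart_map c ` (chart_dom c \<inter> chart_dom d)) (chart_map d \<circ> chart_inv c)"
      using C c d(1) unfolding smooth_structure_def compatible_def by blast
    have h: "Ck_on k ?W (chart_map d \<circ> chart_inv c)"
    proof (rule Ck_on_subset)
      show "Ck_on k (chart_map c ` (chart_dom c \<inter> chart_dom d)) (chart_map d \<circ> chart_inv c)"
        using comp unfolding Cinf_on_def by (rule spec)
    qed blast
    have inv: "chart_inv c (chart_map c x) = x" if "x \<in> ?T \<inter> chart_dom c" for x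
      using chart_continuous(5)[OF C c] that by blast
    then have sub: "(chart_map d \<circ> chart_inv c) ` ?W \<subseteq> V" by auto
    have gk: "Ck_on k V g" using g unfolding Cinf_on_def by (rule spec)
    have "Ck_on k ?W (\<lambda>y. f (chart_inv c y))"
    proof (rule Ck_on_cong[OF W _ Ck_on_compose[OF W V(1) gk h sub]])
      fix z assume "z \<in> ?W"
      then obtain x where x: "x \<in> ?T \<inter> chart_dom c" "z = chart_map c x" by blast
      then show "g ((chart_map d \<circ> chart_inv c) z) = f (chart_inv c z)"
        using inv[OF x(1)] eq[of x] by simp
    qed
    moreover have "y \<in> ?W" using p d V by auto
    ultimately show "\<exists>V. open V \<and> y \<in> V \<and> Ck_on k V (\<lambda>y. f (chart_inv c y))" using W by blast
  qed
next
  assume f: "\<forall>c\<in>C. Cinf_on (chart_map c ` (S \<inter> chart_dom c)) (\<lambda>y. f (chart_inv c y))"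
  show "smooth_on C S f"
    unfolding smooth_on_def
  proof
    fix p assume p: "p \<in> S"
    obtain c where c: "c \<in> C" "p \<in> chart_dom c" using C unfolding smooth_structure_def by blast
    show "\<exists>c\<in>C. p \<in> chart_dom c \<and> (\<exists>V g. open V \<and> chart_map c p \<in> V \<and> V \<subseteq> chart_map c ` chart_dom c \<and>
        Cinf_on V g \<and> (\<forall>x\<in>S \<inter> chart_dom c. chart_map c x \<in> V \<longrightarrow> f x = g (chart_map c x)))"
    proof (intro bexI[OF _ c(1)] conjI c(2) exI)
      show "open (chart_map c ` (S \<inter> chart_dom c))" by (rule chart_image_open[OF C c(1) S])
      show "Cinf_on (chart_map c ` (S \<inter> chart_dom c)) (\<lambda>y. f (chart_inv c y))" using f c(1) by blast
      show "\<forall>x\<in>S \<inter> chart_dom c. chart_map c x \<in> chart_map c ` (S \<inter> chart_dom c) \<longrightarrow>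
          f x = f (chart_inv c (chart_map c x))"
        using chart_continuous(5)[OF C c(1)] by simp
    qed (use p c in auto)
  qed
qed

lemma smooth_on_cong:
  assumes "\<And>x. x \<in> S \<Longrightarrow> f x = g x" "smooth_on C S f"
  shows "smooth_on C S g"
  unfolding smooth_on_def
proof
  fix p assume "p \<in> S"
  then obtain c V h where "c \<in> C" "p \<in> chart_dom c" "open V" "chart_map c p \<in> V"
      "V \<subseteq> chart_map c ` chart_dom c" "Cinf_on V h"
      "\<forall>x\<in>S \<inter> chart_dom c. chart_map c x \<in> V \<longrightarrow> f x = h (chart_map c x)"
    using assms(2) unfolding smooth_on_def by metis
  then show "\<exists>c\<in>C. p \<in> chart_dom c \<and> (\<exists>V h. open V \<and> chart_map c p \<in> V \<and> V \<subseteq> chart_map c ` chart_dom c \<and>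
      Cinf_on V h \<and> (\<forall>x\<in>S \<inter> chart_dom c. chart_map c x \<in> V \<longrightarrow> g x = h (chart_map c x)))"
    using assms(1) by (intro bexI[of _ c] conjI exI[of _ V] exI[of _ h]) auto
qed

lemma smooth_on_add:
  fixes f g :: "'a::t2_space \<Rightarrow> 'w::real_normed_vector"
  assumes C: "smooth_structure (C :: ('a, 'n::finite) chart set)" and S: "open S"
    and "smooth_on C S f" "smooth_on C S g"
  shows "smooth_on C S (\<lambda>x. f x + g x)"
  using assms(3,4) Ck_on_add[OF chart_image_open[OF C _ S]]
  unfolding smooth_on_open_iff[OF C S] Cinf_on_def by blast

lemma smooth_on_mult_const:
  fixes f :: "'a::t2_space \<Rightarrow> complex"
  assumes C: "smooth_structure (C :: ('a, 'n::finite) chart set)" and S: "open S"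
    and "smooth_on C S f"
  shows "smooth_on C S (\<lambda>x. a * f x)"
  using assms(3) Ck_on_bounded_linear[OF bounded_linear_mult_right[of a] chart_image_open[OF C _ S]]
  unfolding smooth_on_open_iff[OF C S] Cinf_on_def by blast

lemma smooth_on_subset:
  assumes "smooth_on C S f" "T \<subseteq> S"
  shows "smooth_on C T f"
  unfolding smooth_on_def
proof
  fix p assume "p \<in> T"
  then obtain c V h where "c \<in> C" "p \<in> chart_dom c" "open V" "chart_map c p \<in> V"
      "V \<subseteq> chart_map c ` chart_dom c" "Cinf_on V h"
      "\<forall>x\<in>S \<inter> chart_dom c. chart_map c x \<in> V \<longrightarrow> f x = h (chart_map c x)"
    using assms unfolding smooth_on_def by blast
  then show "\<exists>c\<in>C. p \<in> chart_dom c \<and> (\<exists>V h. open V \<and> chart_map c p \<in> V \<and> V \<subseteq> chart_map c ` chart_dom c \<and>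
      Cinf_on V h \<and> (\<forall>x\<in>T \<inter> chart_dom c. chart_map c x \<in> V \<longrightarrow> f x = h (chart_map c x)))"
    using assms(2) by (intro bexI[of _ c] conjI exI[of _ V] exI[of _ h]) auto
qed

section \<open>Differential operators\<close>

lemma smooth_section_subset:
  assumes "smooth_section C E W u" "W' \<subseteq> W"
  shows "smooth_section C E W' u"
  unfolding smooth_section_def
proof (intro conjI ballI)
  fix x assume "x \<in> W'"
  then show "u x \<in> fibre E x" using assms unfolding smooth_section_def by blast
next
  fix p assume p: "p \<in> frames E"
  obtain U e where pe: "p = (U, e)" by fastforce
  have "smooth_on C (W \<inter> U) (\<lambda>x. coord E e x (u x) i)" if "i < rank E" for i
    using assms(1) p that unfolding smooth_section_def pe by blast
  then show "case p of (U, e) \<Rightarrow> \<forall>i<rank E. smooth_on C (W' \<inter> U) (\<lambda>x. coord E e x (u x) i)"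
    unfolding pe prod.case using assms(2) smooth_on_subset[of C "W \<inter> U" _ "W' \<inter> U"] by blast
qed

context bundle_over_manifold
begin

lemma smooth_sectionD:
  assumes "smooth_section C E W u"
  shows "x \<in> W \<Longrightarrow> u x \<in> fibre E x"
    and "(U, e) \<in> frames E \<Longrightarrow> i < rank E \<Longrightarrow> smooth_on C (W \<inter> U) (\<lambda>x. coord E e x (u x) i)"
  using assms unfolding smooth_section_def by blast+

lemma smooth_section_add:
  assumes W: "open W" "W \<subseteq> X" and u: "smooth_section C E W u" and v: "smooth_section C E W v"
  shows "smooth_section C E W (\<lambda>x. u x + v x)"
  unfolding smooth_section_def
proof (intro conjI ballI)
  fix x assume "x \<in> W"
  then show "u x + v x \<in> fibre E x"
    using smooth_sectionD(1)[OF u] smooth_sectionD(1)[OF v] W(2)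
    by (intro complex_vector.subspace_add[OF fibre_subspace]) auto
next
  fix p assume p: "p \<in> frames E"
  obtain U e where pe: "p = (U, e)" by fastforce
  then have e: "(U, e) \<in> frames E" using p by simp
  have "smooth_on C (W \<inter> U) (\<lambda>x. coord E e x (u x + v x) i)" if i: "i < rank E" for i
  proof (rule smooth_on_cong)
    show "smooth_on C (W \<inter> U) (\<lambda>x. coord E e x (u x) i + coord E e x (v x) i)"
      by (rule smooth_on_add[OF smooth open_Int_frame[OF e W] smooth_sectionD(2)[OF u e i]
            smooth_sectionD(2)[OF v e i]])
    fix x assume "x \<in> W \<inter> U"
    then show "coord E e x (u x) i + coord E e x (v x) i = coord E e x (u x + v x) i"
      using smooth_sectionD(1)[OF u] smooth_sectionD(1)[OF v] by (intro coord_add[OF e, symmetric]) auto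
  qed
  then show "case p of (U, e) \<Rightarrow> \<forall>i<rank E. smooth_on C (W \<inter> U) (\<lambda>x. coord E e x (u x + v x) i)"
    unfolding pe prod.case by blast
qed

lemma smooth_section_scale:
  assumes W: "open W" "W \<subseteq> X" and u: "smooth_section C E W u"
  shows "smooth_section C E W (\<lambda>x. a *\<^sub>C u x)"
  unfolding smooth_section_def
proof (intro conjI ballI)
  fix x assume "x \<in> W"
  then show "a *\<^sub>C u x \<in> fibre E x"
    using smooth_sectionD(1)[OF u] W(2) by (intro complex_vector.subspace_scale[OF fibre_subspace]) auto
next
  fix p assume p: "p \<in> frames E"
  obtain U e where pe: "p = (U, e)" by fastforce
  then have e: "(U, e) \<in> frames E" using p by simp
  have "smooth_on C (W \<inter> U) (\<lambda>x. coord E e x (a *\<^sub>C u x) i)" if i: "i < rank E" for i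
  proof (rule smooth_on_cong)
    show "smooth_on C (W \<inter> U) (\<lambda>x. a * coord E e x (u x) i)"
      by (rule smooth_on_mult_const[OF smooth open_Int_frame[OF e W] smooth_sectionD(2)[OF u e i]])
    fix x assume "x \<in> W \<inter> U"
    then show "a * coord E e x (u x) i = coord E e x (a *\<^sub>C u x) i"
      using smooth_sectionD(1)[OF u] by (intro coord_scale[OF e, symmetric]) auto
  qed
  then show "case p of (U, e) \<Rightarrow> \<forall>i<rank E. smooth_on C (W \<inter> U) (\<lambda>x. coord E e x (a *\<^sub>C u x) i)"
    unfolding pe prod.case by blast
qed

lemma smooth_section_zero:
  assumes "W \<subseteq> X" "open W"
  shows "smooth_section C E W (\<lambda>x. 0)"
  unfolding smooth_section_def
proof (intro conjI ballI)
  fix x assume "x \<in> W"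
  then show "0 \<in> fibre E x" using assms by (intro complex_vector.subspace_0[OF fibre_subspace]) auto
next
  fix p assume p: "p \<in> frames E"
  obtain U e where pe: "p = (U, e)" by fastforce
  then have e: "(U, e) \<in> frames E" using p by simp
  have "smooth_on C (W \<inter> U) (\<lambda>x. 0 :: complex)"
    unfolding smooth_on_open_iff[OF smooth open_Int_frame[OF e assms(2,1)]] Cinf_on_def
    by (simp add: Ck_on_const)
  then show "case p of (U, e) \<Rightarrow> \<forall>i<rank E. smooth_on C (W \<inter> U) (\<lambda>x. coord E e x 0 i)"
    unfolding pe prod.case by simp
qed

lemma coord_in_chart_smooth:
  assumes W: "open W" "W \<subseteq> X" and u: "smooth_section C E W u"
    and e: "(U, e) \<in> frames E" and c: "c \<in> C" and j: "j < rank E"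
  shows "Cinf_on (chart_map c ` (W \<inter> U \<inter> chart_dom c)) (\<lambda>y. coord E e (chart_inv c y) (u (chart_inv c y)) j)"
  using smooth_sectionD(2)[OF u e j] c
  unfolding smooth_on_open_iff[OF smooth open_Int_frame[OF e W]] by blast

end

locale diff_operator =
  E: bundle_over_manifold C X E + F: bundle_over_manifold C S F
  for C :: "('a::{second_countable_topology,t2_space}, 'n::finite) chart set" and X :: "'a set"
    and E :: "('a, 'e::complex_vector, 'y) vbundle_scheme" and S :: "'a set"
    and F :: "('a, 'f::complex_vector, 'z) vbundle_scheme" +
  fixes k :: nat and P :: "('a \<Rightarrow> 'e) \<Rightarrow> 'a \<Rightarrow> 'f"
  assumes S_subset: "S \<subseteq> X" and operator: "diff_op C S E F k P"
begin

lemma op_fibre: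
  assumes "open W" "W \<subseteq> S" "smooth_section C E W u" "x \<in> W"
  shows "P u x \<in> fibre F x"
  using operator assms unfolding diff_op_def by blast

text \<open>The coefficients of an operator in a chart and frames, retaining only their continuity.\<close>

definition local_expression :: "('a, 'n) chart \<Rightarrow> 'a set \<Rightarrow> (nat \<Rightarrow> 'a \<Rightarrow> 'e) \<Rightarrow>
    'a set \<Rightarrow> (nat \<Rightarrow> 'a \<Rightarrow> 'f) \<Rightarrow> (('n \<Rightarrow> nat) \<Rightarrow> nat \<Rightarrow> nat \<Rightarrow> 'a \<Rightarrow> complex) \<Rightarrow> bool" where
  "local_expression c U e U' f a \<longleftrightarrow>
     (\<forall>\<alpha> i j. continuous_on (S \<inter> chart_dom c \<inter> U \<inter> U') (a \<alpha> i j)) \<and>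
     (\<forall>u W. open W \<and> W \<subseteq> S \<and> smooth_section C E W u \<longrightarrow>
        (\<forall>x \<in> W \<inter> chart_dom c \<inter> U \<inter> U'. \<forall>i<rank F.
           coord F f x (P u x) i = (\<Sum>\<alpha> | sum \<alpha> UNIV \<le> k. \<Sum>j<rank E. a \<alpha> i j x *
             multi_partial \<alpha> (\<lambda>y. coord E e (chart_inv c y) (u (chart_inv c y)) j) (chart_map c x))))"

lemma local_expression_exists:
  assumes c: "c \<in> C" and e: "(U, e) \<in> frames E" and f: "(U', f) \<in> frames F"
  shows "\<exists>a. local_expression c U e U' f a"
proof -
  have "\<forall>c\<in>C. \<forall>e\<in>frames E. \<forall>f\<in>frames F. \<exists>a. local_coefficients C S E F k P c e f a"
    using operator unfolding diff_op_def by (rule conjunct2)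
  then obtain a where a: "local_coefficients C S E F k P c (U, e) (U', f) a" using c e f by blast
  note a = a[unfolded local_coefficients_def fst_conv snd_conv]
  have "\<forall>\<alpha> i j. continuous_on (S \<inter> chart_dom c \<inter> U \<inter> U') (a \<alpha> i j)"
    using conjunct1[OF a] smooth_on_imp_continuous_on[OF E.smooth] by blast
  then have "local_expression c U e U' f a"
    unfolding local_expression_def by (rule conjI[OF _ conjunct2[OF a]])
  then show ?thesis by (intro exI)
qed

lemma local_expressionD:
  assumes "local_expression c U e U' f a"
  shows "continuous_on (S \<inter> chart_dom c \<inter> U \<inter> U') (a \<alpha> i j)"
    and "open W \<Longrightarrow> W \<subseteq> S \<Longrightarrow> smooth_section C E W u \<Longrightarrow>
      x \<in> W \<inter> chart_dom c \<inter> U \<inter> U' \<Longrightarrow> i < rank F \<Longrightarrow>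
      coord F f x (P u x) i = (\<Sum>\<alpha> | sum \<alpha> UNIV \<le> k. \<Sum>j<rank E. a \<alpha> i j x *
        multi_partial \<alpha> (\<lambda>y. coord E e (chart_inv c y) (u (chart_inv c y)) j) (chart_map c x))"
  using assms unfolding local_expression_def by simp_all

text \<open>Locally, the coordinates of \<open>P u\<close> are sums of continuous coefficients times partial derivatives of
  smooth functions.\<close>

lemma op_coord_continuous:
  assumes W: "open W" "W \<subseteq> S" and u: "smooth_section C E W u"
    and f: "(U', f) \<in> frames F" and i: "i < rank F"
  shows "continuous_on (W \<inter> U') (\<lambda>x. coord F f x (P u x) i)"
proof (rule continuous_on_if_locally)
  fix p assume p: "p \<in> W \<inter> U'"
  have WX: "W \<subseteq> X" using W S_subset by blast
  obtain c where c: "c \<in> C" "p \<in> chart_dom c" using E.smooth unfolding smooth_structure_def by blast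
  obtain U e where e: "(U, e) \<in> frames E" "p \<in> U" using E.frame_cover p WX by blast
  note chart = chart_continuous[OF E.smooth c(1)]
  obtain a where "local_expression c U e U' f a"
    using local_expression_exists[OF c(1) e(1) f] by blast
  note a = local_expressionD(1)[OF this] and formula = local_expressionD(2)[OF this]
  let ?T = "W \<inter> U \<inter> chart_dom c" and ?\<phi> = "\<lambda>j y. coord E e (chart_inv c y) (u (chart_inv c y)) j"
  have T: "open ?T" using E.open_Int_frame[OF e(1) W(1) WX] chart(1) by (rule open_Int)
  have mp: "continuous_on (W \<inter> U' \<inter> ?T) (\<lambda>x. multi_partial \<alpha> (?\<phi> j) (chart_map c x))"
    if "j < rank E" for \<alpha> j
  proof -
    have "continuous_on (chart_map c ` ?T) (multi_partial \<alpha> (?\<phi> j))"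
      unfolding multi_partial_def
      by (intro Cinf_on_continuous Cinf_on_foldr_partial E.coord_in_chart_smooth[OF W(1) WX u e(1) c(1) that])
    moreover have "continuous_on (W \<inter> U' \<inter> ?T) (chart_map c)"
      using chart(2) by (rule continuous_on_subset) blast
    ultimately show ?thesis by (rule continuous_on_compose2) blast
  qed
  have ac: "continuous_on (W \<inter> U' \<inter> ?T) (a \<alpha> i j)" for \<alpha> j
    using a by (rule continuous_on_subset) (use W(2) in blast)
  have "continuous_on (W \<inter> U' \<inter> ?T) (\<lambda>x. \<Sum>\<alpha> | sum \<alpha> UNIV \<le> k. \<Sum>j<rank E.
      a \<alpha> i j x * multi_partial \<alpha> (?\<phi> j) (chart_map c x))"
    by (intro continuous_on_sum continuous_on_mult ac mp) simp
  then have "continuous_on (W \<inter> U' \<inter> ?T) (\<lambda>x. coord F f x (P u x) i)"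
    by (rule continuous_on_eq) (rule formula[OF W u _ i, symmetric], blast)
  then show "\<exists>V. open V \<and> p \<in> V \<and> continuous_on (W \<inter> U' \<inter> V) (\<lambda>x. coord F f x (P u x) i)"
    using T p c e by blast
qed

text \<open>Linearity is only available at points around which both arguments are smooth sections.
  There it is inherited from the partial derivatives.\<close>

lemma op_linear:
  assumes W: "open W" "W \<subseteq> S" and u: "smooth_section C E W u" and v: "smooth_section C E W v"
    and x: "x \<in> W"
  shows "P (\<lambda>x. u x + b *\<^sub>C v x) x = P u x + b *\<^sub>C P v x"
proof -
  have WX: "W \<subseteq> X" using W S_subset by blast
  obtain c where c: "c \<in> C" "x \<in> chart_dom c" using E.smooth unfolding smooth_structure_def by blast
  obtain U e where e: "(U, e) \<in> frames E" "x \<in> U" using E.frame_cover x WX by blast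
  obtain U' f where f: "(U', f) \<in> frames F" "x \<in> U'" using F.frame_cover x W(2) by blast
  note chart = chart_continuous[OF E.smooth c(1)]
  obtain a where "local_expression c U e U' f a"
    using local_expression_exists[OF c(1) e(1) f(1)] by blast
  note formula = local_expressionD(2)[OF this]
  let ?V = "chart_map c ` (W \<inter> U \<inter> chart_dom c)"
  let ?\<phi> = "\<lambda>u j y. coord E e (chart_inv c y) (u (chart_inv c y)) j"
  have V: "open ?V" by (rule chart_image_open[OF E.smooth c(1) E.open_Int_frame[OF e(1) W(1) WX]])
  have xV: "chart_map c x \<in> ?V" using x e c by blast
  have bv: "smooth_section C E W (\<lambda>x. b *\<^sub>C v x)" by (rule E.smooth_section_scale[OF W(1) WX v])
  have uv: "smooth_section C E W (\<lambda>x. u x + b *\<^sub>C v x)" by (rule E.smooth_section_add[OF W(1) WX u bv])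
  have mp: "multi_partial \<alpha> (?\<phi> (\<lambda>x. u x + b *\<^sub>C v x) j) (chart_map c x) =
      multi_partial \<alpha> (?\<phi> u j) (chart_map c x) + b * multi_partial \<alpha> (?\<phi> v j) (chart_map c x)"
    if j: "j < rank E" for \<alpha> j
  proof -
    note smooth_j = E.coord_in_chart_smooth[OF W(1) WX _ e(1) c(1) j]
    have "multi_partial \<alpha> (?\<phi> (\<lambda>x. u x + b *\<^sub>C v x) j) (chart_map c x) =
        multi_partial \<alpha> (\<lambda>y. ?\<phi> u j y + ?\<phi> (\<lambda>x. b *\<^sub>C v x) j y) (chart_map c x)"
      unfolding multi_partial_def
    proof (rule foldr_partial_cong[OF V _ xV])
      fix y assume "y \<in> ?V"
      then obtain z where z: "z \<in> W" "z \<in> U" "z \<in> chart_dom c" "y = chart_map c z" by blast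
      then have "chart_inv c y = z" using chart(5) by blast
      then show "?\<phi> (\<lambda>x. u x + b *\<^sub>C v x) j y = ?\<phi> u j y + ?\<phi> (\<lambda>x. b *\<^sub>C v x) j y"
        using E.coord_add[OF e(1) z(2) E.smooth_sectionD(1)[OF u z(1)] E.smooth_sectionD(1)[OF bv z(1)]]
        by simp
    qed
    also have "\<dots> = multi_partial \<alpha> (?\<phi> u j) (chart_map c x) +
        multi_partial \<alpha> (?\<phi> (\<lambda>x. b *\<^sub>C v x) j) (chart_map c x)"
      unfolding multi_partial_def by (rule foldr_partial_add[OF V smooth_j[OF u] smooth_j[OF bv] xV])
    also have "multi_partial \<alpha> (?\<phi> (\<lambda>x. b *\<^sub>C v x) j) (chart_map c x) =
        multi_partial \<alpha> (\<lambda>y. b * ?\<phi> v j y) (chart_map c x)"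
      unfolding multi_partial_def
    proof (rule foldr_partial_cong[OF V _ xV])
      fix y assume "y \<in> ?V"
      then obtain z where z: "z \<in> W" "z \<in> U" "z \<in> chart_dom c" "y = chart_map c z" by blast
      then have "chart_inv c y = z" using chart(5) by blast
      then show "?\<phi> (\<lambda>x. b *\<^sub>C v x) j y = b * ?\<phi> v j y"
        using E.coord_scale[OF e(1) z(2) E.smooth_sectionD(1)[OF v z(1)]] by simp
    qed
    also have "\<dots> = b * multi_partial \<alpha> (?\<phi> v j) (chart_map c x)"
      unfolding multi_partial_def by (rule foldr_partial_mult[OF V smooth_j[OF v] xV])
    finally show ?thesis .
  qed
  have Pu: "P u x \<in> fibre F x" and Pv: "P v x \<in> fibre F x"
    and Puv: "P (\<lambda>x. u x + b *\<^sub>C v x) x \<in> fibre F x"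
    using op_fibre[OF W _ x] u v uv by blast+
  have xi: "x \<in> W \<inter> chart_dom c \<inter> U \<inter> U'" using x c e f by blast
  have xS: "x \<in> S" using x W(2) by blast
  have bPv: "b *\<^sub>C P v x \<in> fibre F x"
    by (rule complex_vector.subspace_scale[OF F.fibre_subspace[OF xS] Pv])
  show ?thesis
  proof (rule F.coord_eqI[OF f Puv])
    show "P u x + b *\<^sub>C P v x \<in> fibre F x"
      by (rule complex_vector.subspace_add[OF F.fibre_subspace[OF xS] Pu bPv])
    fix i assume i: "i < rank F"
    show "coord F f x (P (\<lambda>x. u x + b *\<^sub>C v x) x) i = coord F f x (P u x + b *\<^sub>C P v x) i"
      unfolding F.coord_add[OF f Pu bPv] F.coord_scale[OF f Pv] formula[OF W u xi i] formula[OF W v xi i]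
        formula[OF W uv xi i] sum_distrib_left sum.distrib[symmetric]
      by (intro sum.cong refl) (simp add: mp distrib_left mult.left_commute)
  qed
qed

lemma op_add:
  assumes "open W" "W \<subseteq> S" "smooth_section C E W u" "smooth_section C E W v" "x \<in> W"
  shows "P (\<lambda>x. u x + v x) x = P u x + P v x"
  using op_linear[OF assms, of 1] by (simp add: scaleC_one)

lemma op_scale:
  assumes W: "open W" "W \<subseteq> S" and u: "smooth_section C E W u" and x: "x \<in> W"
  shows "P (\<lambda>x. b *\<^sub>C u x) x = b *\<^sub>C P u x"
proof -
  have 0: "smooth_section C E W (\<lambda>x. 0)"
    using W S_subset by (intro E.smooth_section_zero) auto
  have "P (\<lambda>x. 0) x = 0" using op_add[OF W 0 0 x] by simp
  then show ?thesis using op_linear[OF W 0 u x, of b] by simp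
qed

end

section \<open>Sections smooth up to the boundary are square integrable\<close>

text \<open>In a closed ball in a chart the density of the volume form is bounded by compactness, and the ball
  has finite Lebesgue measure.\<close>

lemma volume_locally_finite:
  fixes C :: "('a::{second_countable_topology,t2_space}, 'n::finite) chart set"
  assumes C: "smooth_structure C" and \<omega>: "volume_form C X \<omega>" and \<mu>: "volume_measure C X \<omega> \<mu>"
    and p: "p \<in> interior X"
  shows "\<exists>W. open W \<and> p \<in> W \<and> emeasure \<mu> W < \<infinity>"
proof -
  obtain c where c: "c \<in> C" "p \<in> chart_dom c" using C unfolding smooth_structure_def by blast
  note chart = chart_continuous[OF C c(1)]
  let ?I = "chart_map c ` (interior X \<inter> chart_dom c)"
  have "open ?I" by (rule chart_image_open[OF C c(1) open_interior])
  moreover have "chart_map c p \<in> ?I" using p c by blast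
  ultimately obtain r where r: "0 < r" "cball (chart_map c p) r \<subseteq> ?I" using open_contains_cball by blast
  let ?B = "ball (chart_map c p) r" and ?CB = "cball (chart_map c p) r"
  have inv: "chart_inv c y \<in> interior X \<inter> chart_dom c" if "y \<in> ?CB" for y
  proof -
    have "y \<in> ?I" using r(2) that by blast
    then obtain x where "x \<in> interior X \<inter> chart_dom c" "y = chart_map c x" by blast
    then show ?thesis using chart(5)[of x] by simp
  qed
  have "smooth_on C (X \<inter> chart_dom c) (\<omega> c)" using \<omega> c(1) unfolding volume_form_def by blast
  then have "continuous_on (X \<inter> chart_dom c) (\<omega> c)" by (rule smooth_on_imp_continuous_on[OF C])
  moreover have "continuous_on ?CB (chart_inv c)"
    using chart(4) by (rule continuous_on_subset) (use r(2) in blast)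
  ultimately have "continuous_on ?CB (\<lambda>y. \<omega> c (chart_inv c y))"
    by (rule continuous_on_compose2) (use inv interior_subset in blast)
  then have "bounded ((\<lambda>y. \<omega> c (chart_inv c y)) ` ?CB)"
    by (intro compact_imp_bounded compact_continuous_image compact_cball)
  then obtain K where K': "\<forall>z\<in>(\<lambda>y. \<omega> c (chart_inv c y)) ` ?CB. norm z \<le> K"
    unfolding bounded_iff by blast
  have K: "\<bar>\<omega> c (chart_inv c y)\<bar> \<le> K" if "y \<in> ?CB" for y
    using bspec[OF K' imageI[OF that]] by simp
  let ?W = "chart_dom c \<inter> chart_map c -` ?B"
  have W: "open ?W"
    using chart(1,2) open_ball by (metis Int_commute continuous_on_open_vimage)
  have sub: "?W \<subseteq> X \<inter> chart_dom c"
  proof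
    fix x assume x: "x \<in> ?W"
    then have "chart_map c x \<in> ?CB" by auto
    from inv[OF this] have "x \<in> interior X" using chart(5)[of x] x by simp
    then show "x \<in> X \<inter> chart_dom c" using x interior_subset by blast
  qed
  have "emeasure \<mu> ?W = (\<integral>\<^sup>+y. ennreal \<bar>\<omega> c (chart_inv c y)\<bar> * indicator (chart_map c ` ?W) y \<partial>lborel)"
    using \<mu> c(1) sub W unfolding volume_measure_def by (meson borel_open)
  also have "\<dots> \<le> (\<integral>\<^sup>+y. ennreal K * indicator ?CB y \<partial>lborel)"
    by (rule nn_integral_mono) (use K in \<open>auto simp: indicator_def intro!: ennreal_leI\<close>)
  also have "\<dots> = ennreal K * emeasure lborel ?CB" by (rule nn_integral_cmult_indicator) simp
  also have "\<dots> < \<infinity>" using emeasure_lborel_cball_finite[of "chart_map c p" r] by (simp add: ennreal_mult_less_top)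
  finally show ?thesis using W p c r(1) by (intro exI[of _ ?W]) auto
qed

context hermitian_bundle_on
begin

lemma metric_continuous:
  assumes W: "open W" "W \<subseteq> X" and s: "\<And>x. x \<in> W \<Longrightarrow> s x \<in> fibre E x"
    and cont: "\<And>U e i. (U, e) \<in> frames E \<Longrightarrow> i < rank E \<Longrightarrow> continuous_on (W \<inter> U) (\<lambda>x. coord E e x (s x) i)"
  shows "continuous_on W (\<lambda>x. metric E x (s x) (s x))"
proof (rule continuous_on_if_locally)
  fix p assume "p \<in> W"
  then obtain U e where e: "(U, e) \<in> frames E" "p \<in> U" using frame_cover W(2) by blast
  have fm: "continuous_on (W \<inter> U) (\<lambda>x. metric E x (e i x) (e j x))" if "i < rank E" "j < rank E" for i j
    using frame_metric_continuous[OF e(1) that] by (rule continuous_on_subset) simp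
  have "continuous_on (W \<inter> U) (\<lambda>x. \<Sum>i<rank E. \<Sum>j<rank E.
      coord E e x (s x) i * (cnj (coord E e x (s x) j) * metric E x (e i x) (e j x)))"
    by (intro continuous_on_sum continuous_on_mult continuous_on_cnj cont[OF e(1)] fm) simp_all
  then have "continuous_on (W \<inter> U) (\<lambda>x. metric E x (s x) (s x))"
    by (rule continuous_on_eq) (rule metric_expansion[OF e(1), symmetric], use s in auto)
  moreover have "W \<inter> (W \<inter> U) = W \<inter> U" by blast
  ultimately show "\<exists>V. open V \<and> p \<in> V \<and> continuous_on (W \<inter> V) (\<lambda>x. metric E x (s x) (s x))"
    using open_Int_frame[OF e(1) W] \<open>p \<in> W\<close> e(2) by (intro exI[of _ "W \<inter> U"]) auto
qed

lemma finite_measure_D: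
  assumes "compact (closure D)" "\<And>p. p \<in> closure D \<Longrightarrow> \<exists>W. open W \<and> p \<in> W \<and> emeasure \<mu> W < \<infinity>"
  shows "emeasure \<mu> D < \<infinity>"
proof -
  let ?\<W> = "{W. open W \<and> emeasure \<mu> W < \<infinity>}"
  have "closure D \<subseteq> \<Union>?\<W>" using assms(2) by blast
  then obtain \<F> where F: "\<F> \<subseteq> ?\<W>" "finite \<F>" "closure D \<subseteq> \<Union>\<F>"
    by (rule compactE[OF assms(1)]) auto
  have "open (\<Union>\<F>)" using F(1) by (intro open_Union) blast
  then have "emeasure \<mu> D \<le> emeasure \<mu> (\<Union>\<F>)"
    using F(3) closure_subset[of D] by (intro emeasure_mono) (auto simp: sets_\<mu>)
  also have "\<dots> \<le> (\<Sum>W\<in>\<F>. emeasure \<mu> W)"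
  proof -
    have "(\<lambda>W. W) ` \<F> \<subseteq> sets \<mu>" unfolding sets_\<mu> using F(1) borel_open by auto
    from emeasure_subadditive_finite[OF F(2) this] show ?thesis by simp
  qed
  also have "\<dots> < \<infinity>" using F by (auto simp: less_top[symmetric] ennreal_sum_eq_top)
  finally show ?thesis .
qed

text \<open>The squared length of the section is continuous on the compact set \<open>closure D\<close>, hence bounded, and \<open>D\<close>
  has finite measure.\<close>

lemma continuous_section_L2:
  assumes compact: "compact (closure D)"
    and fin: "\<And>p. p \<in> closure D \<Longrightarrow> \<exists>W. open W \<and> p \<in> W \<and> emeasure \<mu> W < \<infinity>"
    and W: "open W" "W \<subseteq> X" "closure D \<subseteq> W" and s: "\<And>x. x \<in> W \<Longrightarrow> s x \<in> fibre E x"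
    and cont: "\<And>U e i. (U, e) \<in> frames E \<Longrightarrow> i < rank E \<Longrightarrow> continuous_on (W \<inter> U) (\<lambda>x. coord E e x (s x) i)"
  shows "L2_section \<mu> D E s"
proof -
  have DW: "D \<subseteq> W" using W(3) closure_subset by blast
  have m: "measurable_section s"
    unfolding measurable_section_def
  proof (intro conjI ballI)
    fix x assume "x \<in> D"
    then show "s x \<in> fibre E x" using s DW by blast
  next
    fix p assume p: "p \<in> frames E"
    obtain U e where pe: "p = (U, e)" by fastforce
    then have e: "(U, e) \<in> frames E" using p by simp
    have "(\<lambda>x. coord E e x (s x) i) \<in> borel_measurable (restrict_space \<mu> (D \<inter> U))" if "i < rank E" for i
      by (rule continuous_imp_measurable_frame[OF e])
         (rule continuous_on_subset[OF cont[OF e that]], use DW in blast)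
    then show "case p of (U, e) \<Rightarrow> \<forall>i<rank E. (\<lambda>x. coord E e x (s x) i) \<in> borel_measurable (restrict_space \<mu> (D \<inter> U))"
      unfolding pe prod.case by blast
  qed
  have "continuous_on (closure D) (\<lambda>x. metric E x (s x) (s x))"
    using metric_continuous[OF W(1,2) s cont] W(3) by (rule continuous_on_subset)
  then have "bounded ((\<lambda>x. metric E x (s x) (s x)) ` closure D)"
    using compact by (intro compact_imp_bounded compact_continuous_image)
  then obtain K where K: "\<And>x. x \<in> closure D \<Longrightarrow> cmod (metric E x (s x) (s x)) \<le> K"
    unfolding bounded_iff by auto
  have "integrable \<nu> (\<lambda>x. metric E x (s x) (s x))"
  proof (rule integrableI_bounded_set[where A = "space \<nu>" and B = K])
    show "emeasure \<nu> (space \<nu>) < \<infinity>"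
      using finite_measure_D[OF compact fin] sets_D by (simp add: emeasure_restrict_space)
    show "AE x in \<nu>. x \<in> space \<nu> \<longrightarrow> norm (metric E x (s x) (s x)) \<le> K"
      using K closure_subset by (intro AE_I2) (auto simp: sets_D)
  qed (auto simp: metric_measurable[OF m m])
  then show ?thesis unfolding L2_section_iff using m by blast
qed

end

section \<open>The completion as the closure of a graph\<close>

text \<open>What the completion needs to know about \<open>A\<close> and the space \<open>V\<close> that is completed. The operator is
  linear on \<open>D\<close> only, since its values elsewhere may be arbitrary.\<close>

locale graph_completion =
  E: hermitian_bundle_on C X E D \<mu> + F: hermitian_bundle_on C X F D \<mu>
  for C :: "('a::{second_countable_topology,t2_space}, 'n::finite) chart set" and X :: "'a set"
    and E :: "('a, 'e::complex_vector) hermitian_bundle"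
    and F :: "('a, 'f::complex_vector) hermitian_bundle"
    and D :: "'a set" and \<mu> :: "'a measure" +
  fixes A :: "('a \<Rightarrow> 'e) \<Rightarrow> 'a \<Rightarrow> 'f" and V :: "('a \<Rightarrow> 'e) set"
  assumes V_subspace: "complex_vector.subspace V"
    and V_L2: "u \<in> V \<Longrightarrow> L2_section \<mu> D E u"
    and A_L2: "u \<in> V \<Longrightarrow> L2_section \<mu> D F (A u)"
    and A_add: "u \<in> V \<Longrightarrow> v \<in> V \<Longrightarrow> x \<in> D \<Longrightarrow> A (u + v) x = A u x + A v x"
    and A_scale: "u \<in> V \<Longrightarrow> x \<in> D \<Longrightarrow> A (a *\<^sub>C u) x = a *\<^sub>C A u x"
begin

sublocale LE: hermitian_form "Collect (L2_section \<mu> D E)" "L2_inner \<mu> D E"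
  by (rule E.L2_hermitian)

sublocale LF: hermitian_form "Collect (L2_section \<mu> D F)" "L2_inner \<mu> D F"
  by (rule F.L2_hermitian)

lemma LF_nrm_cong: "(\<And>x. x \<in> D \<Longrightarrow> s x = t x) \<Longrightarrow> LF.nrm s = LF.nrm t"
  unfolding LF.nrm_def using F.L2_inner_cong[of s t s t] by simp

lemma V_add: "u \<in> V \<Longrightarrow> v \<in> V \<Longrightarrow> u + v \<in> V"
  by (rule complex_vector.subspace_add[OF V_subspace])

lemma V_diff: "u \<in> V \<Longrightarrow> v \<in> V \<Longrightarrow> u - v \<in> V"
  by (rule complex_vector.subspace_diff[OF V_subspace])

lemma V_scale: "u \<in> V \<Longrightarrow> a *\<^sub>C u \<in> V"
  by (rule complex_vector.subspace_scale[OF V_subspace])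

lemma A_diff: "u \<in> V \<Longrightarrow> v \<in> V \<Longrightarrow> x \<in> D \<Longrightarrow> A (u - v) x = A u x - A v x"
  using A_add[of "u - v" v x] V_diff[of u v] by (simp add: algebra_simps)

sublocale G: hermitian_form V "D_inner \<mu> D E F A"
proof
  show "complex_vector.subspace V" by (rule V_subspace)
next
  fix u v w assume uvw: "u \<in> V" "v \<in> V" "w \<in> V"
  have "L2_inner \<mu> D F (A (u + v)) (A w) = L2_inner \<mu> D F (A u + A v) (A w)"
    by (rule F.L2_inner_cong) (simp_all add: A_add uvw)
  then show "D_inner \<mu> D E F A (u + v) w = D_inner \<mu> D E F A u w + D_inner \<mu> D E F A v w"
    using uvw by (simp add: D_inner_def LE.add_left LF.add_left V_L2 A_L2)
next
  fix u w a assume uw: "u \<in> V" "w \<in> V"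
  have "L2_inner \<mu> D F (A (a *\<^sub>C u)) (A w) = L2_inner \<mu> D F (a *\<^sub>C A u) (A w)"
    by (rule F.L2_inner_cong) (simp_all add: A_scale uw)
  then show "D_inner \<mu> D E F A (a *\<^sub>C u) w = a * D_inner \<mu> D E F A u w"
    using uw by (simp add: D_inner_def LE.scale_left LF.scale_left V_L2 A_L2 distrib_left)
next
  fix u v assume uv: "u \<in> V" "v \<in> V"
  then show "D_inner \<mu> D E F A v u = cnj (D_inner \<mu> D E F A u v)"
    using LE.sym[of u v] LF.sym[of "A u" "A v"] by (simp add: D_inner_def V_L2 A_L2)
next
  fix u assume u: "u \<in> V"
  then show "0 \<le> Re (D_inner \<mu> D E F A u u)"
    using LE.nonneg[of u] LF.nonneg[of "A u"] by (simp add: D_inner_def V_L2 A_L2)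
qed

lemma D_norm_eq: "D_norm \<mu> D E F A = G.nrm"
  by (rule ext) (simp add: D_norm_def G.nrm_def)

lemma G_nrm_diff_sq:
  assumes "u \<in> V" "v \<in> V"
  shows "(G.nrm (u - v))\<^sup>2 = (LE.nrm (u - v))\<^sup>2 + (LF.nrm (A u - A v))\<^sup>2"
proof -
  have "LF.nrm (A (u - v)) = LF.nrm (A u - A v)"
    by (rule LF_nrm_cong) (simp add: A_diff assms)
  moreover have "(G.nrm (u - v))\<^sup>2 = (LE.nrm (u - v))\<^sup>2 + (LF.nrm (A (u - v)))\<^sup>2"
    using V_diff[OF assms] by (simp add: G.nrm_sq LE.nrm_sq LF.nrm_sq V_L2 A_L2 D_inner_def)
  ultimately show ?thesis by simp
qed

lemma LE_le_G: "u \<in> V \<Longrightarrow> v \<in> V \<Longrightarrow> LE.nrm (u - v) \<le> G.nrm (u - v)"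
  by (rule power2_le_imp_le) (simp_all add: G_nrm_diff_sq V_diff)

lemma LF_le_G: "u \<in> V \<Longrightarrow> v \<in> V \<Longrightarrow> LF.nrm (A u - A v) \<le> G.nrm (u - v)"
  by (rule power2_le_imp_le) (simp_all add: G_nrm_diff_sq V_diff)

lemma G_le: "u \<in> V \<Longrightarrow> v \<in> V \<Longrightarrow> G.nrm (u - v) \<le> LE.nrm (u - v) + LF.nrm (A u - A v)"
proof (rule power2_le_imp_le)
  assume uv: "u \<in> V" "v \<in> V"
  have n: "0 \<le> LE.nrm (u - v)" "0 \<le> LF.nrm (A u - A v)"
    using uv by (auto intro!: LE.nrm_nonneg LF.nrm_nonneg LE.diff_in[simplified] LF.diff_in[simplified] simp: V_L2 A_L2)
  then show "0 \<le> LE.nrm (u - v) + LF.nrm (A u - A v)" by simp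
  show "(G.nrm (u - v))\<^sup>2 \<le> (LE.nrm (u - v) + LF.nrm (A u - A v))\<^sup>2"
    using mult_nonneg_nonneg[OF n] by (simp add: G_nrm_diff_sq uv power2_sum)
qed

abbreviation T :: "(nat \<Rightarrow> 'a \<Rightarrow> 'e) set set" where
  "T \<equiv> completion (D_norm \<mu> D E F A) V"

abbreviation cauchy_V :: "(nat \<Rightarrow> 'a \<Rightarrow> 'e) set" where
  "cauchy_V \<equiv> cauchy_seqs (D_norm \<mu> D E F A) V"

text \<open>The equivalence relation by which \<open>completion\<close> forms the quotient.\<close>

definition null_equiv :: "((nat \<Rightarrow> 'a \<Rightarrow> 'e) \<times> (nat \<Rightarrow> 'a \<Rightarrow> 'e)) set" where
  "null_equiv = {(s, t). s \<in> cauchy_V \<and> t \<in> cauchy_V \<and> (\<lambda>n. G.nrm (s n - t n)) \<longlonglongrightarrow> 0}"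

lemma T_eq: "T = cauchy_V // null_equiv"
  by (simp add: completion_def null_equiv_def D_norm_eq fun_diff_def)

lemma cauchy_V_iff: "s \<in> cauchy_V \<longleftrightarrow> (\<forall>n. s n \<in> V) \<and> G.cauchy s"
  by (auto simp: cauchy_seqs_def G.cauchy_def D_norm_eq fun_diff_def)

lemma equiv_null_equiv: "equiv cauchy_V null_equiv"
proof (rule equivI)
  show "null_equiv \<subseteq> cauchy_V \<times> cauchy_V" by (auto simp: null_equiv_def)
  show "refl_on cauchy_V null_equiv" by (auto simp: refl_on_def null_equiv_def)
  show "sym null_equiv"
  proof (rule symI)
    fix s t assume st: "(s, t) \<in> null_equiv"
    then have "G.nrm (t n - s n) = G.nrm (s n - t n)" for n
      by (intro G.nrm_minus_commute) (auto simp: null_equiv_def cauchy_V_iff)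
    then show "(t, s) \<in> null_equiv" using st by (simp add: null_equiv_def)
  qed
  show "trans null_equiv"
  proof (rule transI)
    fix s t r assume "(s, t) \<in> null_equiv" "(t, r) \<in> null_equiv"
    then show "(s, r) \<in> null_equiv"
      using G.nrm_tendsto_trans[of s t r] by (auto simp: null_equiv_def cauchy_V_iff)
  qed
qed

text \<open>The representative that is used in the definitions of \<open>ext_incl\<close> and \<open>ext_op\<close>.\<close>

definition rep :: "(nat \<Rightarrow> 'a \<Rightarrow> 'e) set \<Rightarrow> nat \<Rightarrow> 'a \<Rightarrow> 'e" where
  "rep u = (SOME s. s \<in> u)"

lemma rep_in:
  assumes "u \<in> T"
  shows "rep u \<in> u" "rep u \<in> cauchy_V"
proof -
  have "u \<noteq> {}" "u \<subseteq> cauchy_V"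
    using assms equiv_null_equiv unfolding T_eq
    by (simp_all add: in_quotient_imp_non_empty in_quotient_imp_subset)
  then show "rep u \<in> u" unfolding rep_def by (simp add: some_in_eq)
  then show "rep u \<in> cauchy_V" using \<open>u \<subseteq> cauchy_V\<close> by blast
qed

lemma rep_V: "u \<in> T \<Longrightarrow> rep u n \<in> V"
  using rep_in(2) cauchy_V_iff by blast

lemma cauchy_V_limits:
  assumes "s \<in> cauchy_V"
  shows "LE.cauchy s" "LF.cauchy (\<lambda>n. A (s n))"
proof -
  have V: "\<And>n. s n \<in> V" and c: "\<And>e. e > 0 \<Longrightarrow> \<exists>M. \<forall>i\<ge>M. \<forall>j\<ge>M. G.nrm (s i - s j) < e"
    using assms unfolding cauchy_V_iff G.cauchy_def by blast+
  show "LE.cauchy s" unfolding LE.cauchy_def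
    using c LE_le_G[OF V V] by (meson order_le_less_trans)
  show "LF.cauchy (\<lambda>n. A (s n))" unfolding LF.cauchy_def
    using c LF_le_G[OF V V] by (meson order_le_less_trans)
qed

text \<open>The chosen representative is Cauchy in \<open>L\<^sup>2\<close>, so by completeness the choice in \<open>L2_limit\<close> is one among
  actual limits.\<close>

lemma ext_incl_limit:
  assumes "u \<in> T"
  shows "L2_section \<mu> D E (ext_incl \<mu> D E u)" "(\<lambda>n. LE.nrm (rep u n - ext_incl \<mu> D E u)) \<longlonglongrightarrow> 0"
proof -
  let ?P = "\<lambda>g. L2_section \<mu> D E g \<and> (\<lambda>n. LE.nrm (rep u n - g)) \<longlonglongrightarrow> 0"
  have "range (rep u) \<subseteq> Collect (L2_section \<mu> D E)" using rep_V[OF assms] V_L2 by auto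
  then have "\<exists>g. ?P g"
    using E.L2_complete cauchy_V_limits(1)[OF rep_in(2)[OF assms]] unfolding LE.complete_def by auto
  then have "?P (SOME g. ?P g)" by (rule someI_ex)
  moreover have "ext_incl \<mu> D E u = (SOME g. ?P g)"
    by (simp add: ext_incl_def L2_limit_def rep_def E.L2_norm_nrm fun_diff_def)
  ultimately show "L2_section \<mu> D E (ext_incl \<mu> D E u)"
    "(\<lambda>n. LE.nrm (rep u n - ext_incl \<mu> D E u)) \<longlonglongrightarrow> 0" by simp_all
qed

lemma ext_op_limit:
  assumes "u \<in> T"
  shows "L2_section \<mu> D F (ext_op \<mu> D F A u)" "(\<lambda>n. LF.nrm (A (rep u n) - ext_op \<mu> D F A u)) \<longlonglongrightarrow> 0"
proof -
  let ?P = "\<lambda>g. L2_section \<mu> D F g \<and> (\<lambda>n. LF.nrm (A (rep u n) - g)) \<longlonglongrightarrow> 0"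
  have "range (\<lambda>n. A (rep u n)) \<subseteq> Collect (L2_section \<mu> D F)" using rep_V[OF assms] A_L2 by auto
  then have "\<exists>g. ?P g"
    using F.L2_complete cauchy_V_limits(2)[OF rep_in(2)[OF assms]] unfolding LF.complete_def by auto
  then have "?P (SOME g. ?P g)" by (rule someI_ex)
  moreover have "ext_op \<mu> D F A u = (SOME g. ?P g)"
    by (simp add: ext_op_def L2_limit_def rep_def F.L2_norm_nrm fun_diff_def)
  ultimately show "L2_section \<mu> D F (ext_op \<mu> D F A u)"
    "(\<lambda>n. LF.nrm (A (rep u n) - ext_op \<mu> D F A u)) \<longlonglongrightarrow> 0" by simp_all
qed

definition graph_closure :: "(('a \<Rightarrow> 'e) \<times> ('a \<Rightarrow> 'f)) set" where
  "graph_closure = {(g, h). L2_section \<mu> D E g \<and> L2_section \<mu> D F h \<and>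
     (\<exists>s. (\<forall>n. s n \<in> V) \<and> (\<lambda>n. LE.nrm (s n - g)) \<longlonglongrightarrow> 0 \<and> (\<lambda>n. LF.nrm (A (s n) - h)) \<longlonglongrightarrow> 0)}"

definition embed :: "(nat \<Rightarrow> 'a \<Rightarrow> 'e) set \<Rightarrow> ('a \<Rightarrow> 'e) \<times> ('a \<Rightarrow> 'f)" where
  "embed u = (ext_incl \<mu> D E u, ext_op \<mu> D F A u)"

lemma graph_closureD:
  assumes "p \<in> graph_closure"
  shows "L2_section \<mu> D E (fst p)" "L2_section \<mu> D F (snd p)"
    "\<exists>s. (\<forall>n. s n \<in> V) \<and> (\<lambda>n. LE.nrm (s n - fst p)) \<longlonglongrightarrow> 0 \<and> (\<lambda>n. LF.nrm (A (s n) - snd p)) \<longlonglongrightarrow> 0"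
  using assms by (auto simp: graph_closure_def)

text \<open>Up to null elements, \<open>embed\<close> is a bijection from the completion onto the closure of the graph: this is the
  content of the next three lemmas. Unlike the quotient, the closure is a subspace of a space of functions.\<close>

lemma embed_in: "u \<in> T \<Longrightarrow> embed u \<in> graph_closure"
  using ext_incl_limit[of u] ext_op_limit[of u] rep_V[of u]
  unfolding graph_closure_def embed_def by blast

text \<open>A sequence whose graph converges is Cauchy in the graph norm. The representative of its class differs from
  it by a null sequence, so its limits agree up to null sections.\<close>

lemma embed_onto:
  assumes p: "p \<in> graph_closure"
  shows "\<exists>u\<in>T. LE.nrm (fst (embed u) - fst p) = 0 \<and> LF.nrm (snd (embed u) - snd p) = 0"
proof -
  note gh = graph_closureD(1,2)[OF p]
  obtain s where s: "\<And>n. s n \<in> V" and sg: "(\<lambda>n. LE.nrm (s n - fst p)) \<longlonglongrightarrow> 0"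
    and sh: "(\<lambda>n. LF.nrm (A (s n) - snd p)) \<longlonglongrightarrow> 0"
    using graph_closureD(3)[OF p] by blast
  have sL: "s n \<in> Collect (L2_section \<mu> D E)" "A (s n) \<in> Collect (L2_section \<mu> D F)" for n
    using s V_L2 A_L2 by auto
  have cE: "LE.cauchy s" using LE.cauchy_if_convergent[OF sL(1) _ sg] gh by simp
  have cF: "LF.cauchy (\<lambda>n. A (s n))" using LF.cauchy_if_convergent[OF sL(2) _ sh] gh by simp
  have "G.cauchy s"
    unfolding G.cauchy_def
  proof (intro allI impI)
    fix e :: real assume "0 < e"
    then have e: "0 < e / 2" by simp
    obtain M where M: "\<And>i j. i \<ge> M \<Longrightarrow> j \<ge> M \<Longrightarrow> LE.nrm (s i - s j) < e / 2"
      using cE e unfolding LE.cauchy_def by blast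
    obtain M' where M': "\<And>i j. i \<ge> M' \<Longrightarrow> j \<ge> M' \<Longrightarrow> LF.nrm (A (s i) - A (s j)) < e / 2"
      using cF e unfolding LF.cauchy_def by blast
    have "G.nrm (s i - s j) < e" if "i \<ge> max M M'" "j \<ge> max M M'" for i j
      using G_le[OF s s, of i j] M[of i j] M'[of i j] that by simp
    then show "\<exists>M. \<forall>i\<ge>M. \<forall>j\<ge>M. G.nrm (s i - s j) < e" by blast
  qed
  then have sc: "s \<in> cauchy_V" using s cauchy_V_iff by blast
  define u where "u = null_equiv `` {s}"
  have u: "u \<in> T" unfolding T_eq u_def using sc by (rule quotientI)
  have "(s, rep u) \<in> null_equiv" using rep_in(1)[OF u] unfolding u_def by simp
  then have st: "(\<lambda>n. G.nrm (rep u n - s n)) \<longlonglongrightarrow> 0"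
    using equiv_null_equiv by (auto simp: equiv_def sym_def null_equiv_def)
  note t = rep_V[OF u]
  have tL: "rep u n \<in> Collect (L2_section \<mu> D E)" "A (rep u n) \<in> Collect (L2_section \<mu> D F)" for n
    using t V_L2 A_L2 by auto
  have tsE: "(\<lambda>n. LE.nrm (rep u n - s n)) \<longlonglongrightarrow> 0"
    using LE_le_G[OF t s] LE.nrm_nonneg[OF LE.diff_in[OF tL(1) sL(1)]]
    by (intro Lim_null_comparison[OF _ st]) simp
  have tsF: "(\<lambda>n. LF.nrm (A (rep u n) - A (s n))) \<longlonglongrightarrow> 0"
    using LF_le_G[OF t s] LF.nrm_nonneg[OF LF.diff_in[OF tL(2) sL(2)]]
    by (intro Lim_null_comparison[OF _ st]) simp
  have "LE.nrm (fst (embed u) - fst p) = 0"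
    unfolding embed_def fst_conv
    by (rule LE.nrm_limit_unique[OF tL(1) _ _ ext_incl_limit(2)[OF u] LE.nrm_tendsto_trans[OF tL(1) sL(1) _ tsE sg]])
       (use ext_incl_limit(1)[OF u] gh in auto)
  moreover have "LF.nrm (snd (embed u) - snd p) = 0"
    unfolding embed_def snd_conv
    by (rule LF.nrm_limit_unique[OF tL(2) _ _ ext_op_limit(2)[OF u] LF.nrm_tendsto_trans[OF tL(2) sL(2) _ tsF sh]])
       (use ext_op_limit(1)[OF u] gh in auto)
  ultimately show ?thesis using u by blast
qed

lemma embed_inj:
  assumes u: "u \<in> T" and v: "v \<in> T"
    and eq: "LE.nrm (fst (embed u) - fst (embed v)) = 0" "LF.nrm (snd (embed u) - snd (embed v)) = 0"
  shows "u = v"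
proof -
  note t = rep_V[OF u] rep_V[OF v]
  have L: "rep u n \<in> Collect (L2_section \<mu> D E)" "A (rep u n) \<in> Collect (L2_section \<mu> D F)"
    "rep v n \<in> Collect (L2_section \<mu> D E)" "A (rep v n) \<in> Collect (L2_section \<mu> D F)" for n
    using t V_L2 A_L2 by auto
  have i: "ext_incl \<mu> D E u \<in> Collect (L2_section \<mu> D E)" "ext_incl \<mu> D E v \<in> Collect (L2_section \<mu> D E)"
    "ext_op \<mu> D F A u \<in> Collect (L2_section \<mu> D F)" "ext_op \<mu> D F A v \<in> Collect (L2_section \<mu> D F)"
    using ext_incl_limit(1) ext_op_limit(1) u v by auto
  have eq': "(\<lambda>n::nat. LE.nrm (ext_incl \<mu> D E u - ext_incl \<mu> D E v)) \<longlonglongrightarrow> 0"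
    "(\<lambda>n::nat. LF.nrm (ext_op \<mu> D F A u - ext_op \<mu> D F A v)) \<longlonglongrightarrow> 0"
    using eq unfolding embed_def by simp_all
  have rE: "(\<lambda>n. LE.nrm (ext_incl \<mu> D E v - rep v n)) \<longlonglongrightarrow> 0"
    using ext_incl_limit(2)[OF v] LE.nrm_minus_commute[OF L(3) i(2)] by simp
  have rF: "(\<lambda>n. LF.nrm (ext_op \<mu> D F A v - A (rep v n))) \<longlonglongrightarrow> 0"
    using ext_op_limit(2)[OF v] LF.nrm_minus_commute[OF L(4) i(4)] by simp
  have 1: "(\<lambda>n. LE.nrm (rep u n - rep v n)) \<longlonglongrightarrow> 0"
    by (rule LE.nrm_tendsto_trans[OF L(1) i(2) L(3)
          LE.nrm_tendsto_trans[OF L(1) i(1) i(2) ext_incl_limit(2)[OF u] eq'(1)] rE])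
  have 2: "(\<lambda>n. LF.nrm (A (rep u n) - A (rep v n))) \<longlonglongrightarrow> 0"
    by (rule LF.nrm_tendsto_trans[OF L(2) i(4) L(4)
          LF.nrm_tendsto_trans[OF L(2) i(3) i(4) ext_op_limit(2)[OF u] eq'(2)] rF])
  have "(\<lambda>n. LE.nrm (rep u n - rep v n) + LF.nrm (A (rep u n) - A (rep v n))) \<longlonglongrightarrow> 0"
    using tendsto_add[OF 1 2] by simp
  moreover have "norm (G.nrm (rep u n - rep v n)) \<le>
      LE.nrm (rep u n - rep v n) + LF.nrm (A (rep u n) - A (rep v n))" for n
    using G_le[OF t(1)[of n] t(2)[of n]] G.nrm_nonneg[OF V_diff[OF t(1)[of n] t(2)[of n]]] by simp
  ultimately have "(\<lambda>n. G.nrm (rep u n - rep v n)) \<longlonglongrightarrow> 0"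
    by (rule Lim_null_comparison[OF always_eventually[OF allI], rotated])
  then have "(rep u, rep v) \<in> null_equiv"
    using rep_in(2) u v by (simp add: null_equiv_def)
  then show ?thesis
    using quotient_eq_iff[OF equiv_null_equiv] u v rep_in(1) unfolding T_eq by blast
qed


lemma graph_closure_subspace: "complex_vector.subspace graph_closure"
  unfolding complex_vector.subspace_def
proof (intro conjI ballI allI)
  have "0 \<in> V" by (rule complex_vector.subspace_0[OF V_subspace])
  moreover from this have "A 0 x = 0" if "x \<in> D" for x using A_scale[of 0 x 0] that by simp
  then have "LF.nrm (A 0) = LF.nrm 0" by (intro LF_nrm_cong) simp
  ultimately have "\<exists>s. (\<forall>n. s n \<in> V) \<and> (\<lambda>n. LE.nrm (s n - 0)) \<longlonglongrightarrow> 0 \<and> (\<lambda>n. LF.nrm (A (s n) - 0)) \<longlonglongrightarrow> 0"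
    by (intro exI[of _ "\<lambda>n. 0"]) simp
  then show "0 \<in> graph_closure"
    using LE.zero_in LF.zero_in unfolding graph_closure_def zero_prod_def by simp
next
  fix p q assume p: "p \<in> graph_closure" and q: "q \<in> graph_closure"
  note pL = graph_closureD(1,2)[OF p] and qL = graph_closureD(1,2)[OF q]
  obtain s where s: "\<And>n. s n \<in> V" "(\<lambda>n. LE.nrm (s n - fst p)) \<longlonglongrightarrow> 0" "(\<lambda>n. LF.nrm (A (s n) - snd p)) \<longlonglongrightarrow> 0"
    using graph_closureD(3)[OF p] by blast
  obtain t where t: "\<And>n. t n \<in> V" "(\<lambda>n. LE.nrm (t n - fst q)) \<longlonglongrightarrow> 0" "(\<lambda>n. LF.nrm (A (t n) - snd q)) \<longlonglongrightarrow> 0"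
    using graph_closureD(3)[OF q] by blast
  have L: "s n - fst p \<in> Collect (L2_section \<mu> D E)" "t n - fst q \<in> Collect (L2_section \<mu> D E)"
    "A (s n) - snd p \<in> Collect (L2_section \<mu> D F)" "A (t n) - snd q \<in> Collect (L2_section \<mu> D F)" for n
    using s(1) t(1) pL qL V_L2 A_L2 by (auto intro!: LE.diff_in[simplified] LF.diff_in[simplified])
  have "(\<lambda>n. LE.nrm ((s n + t n) - (fst p + fst q))) \<longlonglongrightarrow> 0"
  proof (rule Lim_null_comparison[OF always_eventually[OF allI]])
    fix n
    have "(s n + t n) - (fst p + fst q) = (s n - fst p) + (t n - fst q)" by simp
    then show "norm (LE.nrm ((s n + t n) - (fst p + fst q))) \<le> LE.nrm (s n - fst p) + LE.nrm (t n - fst q)"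
      using LE.nrm_triangle[OF L(1)[of n] L(2)[of n]] LE.nrm_nonneg[OF LE.add_in[OF L(1)[of n] L(2)[of n]]] by (simp only: real_norm_def abs_of_nonneg)
  next
    show "(\<lambda>n. LE.nrm (s n - fst p) + LE.nrm (t n - fst q)) \<longlonglongrightarrow> 0"
      using tendsto_add[OF s(2) t(2)] by simp
  qed
  moreover have "(\<lambda>n. LF.nrm (A (s n + t n) - (snd p + snd q))) \<longlonglongrightarrow> 0"
  proof (rule Lim_null_comparison[OF always_eventually[OF allI]])
    fix n
    have "LF.nrm (A (s n + t n) - (snd p + snd q)) = LF.nrm ((A (s n) - snd p) + (A (t n) - snd q))"
      by (rule LF_nrm_cong) (simp add: A_add s(1) t(1))
    then show "norm (LF.nrm (A (s n + t n) - (snd p + snd q))) \<le> LF.nrm (A (s n) - snd p) + LF.nrm (A (t n) - snd q)"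
      using LF.nrm_triangle[OF L(3)[of n] L(4)[of n]] LF.nrm_nonneg[OF LF.add_in[OF L(3)[of n] L(4)[of n]]] by (simp only: real_norm_def abs_of_nonneg)
  next
    show "(\<lambda>n. LF.nrm (A (s n) - snd p) + LF.nrm (A (t n) - snd q)) \<longlonglongrightarrow> 0"
      using tendsto_add[OF s(3) t(3)] by simp
  qed
  ultimately have "\<exists>r. (\<forall>n. r n \<in> V) \<and> (\<lambda>n. LE.nrm (r n - (fst p + fst q))) \<longlonglongrightarrow> 0 \<and>
      (\<lambda>n. LF.nrm (A (r n) - (snd p + snd q))) \<longlonglongrightarrow> 0"
    using V_add[OF s(1) t(1)] by (intro exI[of _ "\<lambda>n. s n + t n"]) simp
  moreover have "L2_section \<mu> D E (fst p + fst q)" "L2_section \<mu> D F (snd p + snd q)"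
    using LE.add_in LF.add_in pL qL by simp_all
  ultimately show "p + q \<in> graph_closure" unfolding graph_closure_def by (simp add: plus_prod_def)
next
  fix c p assume p: "p \<in> graph_closure"
  note pL = graph_closureD(1,2)[OF p]
  obtain s where s: "\<And>n. s n \<in> V" "(\<lambda>n. LE.nrm (s n - fst p)) \<longlonglongrightarrow> 0" "(\<lambda>n. LF.nrm (A (s n) - snd p)) \<longlonglongrightarrow> 0"
    using graph_closureD(3)[OF p] by blast
  have L: "s n - fst p \<in> Collect (L2_section \<mu> D E)" "A (s n) - snd p \<in> Collect (L2_section \<mu> D F)" for n
    using s(1) pL V_L2 A_L2 by (auto intro!: LE.diff_in[simplified] LF.diff_in[simplified])
  have "LE.nrm (c *\<^sub>C s n - c *\<^sub>C fst p) = cmod c * LE.nrm (s n - fst p)" for n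
    using LE.nrm_scale[OF L(1)[of n], of c] by (simp add: complex_vector.scale_right_diff_distrib)
  then have 1: "(\<lambda>n. LE.nrm (c *\<^sub>C s n - c *\<^sub>C fst p)) \<longlonglongrightarrow> 0"
    using tendsto_mult_right_zero[OF s(2)] by simp
  have "LF.nrm (A (c *\<^sub>C s n) - c *\<^sub>C snd p) = cmod c * LF.nrm (A (s n) - snd p)" for n
  proof -
    have "LF.nrm (A (c *\<^sub>C s n) - c *\<^sub>C snd p) = LF.nrm (c *\<^sub>C (A (s n) - snd p))"
      by (rule LF_nrm_cong) (simp add: A_scale s(1) complex_vector.scale_right_diff_distrib)
    then show ?thesis using LF.nrm_scale[OF L(2)[of n], of c] by (simp only:)
  qed
  then have 2: "(\<lambda>n. LF.nrm (A (c *\<^sub>C s n) - c *\<^sub>C snd p)) \<longlonglongrightarrow> 0"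
    using tendsto_mult_right_zero[OF s(3)] by simp
  have "\<exists>r. (\<forall>n. r n \<in> V) \<and> (\<lambda>n. LE.nrm (r n - c *\<^sub>C fst p)) \<longlonglongrightarrow> 0 \<and>
      (\<lambda>n. LF.nrm (A (r n) - c *\<^sub>C snd p)) \<longlonglongrightarrow> 0"
    using V_scale[OF s(1)] 1 2 by (intro exI[of _ "\<lambda>n. c *\<^sub>C s n"]) simp
  moreover have "L2_section \<mu> D E (c *\<^sub>C fst p)" "L2_section \<mu> D F (c *\<^sub>C snd p)"
    using LE.scale_in LF.scale_in pL by simp_all
  ultimately show "c *\<^sub>C p \<in> graph_closure" unfolding graph_closure_def by (simp add: scaleC_prod_def)
qed

abbreviation a_form :: "('a \<Rightarrow> 'e) \<times> ('a \<Rightarrow> 'f) \<Rightarrow> ('a \<Rightarrow> 'e) \<times> ('a \<Rightarrow> 'f) \<Rightarrow> complex" where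
  "a_form p q \<equiv> L2_inner \<mu> D F (snd p) (snd q)"

abbreviation b_form :: "('a \<Rightarrow> 'e) \<times> ('a \<Rightarrow> 'f) \<Rightarrow> ('a \<Rightarrow> 'e) \<times> ('a \<Rightarrow> 'f) \<Rightarrow> complex" where
  "b_form p q \<equiv> L2_inner \<mu> D E (fst p) (fst q)"

sublocale a: hermitian_form graph_closure a_form
proof
  show "complex_vector.subspace graph_closure" by (rule graph_closure_subspace)
next
  fix u v assume uv: "u \<in> graph_closure" "v \<in> graph_closure"
  show "a_form v u = cnj (a_form u v)" by (rule LF.sym) (simp_all add: graph_closureD(2) uv)
qed (simp_all add: LF.add_left LF.scale_left LF.nonneg graph_closureD(2))

sublocale b: hermitian_form graph_closure b_form
proof
  show "complex_vector.subspace graph_closure" by (rule graph_closure_subspace)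
next
  fix u v assume uv: "u \<in> graph_closure" "v \<in> graph_closure"
  show "b_form v u = cnj (b_form u v)" by (rule LE.sym) (simp_all add: graph_closureD(1) uv)
qed (simp_all add: LE.add_left LE.scale_left LE.nonneg graph_closureD(1))

sublocale ab: hermitian_form graph_closure "\<lambda>p q. a_form p q + b_form p q"
proof
  show "complex_vector.subspace graph_closure" by (rule graph_closure_subspace)
next
  fix u v assume uv: "u \<in> graph_closure" "v \<in> graph_closure"
  show "a_form v u + b_form v u = cnj (a_form u v + b_form u v)"
    using a.sym[OF uv] b.sym[OF uv] by simp
qed (simp_all add: LE.add_left LF.add_left LE.scale_left LF.scale_left LE.nonneg LF.nonneg
    graph_closureD(1,2) distrib_left)

lemma a_nrm: "a.nrm p = LF.nrm (snd p)"
  by (simp add: a.nrm_def LF.nrm_def)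

lemma b_nrm: "b.nrm p = LE.nrm (fst p)"
  by (simp add: b.nrm_def LE.nrm_def)

lemma ab_nrm_sq: "p \<in> graph_closure \<Longrightarrow> (ab.nrm p)\<^sup>2 = (LF.nrm (snd p))\<^sup>2 + (LE.nrm (fst p))\<^sup>2"
  by (simp add: ab.nrm_sq LE.nrm_sq LF.nrm_sq graph_closureD)

text \<open>A Cauchy sequence in the graph closure has a limit in the product of the \<open>L\<^sup>2\<close> spaces; approximating
  its \<open>n\<close>-th member by a point of the graph up to \<open>1 / (n + 1)\<close> shows that the limit is again in the closure.\<close>

lemma ab_complete: "ab.complete"
  unfolding ab.complete_def
proof (intro allI impI)
  fix p assume "range p \<subseteq> graph_closure" and cau: "ab.cauchy p"
  then have p: "\<And>n. p n \<in> graph_closure" by blast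
  have L: "fst (p n) \<in> Collect (L2_section \<mu> D E)" "snd (p n) \<in> Collect (L2_section \<mu> D F)" for n
    using graph_closureD(1,2)[OF p] by auto
  have le: "LE.nrm (fst (p i) - fst (p j)) \<le> ab.nrm (p i - p j)"
    "LF.nrm (snd (p i) - snd (p j)) \<le> ab.nrm (p i - p j)" for i j
  proof -
    have d: "p i - p j \<in> graph_closure" using p by simp
    show "LE.nrm (fst (p i) - fst (p j)) \<le> ab.nrm (p i - p j)"
      by (rule power2_le_imp_le) (simp_all add: ab_nrm_sq[OF d] ab.nrm_nonneg[OF d])
    show "LF.nrm (snd (p i) - snd (p j)) \<le> ab.nrm (p i - p j)"
      by (rule power2_le_imp_le) (simp_all add: ab_nrm_sq[OF d] ab.nrm_nonneg[OF d])
  qed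
  have cE: "LE.cauchy (\<lambda>n. fst (p n))" unfolding LE.cauchy_def
  proof (intro allI impI)
    fix e :: real assume "0 < e"
    then obtain M where "\<forall>i\<ge>M. \<forall>j\<ge>M. ab.nrm (p i - p j) < e" using cau unfolding ab.cauchy_def by blast
    then show "\<exists>M. \<forall>i\<ge>M. \<forall>j\<ge>M. LE.nrm (fst (p i) - fst (p j)) < e"
      using le(1) order_le_less_trans by blast
  qed
  have "range (\<lambda>n. fst (p n)) \<subseteq> Collect (L2_section \<mu> D E)" using L(1) by blast
  with cE obtain g where g: "L2_section \<mu> D E g" "(\<lambda>n. LE.nrm (fst (p n) - g)) \<longlonglongrightarrow> 0"
    using E.L2_complete[unfolded LE.complete_def, rule_format, of "\<lambda>n. fst (p n)"] by auto
  have cF: "LF.cauchy (\<lambda>n. snd (p n))" unfolding LF.cauchy_def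
  proof (intro allI impI)
    fix e :: real assume "0 < e"
    then obtain M where "\<forall>i\<ge>M. \<forall>j\<ge>M. ab.nrm (p i - p j) < e" using cau unfolding ab.cauchy_def by blast
    then show "\<exists>M. \<forall>i\<ge>M. \<forall>j\<ge>M. LF.nrm (snd (p i) - snd (p j)) < e"
      using le(2) order_le_less_trans by blast
  qed
  have "range (\<lambda>n. snd (p n)) \<subseteq> Collect (L2_section \<mu> D F)" using L(2) by blast
  with cF obtain h where h: "L2_section \<mu> D F h" "(\<lambda>n. LF.nrm (snd (p n) - h)) \<longlonglongrightarrow> 0"
    using F.L2_complete[unfolded LF.complete_def, rule_format, of "\<lambda>n. snd (p n)"] by auto
  have "\<exists>v\<in>V. LE.nrm (v - fst (p n)) < inverse (real (Suc n)) \<and> LF.nrm (A v - snd (p n)) < inverse (real (Suc n))" for n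
  proof -
    obtain s where s: "\<And>k. s k \<in> V" "(\<lambda>k. LE.nrm (s k - fst (p n))) \<longlonglongrightarrow> 0"
        "(\<lambda>k. LF.nrm (A (s k) - snd (p n))) \<longlonglongrightarrow> 0"
      using graph_closureD(3)[OF p] by blast
    have "0 < inverse (real (Suc n))" by simp
    from order_tendstoD(2)[OF s(2) this] order_tendstoD(2)[OF s(3) this]
    have "\<forall>\<^sub>F k in sequentially. LE.nrm (s k - fst (p n)) < inverse (real (Suc n)) \<and>
        LF.nrm (A (s k) - snd (p n)) < inverse (real (Suc n))"
      by (rule eventually_conj)
    then obtain k where "LE.nrm (s k - fst (p n)) < inverse (real (Suc n)) \<and>
        LF.nrm (A (s k) - snd (p n)) < inverse (real (Suc n))"
      unfolding eventually_sequentially by blast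
    then show ?thesis using s(1) by blast
  qed
  then obtain v where v: "\<And>n. v n \<in> V" "\<And>n. LE.nrm (v n - fst (p n)) < inverse (real (Suc n))"
    "\<And>n. LF.nrm (A (v n) - snd (p n)) < inverse (real (Suc n))" by metis
  have vL: "v n \<in> Collect (L2_section \<mu> D E)" "A (v n) \<in> Collect (L2_section \<mu> D F)" for n
    using v(1) V_L2 A_L2 by auto
  have vp: "(\<lambda>n. LE.nrm (v n - fst (p n))) \<longlonglongrightarrow> 0" "(\<lambda>n. LF.nrm (A (v n) - snd (p n))) \<longlonglongrightarrow> 0"
  proof -
    show "(\<lambda>n. LE.nrm (v n - fst (p n))) \<longlonglongrightarrow> 0"
      using LE.nrm_nonneg[OF LE.diff_in[OF vL(1) L(1)]] v(2)
      by (intro Lim_null_comparison[OF _ LIMSEQ_inverse_real_of_nat]) (simp add: less_imp_le)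
    show "(\<lambda>n. LF.nrm (A (v n) - snd (p n))) \<longlonglongrightarrow> 0"
      using LF.nrm_nonneg[OF LF.diff_in[OF vL(2) L(2)]] v(3)
      by (intro Lim_null_comparison[OF _ LIMSEQ_inverse_real_of_nat]) (simp add: less_imp_le)
  qed
  have gL: "g \<in> Collect (L2_section \<mu> D E)" "h \<in> Collect (L2_section \<mu> D F)" using g(1) h(1) by auto
  have "(\<lambda>n. LE.nrm (v n - g)) \<longlonglongrightarrow> 0"
    by (rule LE.nrm_tendsto_trans[OF vL(1) L(1) gL(1) vp(1) g(2)])
  moreover have "(\<lambda>n. LF.nrm (A (v n) - h)) \<longlonglongrightarrow> 0"
    by (rule LF.nrm_tendsto_trans[OF vL(2) L(2) gL(2) vp(2) h(2)])
  ultimately have gh: "(g, h) \<in> graph_closure"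
    unfolding graph_closure_def using g(1) h(1) v(1) by blast
  have "(\<lambda>n. ab.nrm (p n - (g, h))) \<longlonglongrightarrow> 0"
  proof (rule Lim_null_comparison[OF always_eventually[OF allI]])
    fix n
    have d: "p n - (g, h) \<in> graph_closure" using p gh by simp
    have nn: "0 \<le> LF.nrm (snd (p n) - h)" "0 \<le> LE.nrm (fst (p n) - g)"
      using LF.nrm_nonneg[OF LF.diff_in[OF L(2) gL(2)]] LE.nrm_nonneg[OF LE.diff_in[OF L(1) gL(1)]] by auto
    have "ab.nrm (p n - (g, h)) \<le> LF.nrm (snd (p n) - h) + LE.nrm (fst (p n) - g)"
    proof (rule power2_le_imp_le)
      show "(ab.nrm (p n - (g, h)))\<^sup>2 \<le> (LF.nrm (snd (p n) - h) + LE.nrm (fst (p n) - g))\<^sup>2"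
        using mult_nonneg_nonneg[OF nn(2,1)] by (simp add: ab_nrm_sq[OF d] power2_sum)
    qed (use nn in simp)
    then show "norm (ab.nrm (p n - (g, h))) \<le> LF.nrm (snd (p n) - h) + LE.nrm (fst (p n) - g)"
      using ab.nrm_nonneg[OF d] by simp
  next
    show "(\<lambda>n. LF.nrm (snd (p n) - h) + LE.nrm (fst (p n) - g)) \<longlonglongrightarrow> 0"
      using tendsto_add[OF h(2) g(2)] by simp
  qed
  then show "\<exists>l\<in>graph_closure. (\<lambda>n. ab.nrm (p n - l)) \<longlonglongrightarrow> 0" using gh by blast
qed

section \<open>Boundedness and solvability\<close>

text \<open>The property by which \<open>u_eps\<close> is defined as the unique element.\<close>

definition solves :: "('a \<Rightarrow> 'f) \<Rightarrow> real \<Rightarrow> (nat \<Rightarrow> 'a \<Rightarrow> 'e) set \<Rightarrow> bool" where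
  "solves f \<epsilon> u \<longleftrightarrow> u \<in> T \<and> (\<forall>v\<in>T.
      L2_inner \<mu> D F (ext_op \<mu> D F A u) (ext_op \<mu> D F A v) +
      complex_of_real \<epsilon> * L2_inner \<mu> D E (ext_incl \<mu> D E u) (ext_incl \<mu> D E v) =
      L2_inner \<mu> D F f (ext_op \<mu> D F A v))"

text \<open>Along \<open>embed\<close>, equations tested with all elements of the completion correspond to equations tested
  with the whole graph closure, as the forms do not see null elements. So the existence and uniqueness of the
  regularized solutions and the criterion for boundedness carry over from the graph closure.\<close>

theorem bounded_iff_solvable:
  assumes f: "L2_section \<mu> D F f"
  shows "(\<exists>K. \<forall>\<epsilon>>0. D_T_norm \<mu> D E F A (THE u. solves f \<epsilon> u) \<le> K) \<longleftrightarrow>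
    (\<exists>u\<in>T. \<forall>v\<in>T. L2_inner \<mu> D F (ext_op \<mu> D F A u) (ext_op \<mu> D F A v) =
       L2_inner \<mu> D F f (ext_op \<mu> D F A v))"
proof -
  let ?\<phi> = "\<lambda>q :: ('a \<Rightarrow> 'e) \<times> ('a \<Rightarrow> 'f). L2_inner \<mu> D F f (snd q)"
  have fL: "f \<in> Collect (L2_section \<mu> D F)" using f by simp
  interpret R: regularization graph_closure a_form b_form ?\<phi> "LF.nrm f"
  proof
    show "ab.complete" by (rule ab_complete)
    show "?\<phi> (u + v) = ?\<phi> u + ?\<phi> v" if "u \<in> graph_closure" "v \<in> graph_closure" for u v
      using LF.add_right[of "snd u" "snd v" f] that fL by (simp add: graph_closureD(2))
    show "?\<phi> (c *\<^sub>C u) = cnj c * ?\<phi> u" if "u \<in> graph_closure" for c u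
      using LF.scale_right[of "snd u" f c] that fL by (simp add: graph_closureD(2))
    show "cmod (?\<phi> u) \<le> LF.nrm f * a.nrm u" if "u \<in> graph_closure" for u
      unfolding a_nrm using that by (intro LF.cauchy_schwarz fL) (simp add: graph_closureD(2))
    show "0 \<le> LF.nrm f" by (rule LF.nrm_nonneg[OF fL])
  qed
  have transfer: "a_form p q = a_form p' q'" "b_form p q = b_form p' q'" "?\<phi> q = ?\<phi> q'"
    if "p \<in> graph_closure" "p' \<in> graph_closure" "q \<in> graph_closure" "q' \<in> graph_closure"
      "LE.nrm (fst p - fst p') = 0" "LF.nrm (snd p - snd p') = 0"
      "LE.nrm (fst q - fst q') = 0" "LF.nrm (snd q - snd q') = 0" for p p' q q'
  proof -
    show "a_form p q = a_form p' q'"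
      by (rule LF.ip_cong_nrm) (use that graph_closureD(2) in auto)
    show "b_form p q = b_form p' q'"
      by (rule LE.ip_cong_nrm) (use that graph_closureD(1) in auto)
    have "LF.nrm (f - f) = 0" by simp
    then show "?\<phi> q = ?\<phi> q'"
      by (intro LF.ip_cong_nrm fL) (use that graph_closureD(2) in auto)
  qed
  have null: "LE.nrm (fst p - fst p) = 0" "LF.nrm (snd p - snd p) = 0" for p :: "('a \<Rightarrow> 'e) \<times> ('a \<Rightarrow> 'f)"
    by simp_all
  have forms_embed: "a_form (embed u) (embed v) = L2_inner \<mu> D F (ext_op \<mu> D F A u) (ext_op \<mu> D F A v)"
    "b_form (embed u) (embed v) = L2_inner \<mu> D E (ext_incl \<mu> D E u) (ext_incl \<mu> D E v)"
    "?\<phi> (embed v) = L2_inner \<mu> D F f (ext_op \<mu> D F A v)" for u v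
    by (simp_all add: embed_def)
  have solves_iff: "solves f \<epsilon> u \<longleftrightarrow> u \<in> T \<and> R.regularized \<epsilon> (embed u)" for \<epsilon> u
  proof
    assume s: "solves f \<epsilon> u"
    then have u: "u \<in> T" by (simp add: solves_def)
    have "a_form (embed u) q + complex_of_real \<epsilon> * b_form (embed u) q = ?\<phi> q" if q: "q \<in> graph_closure" for q
    proof -
      obtain v where v: "v \<in> T" "LE.nrm (fst (embed v) - fst q) = 0" "LF.nrm (snd (embed v) - snd q) = 0"
        using embed_onto[OF q] by blast
      note tr = transfer[OF embed_in[OF u] embed_in[OF u] embed_in[OF v(1)] q null v(2,3)]
      have "a_form (embed u) (embed v) + complex_of_real \<epsilon> * b_form (embed u) (embed v) = ?\<phi> (embed v)"
        using s v(1) unfolding solves_def forms_embed by blast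
      then show ?thesis unfolding tr .
    qed
    then show "u \<in> T \<and> R.regularized \<epsilon> (embed u)"
      using u embed_in[OF u] unfolding R.regularized_def by blast
  next
    assume r: "u \<in> T \<and> R.regularized \<epsilon> (embed u)"
    then show "solves f \<epsilon> u"
      unfolding solves_def R.regularized_def using embed_in forms_embed by metis
  qed
  have ex1: "\<exists>!u. solves f \<epsilon> u" if \<epsilon>: "0 < \<epsilon>" for \<epsilon>
  proof -
    obtain p where p: "R.regularized \<epsilon> p" using R.regularized_exists[OF \<epsilon>] by blast
    then have pG: "p \<in> graph_closure" by (simp add: R.regularized_def)
    obtain u where u: "u \<in> T" "LE.nrm (fst (embed u) - fst p) = 0" "LF.nrm (snd (embed u) - snd p) = 0"
      using embed_onto[OF pG] by blast
    have "R.regularized \<epsilon> (embed u)"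
      unfolding R.regularized_def
    proof (intro conjI ballI embed_in u(1))
      fix q assume q: "q \<in> graph_closure"
      note tr = transfer[OF embed_in[OF u(1)] pG q q u(2,3) null]
      show "a_form (embed u) q + complex_of_real \<epsilon> * b_form (embed u) q = ?\<phi> q"
        unfolding tr(1,2) using p q by (simp add: R.regularized_def)
    qed
    then have "solves f \<epsilon> u" using u(1) solves_iff by blast
    moreover have "v = u" if v: "solves f \<epsilon> v" for v
    proof -
      have vu: "v \<in> T" "R.regularized \<epsilon> (embed v)" "R.regularized \<epsilon> (embed u)"
        using v \<open>solves f \<epsilon> u\<close> solves_iff by blast+
      have "LE.nrm (fst (embed v) - fst (embed u)) = 0" "LF.nrm (snd (embed v) - snd (embed u)) = 0"
        using R.regularized_unique[OF \<epsilon> vu(2,3)] unfolding a_nrm b_nrm by simp_all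
      then show ?thesis by (rule embed_inj[OF vu(1) u(1)])
    qed
    ultimately show ?thesis by blast
  qed
  define U where "U \<epsilon> = (THE u. solves f \<epsilon> u)" for \<epsilon>
  have U: "solves f \<epsilon> (U \<epsilon>)" if "0 < \<epsilon>" for \<epsilon>
    unfolding U_def by (rule theI'[OF ex1[OF that]])
  have norm_U: "D_T_norm \<mu> D E F A u = ab.nrm (embed u)" for u
    unfolding D_T_norm_def D_T_inner_def ab.nrm_def forms_embed by (simp add: add.commute)
  have "(\<exists>K. \<forall>\<epsilon>>0. D_T_norm \<mu> D E F A (U \<epsilon>) \<le> K) \<longleftrightarrow> (\<exists>u\<in>graph_closure. \<forall>v\<in>graph_closure. a_form u v = ?\<phi> v)"
    unfolding norm_U by (rule R.bounded_iff_solvable) (use U solves_iff in blast)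
  also have "\<dots> \<longleftrightarrow> (\<exists>u\<in>T. \<forall>v\<in>T. a_form (embed u) (embed v) = ?\<phi> (embed v))"
  proof
    assume "\<exists>p\<in>graph_closure. \<forall>q\<in>graph_closure. a_form p q = ?\<phi> q"
    then obtain p where p: "p \<in> graph_closure" "\<And>q. q \<in> graph_closure \<Longrightarrow> a_form p q = ?\<phi> q" by blast
    obtain u where u: "u \<in> T" "LE.nrm (fst (embed u) - fst p) = 0" "LF.nrm (snd (embed u) - snd p) = 0"
      using embed_onto[OF p(1)] by blast
    have "a_form (embed u) (embed v) = ?\<phi> (embed v)" if v: "v \<in> T" for v
      using transfer(1)[OF embed_in[OF u(1)] p(1) embed_in[OF v] embed_in[OF v] u(2,3) null]
        p(2)[OF embed_in[OF v]] by (rule trans)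
    then show "\<exists>u\<in>T. \<forall>v\<in>T. a_form (embed u) (embed v) = ?\<phi> (embed v)" using u(1) by blast
  next
    assume "\<exists>u\<in>T. \<forall>v\<in>T. a_form (embed u) (embed v) = ?\<phi> (embed v)"
    then obtain u where u: "u \<in> T" "\<And>v. v \<in> T \<Longrightarrow> a_form (embed u) (embed v) = ?\<phi> (embed v)" by blast
    have "a_form (embed u) q = ?\<phi> q" if q: "q \<in> graph_closure" for q
    proof -
      obtain v where v: "v \<in> T" "LE.nrm (fst (embed v) - fst q) = 0" "LF.nrm (snd (embed v) - snd q) = 0"
        using embed_onto[OF q] by blast
      note tr = transfer[OF embed_in[OF u(1)] embed_in[OF u(1)] embed_in[OF v(1)] q null v(2,3)]
      show ?thesis using u(2)[OF v(1)] unfolding tr .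
    qed
    then show "\<exists>p\<in>graph_closure. \<forall>q\<in>graph_closure. a_form p q = ?\<phi> q" using embed_in[OF u(1)] by blast
  qed
  finally show ?thesis unfolding U_def forms_embed .
qed

end

text \<open>The boundary conditions are linear, because a neighbourhood of every point of \<open>\<Gamma>\<close> is contained both in the
  neighbourhood \<open>N\<close> on which the operators \<open>B\<^sub>j\<close> are defined and in that on which the sections are smooth.\<close>

lemma smooth_T_subspace:
  fixes C :: "('a::{second_countable_topology,t2_space}, 'n::finite) chart set"
    and E :: "('a, 'e::complex_vector, 'y) vbundle_scheme"
    and G :: "nat \<Rightarrow> ('a, 'g::complex_vector, 'z) vbundle_scheme"
  assumes C: "smooth_structure C" and E: "vector_bundle C X E" and D: "closure D \<subseteq> interior X"
    and \<Gamma>: "\<Gamma> \<subseteq> frontier D" and N: "N \<subseteq> X" and B: "dirichlet_system C (frontier D) N m E G k B"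
  shows "complex_vector.subspace (smooth_T C X D \<Gamma> E m B)"
proof -
  interpret E: bundle_over_manifold C X E by unfold_locales (fact C E)+
  have N_open: "open N" and \<Gamma>N: "\<Gamma> \<subseteq> N" using B \<Gamma> unfolding dirichlet_system_def by blast+
  have Bj: "diff_operator C X E N (G j) (k j) (B j)" if "j < m" for j
  proof -
    have "vector_bundle C N (G j)" "diff_op C N E (G j) (k j) (B j)"
      using B that unfolding dirichlet_system_def by blast+
    then show ?thesis using C N by unfold_locales
  qed
  have \<Gamma>D: "\<Gamma> \<subseteq> closure D" using \<Gamma> by (auto simp: frontier_def)
  have memI: "u \<in> smooth_T C X D \<Gamma> E m B"
    if "open W" "closure D \<subseteq> W" "W \<subseteq> X" "smooth_section C E W u"
      "\<And>j x. j < m \<Longrightarrow> x \<in> \<Gamma> \<Longrightarrow> B j u x = 0" for u W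
  proof -
    have "u \<in> smooth_upto C X D E"
      unfolding smooth_upto_def mem_Collect_eq using that(1-4) by (intro exI conjI)
    then show ?thesis unfolding smooth_T_def using that(5) by simp
  qed
  have memD: "\<exists>W. open W \<and> closure D \<subseteq> W \<and> W \<subseteq> X \<and> smooth_section C E W u"
    if "u \<in> smooth_T C X D \<Gamma> E m B" for u
    using that unfolding smooth_T_def smooth_upto_def by simp
  have zeroD: "B j u x = 0" if "u \<in> smooth_T C X D \<Gamma> E m B" "j < m" "x \<in> \<Gamma>" for u j x
    using that unfolding smooth_T_def by simp
  have scale: "(\<lambda>x. a *\<^sub>C u x) \<in> smooth_T C X D \<Gamma> E m B"
    if W: "open W" "closure D \<subseteq> W" "W \<subseteq> X" and u: "smooth_section C E W u"
      and zero: "\<And>j x. j < m \<Longrightarrow> x \<in> \<Gamma> \<Longrightarrow> a *\<^sub>C B j u x = 0" for a u W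
  proof (rule memI[OF W E.smooth_section_scale[OF W(1,3) u]])
    fix j x assume j: "j < m" and x: "x \<in> \<Gamma>"
    interpret B: diff_operator C X E N "G j" "k j" "B j" by (rule Bj[OF j])
    have "B j (\<lambda>x. a *\<^sub>C u x) x = a *\<^sub>C B j u x"
      by (rule B.op_scale[of "W \<inter> N"])
         (use W N_open u x \<Gamma>N \<Gamma>D in \<open>auto intro: smooth_section_subset\<close>)
    then show "B j (\<lambda>x. a *\<^sub>C u x) x = 0" using zero[OF j x] by simp
  qed
  show ?thesis
    unfolding complex_vector.subspace_def
  proof (intro conjI ballI allI)
    have "smooth_section C E (interior X) (\<lambda>x. 0)"
      by (rule E.smooth_section_zero[OF interior_subset open_interior])
    from scale[OF open_interior D interior_subset this, of 0]
    show "0 \<in> smooth_T C X D \<Gamma> E m B" by (simp add: zero_fun_def)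
  next
    fix u v assume uv: "u \<in> smooth_T C X D \<Gamma> E m B" "v \<in> smooth_T C X D \<Gamma> E m B"
    obtain W where W: "open W" "closure D \<subseteq> W" "W \<subseteq> X" "smooth_section C E W u"
      using memD[OF uv(1)] by (elim exE conjE)
    obtain W' where W': "open W'" "closure D \<subseteq> W'" "W' \<subseteq> X" "smooth_section C E W' v"
      using memD[OF uv(2)] by (elim exE conjE)
    have WW: "open (W \<inter> W')" "closure D \<subseteq> W \<inter> W'" "W \<inter> W' \<subseteq> X" using W W' by auto
    have u: "smooth_section C E (W \<inter> W') u" and v: "smooth_section C E (W \<inter> W') v"
      using W(4) W'(4) by (auto intro: smooth_section_subset)
    have "(\<lambda>x. u x + v x) \<in> smooth_T C X D \<Gamma> E m B"
    proof (rule memI[OF WW E.smooth_section_add[OF WW(1,3) u v]])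
      fix j x assume j: "j < m" and x: "x \<in> \<Gamma>"
      interpret B: diff_operator C X E N "G j" "k j" "B j" by (rule Bj[OF j])
      have "B j (\<lambda>x. u x + v x) x = B j u x + B j v x"
        by (rule B.op_add[of "W \<inter> W' \<inter> N"])
           (use WW N_open u v x \<Gamma>N \<Gamma>D in \<open>auto intro: smooth_section_subset\<close>)
      then show "B j (\<lambda>x. u x + v x) x = 0" using zeroD[OF uv(1) j x] zeroD[OF uv(2) j x] by simp
    qed
    then show "u + v \<in> smooth_T C X D \<Gamma> E m B" by (simp add: plus_fun_def)
  next
    fix a u assume u: "u \<in> smooth_T C X D \<Gamma> E m B"
    obtain W where W: "open W" "closure D \<subseteq> W" "W \<subseteq> X" "smooth_section C E W u"
      using memD[OF u] by (elim exE conjE)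
    show "a *\<^sub>C u \<in> smooth_T C X D \<Gamma> E m B"
      unfolding scaleC_fun_def by (rule scale[OF W]) (simp add: zeroD[OF u])
  qed
qed

theorem theorem4p1:
  fixes C :: "('a::{second_countable_topology,t2_space}, 'n::finite) chart set"
    and X D \<Gamma> N :: "'a set"
    and \<omega> :: "('a, 'n) chart \<Rightarrow> 'a \<Rightarrow> real"
    and \<mu> :: "'a measure"
    and E :: "('a, 'e::complex_vector) hermitian_bundle"
    and F :: "('a, 'f::complex_vector) hermitian_bundle"
    and A :: "('a \<Rightarrow> 'e) \<Rightarrow> 'a \<Rightarrow> 'f"
    and m :: nat
    and G :: "nat \<Rightarrow> ('a, 'g::complex_vector) vbundle"
    and k :: "nat \<Rightarrow> nat"
    and B :: "nat \<Rightarrow> ('a \<Rightarrow> 'e) \<Rightarrow> 'a \<Rightarrow> 'g"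
    and f :: "'a \<Rightarrow> 'f"
  assumes "closed_manifold C"
    and "manifold_with_boundary C X"
    and "volume_form C X \<omega>" and "volume_measure C X \<omega> \<mu>"
    and "hermitian_vector_bundle C X E" and "hermitian_vector_bundle C X F"
    and "diff_op C X E F m A" and "injective_symbol C X E F m A"
    and "smooth_domain C D" and "compact (closure D)" and "closure D \<subseteq> interior X"
    and "closed \<Gamma>" and "\<Gamma> \<subseteq> frontier D"
    and "N \<subseteq> X" and "dirichlet_system C (frontier D) N m E G k B"
    and "L2_section \<mu> D F f"
  shows "(\<exists>K. \<forall>\<epsilon>>0. D_T_norm \<mu> D E F A (u_eps C X \<mu> D \<Gamma> E F A m B f \<epsilon>) \<le> K) \<longleftrightarrow>
    (\<exists>u \<in> D_T C X \<mu> D \<Gamma> E F A m B. \<forall>v \<in> D_T C X \<mu> D \<Gamma> E F A m B.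
       L2_inner \<mu> D F (ext_op \<mu> D F A u) (ext_op \<mu> D F A v) =
       L2_inner \<mu> D F f (ext_op \<mu> D F A v))"
proof -
  have C: "smooth_structure C" using assms(1) unfolding closed_manifold_def by blast
  have EF: "vector_bundle C X E" "vector_bundle C X F"
    using conjunct1[OF assms(5)[unfolded hermitian_vector_bundle_def]]
      conjunct1[OF assms(6)[unfolded hermitian_vector_bundle_def]] .
  have D: "open D" "D \<subseteq> X"
    using assms(9,11) closure_subset[of D] interior_subset[of X] unfolding smooth_domain_def by blast+
  have \<mu>: "sets \<mu> = sets borel" using assms(4) unfolding volume_measure_def by blast
  have fin: "\<exists>W. open W \<and> p \<in> W \<and> emeasure \<mu> W < \<infinity>" if "p \<in> closure D" for p
    using volume_locally_finite[OF C assms(3,4)] assms(11) that by blast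
  interpret E: hermitian_bundle_on C X E D \<mu> by unfold_locales (fact C EF assms(5) D \<mu>)+
  interpret F: hermitian_bundle_on C X F D \<mu> by unfold_locales (fact C EF assms(6) D \<mu>)+
  interpret A: diff_operator C X E X F m A by unfold_locales (fact subset_refl assms(7))+
  let ?V = "smooth_T C X D \<Gamma> E m B"
  have V: "\<exists>W. open W \<and> closure D \<subseteq> W \<and> W \<subseteq> X \<and> smooth_section C E W u" if "u \<in> ?V" for u
    using that unfolding smooth_T_def smooth_upto_def by simp
  interpret graph_completion C X E F D \<mu> A ?V
  proof unfold_locales
    show "complex_vector.subspace ?V"
      by (rule smooth_T_subspace[OF C EF(1) assms(11,13,14,15)])
  next
    fix u assume "u \<in> ?V"
    then obtain W where W: "open W" "closure D \<subseteq> W" "W \<subseteq> X" and u: "smooth_section C E W u"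
      using V by blast
    show "L2_section \<mu> D E u"
      by (rule E.continuous_section_L2[OF assms(10) fin W(1,3,2) E.smooth_sectionD(1)[OF u]
            smooth_on_imp_continuous_on[OF C E.smooth_sectionD(2)[OF u]]])
    show "L2_section \<mu> D F (A u)"
      by (rule F.continuous_section_L2[OF assms(10) fin W(1,3,2) A.op_fibre[OF W(1,3) u]
            A.op_coord_continuous[OF W(1,3) u]])
  next
    fix u v x assume uv: "u \<in> ?V" "v \<in> ?V" and x: "x \<in> D"
    obtain W where W: "open W" "closure D \<subseteq> W" "W \<subseteq> X" "smooth_section C E W u"
      using V[OF uv(1)] by blast
    obtain W' where W': "open W'" "closure D \<subseteq> W'" "W' \<subseteq> X" "smooth_section C E W' v"
      using V[OF uv(2)] by blast
    have "x \<in> W \<inter> W'" using x W(2) W'(2) closure_subset[of D] by blast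
    then have "A (\<lambda>x. u x + v x) x = A u x + A v x"
      by (rule A.op_add[rotated 4])
         (use W W' in \<open>auto intro: smooth_section_subset\<close>)
    then show "A (u + v) x = A u x + A v x" by (simp add: plus_fun_def)
  next
    fix u a x assume u: "u \<in> ?V" and x: "x \<in> D"
    obtain W where W: "open W" "closure D \<subseteq> W" "W \<subseteq> X" "smooth_section C E W u"
      using V[OF u] by blast
    show "A (a *\<^sub>C u) x = a *\<^sub>C A u x"
      unfolding scaleC_fun_def
      by (rule A.op_scale[OF W(1,3,4)]) (use W(2) x closure_subset[of D] in blast)
  qed
  show ?thesis
    using bounded_iff_solvable[OF assms(16)] unfolding solves_def u_eps_def D_T_def .
qed

end
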